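(* Let $m\ge 2$ be an integer, let $n_1,\dots,n_m\ge 2$ be integers, and let $N=\prod_{j=1}^m n_j$. Let $\phi: M_N\rightarrow M_N$ be a (complex-)linear map. The following are equivalent. (a) $W(\phi(A_1\otimes\cdots\otimes A_m)) = W(A_1\otimes\cdots\otimes A_m)$ for all $(A_1,\dots,A_m)\in M_{n_1}\times\cdots\times M_{n_m}$. (b) There exist a unitary matrix $U\in M_N$ and maps $\varphi_k: M_{n_k}\to M_{n_k}$, $k=1,\dots,m$, each of which is either the identity map $X\mapsto X$ or the transposition map $X\mapsto X^t$, such that $$\phi(A_1\otimes\cdots\otimes A_m) = U(\varphi_1(A_1)\otimes\cdots\otimes\varphi_m(A_m))U^*$$ for all $(A_1,\dots,A_m)\in M_{n_1}\times\cdots\times M_{n_m}$, and the maps $\varphi_j$ for those indices $j$ with $n_j\ge 3$ are all of the same type (all identity maps or all transposition maps).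
   Context: $M_k$ denotes the set of $k\times k$ complex matrices. $\otimes$ denotes the tensor (Kronecker) product of matrices, so $A_1\otimes\cdots\otimes A_m\in M_N$. $X^t$ is the transpose and $X^*$ the conjugate transpose of $X$. For $A\in M_k$, the numerical range is $W(A)=\{u^*Au : u\in\mathbb{C}^k,\ u^*u=1\}\subseteq\mathbb{C}$. *)

theory Defs
  imports "Jordan_Normal_Form.VS_Connect" "Jordan_Normal_Form.Schur_Decomposition"
begin

definition kron :: "complex mat \<Rightarrow> complex mat \<Rightarrow> complex mat" where
  "kron A B = mat (dim_row A * dim_row B) (dim_col A * dim_col B)
     (\<lambda>(i, j). A $$ (i div dim_row B, j div dim_col B) * B $$ (i mod dim_row B, j mod dim_col B))"

text \<open>\<open>kron_prod A m\<close> is the product of \<open>A 1, \<dots>, A m\<close> in this order, bracketed to the left.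
  The empty product is the 1-by-1 identity, which is neutral for \<open>kron\<close>.\<close>

primrec kron_prod :: "(nat \<Rightarrow> complex mat) \<Rightarrow> nat \<Rightarrow> complex mat" where
  "kron_prod A 0 = 1\<^sub>m 1"
| "kron_prod A (Suc k) = kron (kron_prod A k) (A (Suc k))"

lemma kron_carrier [intro]:
  assumes "A \<in> carrier_mat r c" and "B \<in> carrier_mat r' c'"
  shows "kron A B \<in> carrier_mat (r * r') (c * c')"
  using assms by (auto simp: kron_def)

lemma kron_prod_carrier:
  assumes "\<forall>k\<in>{1..m}. A k \<in> carrier_mat (n k) (n k)"
  shows "kron_prod A m \<in> carrier_mat (\<Prod>k=1..m. n k) (\<Prod>k=1..m. n k)"
  using assms by (induction m) auto

lemma kron_one_left [simp]: "kron (1\<^sub>m 1) A = A"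
  by (rule eq_matI) (auto simp: kron_def)

text \<open>As \<open>v \<bullet>c w\<close> conjugates its second argument, \<open>(A *\<^sub>v u) \<bullet>c u\<close> is the number
  usually written as \<open>u\<close>-star times \<open>A u\<close>.\<close>

definition numerical_range :: "complex mat \<Rightarrow> complex set" where
  "numerical_range A = {(A *\<^sub>v u) \<bullet>c u | u. u \<in> carrier_vec (dim_row A) \<and> u \<bullet>c u = 1}"

definition unitary_mat :: "complex mat \<Rightarrow> bool" where
  "unitary_mat U \<longleftrightarrow>
     square_mat U \<and> inverts_mat U (mat_adjoint U) \<and> inverts_mat (mat_adjoint U) U"

text \<open>The type \<open>complex mat\<close> contains matrices of all sizes; a map on the k-by-k matrices is
  a function whose values outside \<open>carrier_mat k k\<close> are irrelevant.\<close>

definition is_identity_map :: "nat \<Rightarrow> (complex mat \<Rightarrow> complex mat) \<Rightarrow> bool" where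
  "is_identity_map k f \<longleftrightarrow> (\<forall>X\<in>carrier_mat k k. f X = X)"

definition is_transposition_map :: "nat \<Rightarrow> (complex mat \<Rightarrow> complex mat) \<Rightarrow> bool" where
  "is_transposition_map k f \<longleftrightarrow> (\<forall>X\<in>carrier_mat k k. f X = transpose_mat X)"

end

theory Submission
  imports Defs
begin

text \<open>
  That the maps of the standard form preserve numerical ranges rests on two facts: a matrix and its
  transpose have the same numerical range, and in dimension two every single matrix is unitarily
  similar to its transpose, so factors of dimension two may be transposed at will
  (\<open>numerical_range_partial_transpose\<close>).

  For the converse let \<open>\<phi>\<close> preserve the numerical range of all product matrices.  The images of the
  \<open>N\<close> diagonal matrix units are positive semidefinite, add up to the identity, and each attains the
  value \<open>1\<close> at a unit vector.  Such a vector is annihilated by all other images, so these vectors form an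
  orthonormal basis in which the images are again the diagonal matrix units
  (\<open>diagonalize_diagonal_units\<close>).  The same applies to every orthonormal product basis; hence
  \<open>\<phi>\<close> maps a product of Hermitian dyads to a matrix of rank one.  Polarising in one factor after the
  other shows that \<open>\<phi>\<close> maps every product of dyads, formed from \<open>2 * m\<close> independent vectors, to
  a matrix of rank at most one (\<open>rank_image_dyad\<close>), and this matrix is nonzero because a nonzero
  matrix has a numerical range different from \<open>{0}\<close>.

  A multilinear map with these properties has a rigid shape: each of its \<open>2 * m\<close> slots influences
  either only the column or only the row of the value, and which one does not depend on the other
  arguments (\<open>row_slot_independent\<close>; the heart is \<open>same_column_same_row_incompatible\<close>).  The
  diagonal matrix units show that the two slots of one factor have different types.  So there is a
  set of factors, those with the exchanged types, such that \<open>\<phi>\<close> sends every matrix unit to a multiple of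
  its partial transpose over this set (\<open>image_mat_unit_support\<close>).  The multiples are the entries of
  the image of the all-ones matrix, a Hermitian rank one matrix with unit diagonal; they are absorbed
  by a diagonal unitary matrix (\<open>image_of_kron\<close>).

  Finally, transposing one but not the other of two factors of dimension at least three changes some
  numerical range, as an explicit weighted shift shows
  (\<open>numerical_range_partial_transpose_differs\<close>).  Therefore all these factors have the same type.
\<close>

section \<open>Multi-indices of a Kronecker product\<close>

text \<open>The left-bracketed Kronecker product reads a row or column index in mixed radix notation, with the
  last factor as the least significant position.  Positions outside \<open>{1..m}\<close> get the digit \<open>0\<close>.\<close>

primrec digit :: "(nat \<Rightarrow> nat) \<Rightarrow> nat \<Rightarrow> nat \<Rightarrow> nat \<Rightarrow> nat" where
  "digit n 0 i k = 0"
| "digit n (Suc m) i k = (if k = Suc m then i mod n (Suc m) else digit n m (i div n (Suc m)) k)"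

lemma digit_less:
  assumes "\<forall>k\<in>{1..m}. n k > 0" and "k \<in> {1..m}"
  shows "digit n m i k < n k"
  using assms by (induction m arbitrary: i) auto

lemma digit_inject:
  assumes "\<forall>k\<in>{1..m}. n k > 0"
    and "i < (\<Prod>k=1..m. n k)" and "j < (\<Prod>k=1..m. n k)"
    and "\<And>k. k \<in> {1..m} \<Longrightarrow> digit n m i k = digit n m j k"
  shows "i = j"
  using assms
proof (induction m arbitrary: i j)
  case (Suc m)
  have last: "i mod n (Suc m) = j mod n (Suc m)"
    using Suc.prems(4)[of "Suc m"] by simp
  have "i div n (Suc m) = j div n (Suc m)"
  proof (rule Suc.IH)
    show "digit n m (i div n (Suc m)) k = digit n m (j div n (Suc m)) k" if "k \<in> {1..m}" for k
      using Suc.prems(4)[of k] that by simp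
    show "i div n (Suc m) < (\<Prod>k=1..m. n k)" "j div n (Suc m) < (\<Prod>k=1..m. n k)"
      using Suc.prems(2,3) by (simp_all add: less_mult_imp_div_less)
  qed (use Suc.prems(1) in auto)
  then show ?case using last by (metis div_mult_mod_eq)
qed simp

lemma digit_surj:
  assumes "\<forall>k\<in>{1..m}. f k < n k"
  shows "\<exists>i<(\<Prod>k=1..m. n k). \<forall>k\<in>{1..m}. digit n m i k = f k"
  using assms
proof (induction m)
  case (Suc m)
  then obtain i where i: "i < (\<Prod>k=1..m. n k)" "\<forall>k\<in>{1..m}. digit n m i k = f k" by auto
  have f: "f (Suc m) < n (Suc m)" using Suc.prems by simp
  have "i * n (Suc m) + f (Suc m) < (\<Prod>k=1..m. n k) * n (Suc m)"
  proof -
    have "i * n (Suc m) + f (Suc m) < (i + 1) * n (Suc m)" using f by simp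
    also have "\<dots> \<le> (\<Prod>k=1..m. n k) * n (Suc m)" using i(1) by (intro mult_right_mono) auto
    finally show ?thesis .
  qed
  moreover have "digit n (Suc m) (i * n (Suc m) + f (Suc m)) k = f k" if "k \<in> {1..Suc m}" for k
    using that f i(2) by (cases "k = Suc m") auto
  ultimately show ?case by (metis prod.nat_ivl_Suc' One_nat_def add.commute mult.commute plus_1_eq_Suc le_add1)
qed simp

text \<open>The distributive law over all digit vectors.  It is behind the mixed product rule and
  also computes the row and column sums of a Kronecker product factor by factor.\<close>

lemma sum_prod_digit:
  fixes f :: "nat \<Rightarrow> nat \<Rightarrow> 'a::comm_semiring_1"
  assumes "\<forall>k\<in>{1..m}. n k > 0"
  shows "(\<Sum>i=0..<(\<Prod>k=1..m. n k). \<Prod>k=1..m. f k (digit n m i k)) = (\<Prod>k=1..m. \<Sum>a=0..<n k. f k a)"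
  using assms
proof (induction m)
  case (Suc m)
  let ?M = "\<Prod>k=1..m. n k" and ?b = "n (Suc m)"
  let ?g = "\<lambda>i. \<Prod>k=1..Suc m. f k (digit n (Suc m) i k)"
  have g: "?g (q * ?b + r) = (\<Prod>k=1..m. f k (digit n m q k)) * f (Suc m) r" if "r < ?b" for q r
  proof -
    have "(\<Prod>k=1..m. f k (digit n (Suc m) (q * ?b + r) k)) = (\<Prod>k=1..m. f k (digit n m q k))"
      by (rule prod.cong) (use that in auto)
    then show ?thesis using that by simp
  qed
  have "(\<Sum>i<?M * ?b. ?g i) = (\<Sum>q<?M. \<Sum>i=q*?b..<q*?b+?b. ?g i)"
    by (simp add: sum.nat_group)
  also have "\<dots> = (\<Sum>q<?M. \<Sum>r=0..<?b. ?g (q * ?b + r))"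
  proof (rule sum.cong[OF refl])
    fix q
    show "(\<Sum>i=q*?b..<q*?b+?b. ?g i) = (\<Sum>r=0..<?b. ?g (q * ?b + r))"
      using sum.shift_bounds_nat_ivl[of ?g 0 "q*?b" ?b] by (simp add: add.commute)
  qed
  also have "\<dots> = (\<Sum>q<?M. \<Sum>r=0..<?b. (\<Prod>k=1..m. f k (digit n m q k)) * f (Suc m) r)"
    by (intro sum.cong refl g) simp
  also have "\<dots> = (\<Sum>q<?M. \<Prod>k=1..m. f k (digit n m q k)) * (\<Sum>r=0..<?b. f (Suc m) r)"
    by (simp add: sum_product)
  also have "(\<Sum>q<?M. \<Prod>k=1..m. f k (digit n m q k)) = (\<Prod>k=1..m. \<Sum>a=0..<n k. f k a)"
    using Suc by (simp add: atLeast0LessThan)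
  finally show ?case by (simp add: atLeast0LessThan)
qed simp

lemma kron_prod_index:
  assumes "\<forall>k\<in>{1..m}. A k \<in> carrier_mat (n k) (n k)"
    and "i < (\<Prod>k=1..m. n k)" and "j < (\<Prod>k=1..m. n k)"
  shows "kron_prod A m $$ (i, j) = (\<Prod>k=1..m. A k $$ (digit n m i k, digit n m j k))"
  using assms
proof (induction m arbitrary: i j)
  case (Suc m)
  let ?b = "n (Suc m)"
  have K: "kron_prod A m \<in> carrier_mat (\<Prod>k=1..m. n k) (\<Prod>k=1..m. n k)"
    using Suc.prems(1) by (intro kron_prod_carrier) auto
  have A: "A (Suc m) \<in> carrier_mat ?b ?b" using Suc.prems(1) by simp
  have div: "i div ?b < (\<Prod>k=1..m. n k)" "j div ?b < (\<Prod>k=1..m. n k)"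
    using Suc.prems(2,3) by (simp_all add: less_mult_imp_div_less)
  have "kron_prod A (Suc m) $$ (i, j)
      = kron_prod A m $$ (i div ?b, j div ?b) * A (Suc m) $$ (i mod ?b, j mod ?b)"
    using K A Suc.prems(2,3) by (simp add: kron_def)
  also have "kron_prod A m $$ (i div ?b, j div ?b)
      = (\<Prod>k=1..m. A k $$ (digit n m (i div ?b) k, digit n m (j div ?b) k))"
    using Suc.prems(1) div by (intro Suc.IH) auto
  also have "\<dots> = (\<Prod>k=1..m. A k $$ (digit n (Suc m) i k, digit n (Suc m) j k))"
    by (rule prod.cong) auto
  finally show ?case by simp
qed simp

text \<open>The mixed product rule: entrywise it is the distributive law for digit vectors.\<close>

lemma kron_prod_mult:
  assumes A: "\<forall>k\<in>{1..m}. A k \<in> carrier_mat (n k) (n k)"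
    and B: "\<forall>k\<in>{1..m}. B k \<in> carrier_mat (n k) (n k)"
    and pos: "\<forall>k\<in>{1..m}. n k > 0"
  shows "kron_prod (\<lambda>k. A k * B k) m = kron_prod A m * kron_prod B m"
proof (rule eq_matI)
  let ?N = "\<Prod>k=1..m. n k"
  have AB: "\<forall>k\<in>{1..m}. A k * B k \<in> carrier_mat (n k) (n k)" using A B by auto
  note car = kron_prod_carrier[OF A] kron_prod_carrier[OF B] kron_prod_carrier[OF AB]
  show "dim_row (kron_prod (\<lambda>k. A k * B k) m) = dim_row (kron_prod A m * kron_prod B m)"
    "dim_col (kron_prod (\<lambda>k. A k * B k) m) = dim_col (kron_prod A m * kron_prod B m)"
    using car by auto
  fix i j assume "i < dim_row (kron_prod A m * kron_prod B m)" "j < dim_col (kron_prod A m * kron_prod B m)"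
  then have ij: "i < ?N" "j < ?N" using car by auto
  have "kron_prod (\<lambda>k. A k * B k) m $$ (i, j)
      = (\<Prod>k=1..m. (A k * B k) $$ (digit n m i k, digit n m j k))"
    by (rule kron_prod_index[OF AB ij])
  also have "\<dots> = (\<Prod>k=1..m. \<Sum>a=0..<n k. A k $$ (digit n m i k, a) * B k $$ (a, digit n m j k))"
  proof (rule prod.cong[OF refl])
    fix k assume k: "k \<in> {1..m}"
    have "A k \<in> carrier_mat (n k) (n k)" "B k \<in> carrier_mat (n k) (n k)" using A B k by auto
    then show "(A k * B k) $$ (digit n m i k, digit n m j k)
        = (\<Sum>a=0..<n k. A k $$ (digit n m i k, a) * B k $$ (a, digit n m j k))"
      using digit_less[OF pos k] by (auto simp: scalar_prod_def intro!: sum.cong)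
  qed
  also have "\<dots> = (\<Sum>l=0..<?N. \<Prod>k=1..m. A k $$ (digit n m i k, digit n m l k) * B k $$ (digit n m l k, digit n m j k))"
    by (rule sum_prod_digit[OF pos, symmetric])
  also have "\<dots> = (\<Sum>l=0..<?N. kron_prod A m $$ (i, l) * kron_prod B m $$ (l, j))"
    using ij by (intro sum.cong) (auto simp: kron_prod_index[OF A] kron_prod_index[OF B] prod.distrib)
  also have "\<dots> = (kron_prod A m * kron_prod B m) $$ (i, j)"
    using ij car by (auto simp: scalar_prod_def intro!: sum.cong)
  finally show "kron_prod (\<lambda>k. A k * B k) m $$ (i, j) = (kron_prod A m * kron_prod B m) $$ (i, j)" .
qed

lemma kron_prod_cong:
  assumes "\<And>k. k \<in> {1..m} \<Longrightarrow> A k = B k"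
  shows "kron_prod A m = kron_prod B m"
  using assms by (induction m) auto

lemma kron_prod_one: "kron_prod (\<lambda>k. 1\<^sub>m (n k)) m = 1\<^sub>m (\<Prod>k=1..m. n k)"
proof (induction m)
  case (Suc m)
  have "kron (1\<^sub>m a) (1\<^sub>m b) = 1\<^sub>m (a * b)" for a b
  proof (rule eq_matI)
    fix i j assume "i < dim_row (1\<^sub>m (a * b))" "j < dim_col (1\<^sub>m (a * b))"
    then have ij: "i < a * b" "j < a * b" by auto
    then have "b > 0" by (cases b) auto
    moreover have "i div b < a" "j div b < a" using ij by (auto simp: less_mult_imp_div_less)
    moreover have "(i div b = j div b \<and> i mod b = j mod b) = (i = j)"
      by (metis div_mult_mod_eq)
    ultimately show "kron (1\<^sub>m a) (1\<^sub>m b) $$ (i, j) = 1\<^sub>m (a * b) $$ (i, j)"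
      using ij by (auto simp: kron_def)
  qed (auto simp: kron_def)
  then show ?case using Suc by simp
qed simp

lemma mat_adjoint_carrier [simp, intro]:
  "A \<in> carrier_mat r c \<Longrightarrow> mat_adjoint A \<in> carrier_mat c r"
  unfolding mat_adjoint_def by (auto simp: mat_of_rows_def)

lemma mat_adjoint_dim [simp]:
  "dim_row (mat_adjoint A) = dim_col A" "dim_col (mat_adjoint A) = dim_row A"
  unfolding mat_adjoint_def by (auto simp: mat_of_rows_def)

lemma mat_adjoint_index [simp]:
  fixes A :: "complex mat"
  shows "i < dim_col A \<Longrightarrow> j < dim_row A \<Longrightarrow> mat_adjoint A $$ (i, j) = cnj (A $$ (j, i))"
  unfolding mat_adjoint_def by (auto simp: mat_of_rows_def)

lemma kron_prod_adjoint:
  assumes A: "\<forall>k\<in>{1..m}. A k \<in> carrier_mat (n k) (n k)"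
    and pos: "\<forall>k\<in>{1..m}. n k > 0"
  shows "kron_prod (\<lambda>k. mat_adjoint (A k)) m = mat_adjoint (kron_prod A m)"
proof (rule eq_matI)
  let ?N = "\<Prod>k=1..m. n k"
  have A': "\<forall>k\<in>{1..m}. mat_adjoint (A k) \<in> carrier_mat (n k) (n k)" using A by auto
  note car = kron_prod_carrier[OF A] kron_prod_carrier[OF A']
  show "dim_row (kron_prod (\<lambda>k. mat_adjoint (A k)) m) = dim_row (mat_adjoint (kron_prod A m))"
    "dim_col (kron_prod (\<lambda>k. mat_adjoint (A k)) m) = dim_col (mat_adjoint (kron_prod A m))"
    using car by auto
  fix i j assume "i < dim_row (mat_adjoint (kron_prod A m))" "j < dim_col (mat_adjoint (kron_prod A m))"
  then have ij: "i < ?N" "j < ?N" using car by auto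
  have "mat_adjoint (A k) $$ (digit n m i k, digit n m j k) = cnj (A k $$ (digit n m j k, digit n m i k))"
    if k: "k \<in> {1..m}" for k
    using bspec[OF A k] digit_less[OF pos k, of i] digit_less[OF pos k, of j] by simp
  then show "kron_prod (\<lambda>k. mat_adjoint (A k)) m $$ (i, j) = mat_adjoint (kron_prod A m) $$ (i, j)"
    using ij car by (simp add: kron_prod_index[OF A'] kron_prod_index[OF A])
qed

lemma kron_prod_transpose:
  assumes A: "\<forall>k\<in>{1..m}. A k \<in> carrier_mat (n k) (n k)"
    and pos: "\<forall>k\<in>{1..m}. n k > 0"
  shows "kron_prod (\<lambda>k. transpose_mat (A k)) m = transpose_mat (kron_prod A m)"
proof (rule eq_matI)
  let ?N = "\<Prod>k=1..m. n k"
  have A': "\<forall>k\<in>{1..m}. transpose_mat (A k) \<in> carrier_mat (n k) (n k)" using A by auto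
  note car = kron_prod_carrier[OF A] kron_prod_carrier[OF A']
  show "dim_row (kron_prod (\<lambda>k. transpose_mat (A k)) m) = dim_row (transpose_mat (kron_prod A m))"
    "dim_col (kron_prod (\<lambda>k. transpose_mat (A k)) m) = dim_col (transpose_mat (kron_prod A m))"
    using car by auto
  fix i j assume "i < dim_row (transpose_mat (kron_prod A m))" "j < dim_col (transpose_mat (kron_prod A m))"
  then have ij: "i < ?N" "j < ?N" using car by auto
  have "transpose_mat (A k) $$ (digit n m i k, digit n m j k) = A k $$ (digit n m j k, digit n m i k)"
    if k: "k \<in> {1..m}" for k
    using bspec[OF A k] digit_less[OF pos k, of i] digit_less[OF pos k, of j] by simp
  then show "kron_prod (\<lambda>k. transpose_mat (A k)) m $$ (i, j) = transpose_mat (kron_prod A m) $$ (i, j)"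
    using ij car by (simp add: kron_prod_index[OF A'] kron_prod_index[OF A])
qed

section \<open>Adjoints, unitary matrices and numerical ranges\<close>

lemma mat_adjoint_adjoint [simp]: "mat_adjoint (mat_adjoint A) = (A :: complex mat)"
  by (rule eq_matI) auto

lemma mat_adjoint_mult:
  assumes "A \<in> carrier_mat r n" "B \<in> carrier_mat n c"
  shows "mat_adjoint (A * B) = mat_adjoint B * mat_adjoint (A :: complex mat)"
  using assms by (intro eq_matI) (auto simp: scalar_prod_def intro!: sum.cong)

lemma mult_carrier_square [simp]:
  "A \<in> carrier_mat n n \<Longrightarrow> B \<in> carrier_mat n n \<Longrightarrow> A * B \<in> carrier_mat n n"
  by auto

lemma cscalar_prod_sum: "x \<in> carrier_vec n \<Longrightarrow> y \<in> carrier_vec n \<Longrightarrow>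
    x \<bullet>c (y :: complex vec) = (\<Sum>i=0..<n. x $ i * cnj (y $ i))"
  by (auto simp: scalar_prod_def intro!: sum.cong)

lemma cscalar_prod_mat_sum: "M \<in> carrier_mat n n \<Longrightarrow> x \<in> carrier_vec n \<Longrightarrow> y \<in> carrier_vec n \<Longrightarrow>
    (M *\<^sub>v x) \<bullet>c (y :: complex vec) = (\<Sum>i=0..<n. \<Sum>j=0..<n. M $$ (i, j) * x $ j * cnj (y $ i))"
  by (auto simp: scalar_prod_def sum_distrib_right intro!: sum.cong)

lemma cscalar_prod_adjoint:
  fixes A :: "complex mat"
  assumes "A \<in> carrier_mat n n" "x \<in> carrier_vec n" "y \<in> carrier_vec n"
  shows "(A *\<^sub>v x) \<bullet>c y = x \<bullet>c (mat_adjoint A *\<^sub>v y)"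
proof -
  have "x \<bullet>c (mat_adjoint A *\<^sub>v y) = (\<Sum>j=0..<n. \<Sum>i=0..<n. x $ j * (A $$ (i, j) * cnj (y $ i)))"
    using assms by (auto simp: scalar_prod_def sum_distrib_left intro!: sum.cong)
  also have "\<dots> = (\<Sum>i=0..<n. \<Sum>j=0..<n. x $ j * (A $$ (i, j) * cnj (y $ i)))"
    by (rule sum.swap)
  also have "\<dots> = (A *\<^sub>v x) \<bullet>c y"
    using assms by (simp add: cscalar_prod_mat_sum ac_simps)
  finally show ?thesis by simp
qed

lemma cscalar_prod_commute:
  assumes "x \<in> carrier_vec n" "y \<in> carrier_vec n"
  shows "y \<bullet>c x = cnj (x \<bullet>c (y :: complex vec))"
  using assms by (simp add: cscalar_prod_sum ac_simps)

lemma cscalar_prod_self: "x \<in> carrier_vec n \<Longrightarrow> x \<bullet>c x = of_real (\<Sum>i=0..<n. (cmod (x $ i))\<^sup>2)"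
  by (simp add: cscalar_prod_sum complex_norm_square del: of_real_power)

lemma unitary_matI:
  assumes "U \<in> carrier_mat n n" "U * mat_adjoint U = 1\<^sub>m n"
  shows "unitary_mat U"
proof -
  have "mat_adjoint U * U = 1\<^sub>m n"
    using assms by (intro mat_mult_left_right_inverse[of U]) auto
  then show ?thesis using assms by (auto simp: unitary_mat_def inverts_mat_def)
qed

lemma unitary_matD:
  assumes "U \<in> carrier_mat n n" "unitary_mat U"
  shows "U * mat_adjoint U = 1\<^sub>m n" "mat_adjoint U * U = 1\<^sub>m n"
  using assms by (auto simp: unitary_mat_def inverts_mat_def)

lemma unitary_mat_one: "unitary_mat (1\<^sub>m n)"
proof (rule unitary_matI[of _ n])
  have "mat_adjoint (1\<^sub>m n) = (1\<^sub>m n :: complex mat)" by (rule eq_matI) auto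
  then show "1\<^sub>m n * mat_adjoint (1\<^sub>m n) = (1\<^sub>m n :: complex mat)" by simp
qed simp

lemma unitary_mat_adjoint:
  "U \<in> carrier_mat n n \<Longrightarrow> unitary_mat U \<Longrightarrow> unitary_mat (mat_adjoint U)"
  by (rule unitary_matI[of _ n]) (auto simp: unitary_matD)

lemma unitary_mat_mult:
  assumes U: "U \<in> carrier_mat n n" "unitary_mat U" and V: "V \<in> carrier_mat n n" "unitary_mat V"
  shows "unitary_mat (U * V)"
proof (rule unitary_matI[of _ n])
  have "U * V * mat_adjoint (U * V) = U * (V * mat_adjoint V) * mat_adjoint U"
    using U(1) V(1) by (simp add: mat_adjoint_mult assoc_mult_mat[of _ n n _ n _ n])
  then show "U * V * mat_adjoint (U * V) = 1\<^sub>m n"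
    using U V by (simp add: unitary_matD)
qed (use U V in auto)

lemma unitary_kron_prod:
  assumes U: "\<forall>k\<in>{1..m}. U k \<in> carrier_mat (n k) (n k)" "\<forall>k\<in>{1..m}. unitary_mat (U k)"
    and pos: "\<forall>k\<in>{1..m}. n k > 0"
  shows "unitary_mat (kron_prod U m)"
proof (rule unitary_matI)
  show "kron_prod U m \<in> carrier_mat (\<Prod>k=1..m. n k) (\<Prod>k=1..m. n k)"
    by (rule kron_prod_carrier[OF U(1)])
  have U': "\<forall>k\<in>{1..m}. mat_adjoint (U k) \<in> carrier_mat (n k) (n k)" using U by auto
  have "kron_prod U m * mat_adjoint (kron_prod U m) = kron_prod (\<lambda>k. U k * mat_adjoint (U k)) m"
    by (simp add: kron_prod_adjoint[OF U(1) pos] kron_prod_mult[OF U(1) U' pos])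
  also have "\<dots> = kron_prod (\<lambda>k. 1\<^sub>m (n k)) m"
    by (rule kron_prod_cong, rule unitary_matD(1)) (use U in auto)
  finally show "kron_prod U m * mat_adjoint (kron_prod U m) = 1\<^sub>m (\<Prod>k=1..m. n k)"
    by (simp add: kron_prod_one)
qed

lemma kron_prod_conjugation:
  assumes U: "\<forall>k\<in>{1..m}. U k \<in> carrier_mat (n k) (n k)"
    and A: "\<forall>k\<in>{1..m}. A k \<in> carrier_mat (n k) (n k)"
    and pos: "\<forall>k\<in>{1..m}. n k > 0"
  shows "kron_prod (\<lambda>k. U k * A k * mat_adjoint (U k)) m
    = kron_prod U m * kron_prod A m * mat_adjoint (kron_prod U m)"
proof -
  have UA: "\<forall>k\<in>{1..m}. U k * A k \<in> carrier_mat (n k) (n k)" using U A by auto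
  have U': "\<forall>k\<in>{1..m}. mat_adjoint (U k) \<in> carrier_mat (n k) (n k)" using U by auto
  show ?thesis
    by (simp add: kron_prod_mult[OF UA U' pos] kron_prod_mult[OF U A pos] kron_prod_adjoint[OF U pos])
qed

lemma numerical_range_iff:
  assumes "M \<in> carrier_mat n n"
  shows "z \<in> numerical_range M \<longleftrightarrow> (\<exists>u\<in>carrier_vec n. u \<bullet>c u = 1 \<and> z = (M *\<^sub>v u) \<bullet>c u)"
  using assms by (auto simp: numerical_range_def)

lemma numerical_range_unitary_subset:
  assumes M: "M \<in> carrier_mat n n" and U: "U \<in> carrier_mat n n" "unitary_mat U"
  shows "numerical_range (U * M * mat_adjoint U) \<subseteq> numerical_range M"
proof
  let ?U = "mat_adjoint U"
  have car: "U * M * ?U \<in> carrier_mat n n" "?U \<in> carrier_mat n n" using M U by auto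
  fix z assume "z \<in> numerical_range (U * M * ?U)"
  then obtain u where u: "u \<in> carrier_vec n" "u \<bullet>c u = 1" and z: "z = ((U * M * ?U) *\<^sub>v u) \<bullet>c u"
    using car numerical_range_iff by metis
  let ?v = "?U *\<^sub>v u"
  have v: "?v \<in> carrier_vec n" using car u by auto
  have Uv: "U *\<^sub>v ?v = u"
    using u U car by (simp add: assoc_mult_mat_vec[symmetric, of U n n ?U n] unitary_matD)
  have "z = (U *\<^sub>v (M *\<^sub>v ?v)) \<bullet>c u"
    unfolding z using M U(1) u v by (simp add: assoc_mult_mat_vec[of _ n n _ n] car)
  also have "\<dots> = (M *\<^sub>v ?v) \<bullet>c ?v"
    using M U u v by (intro cscalar_prod_adjoint) auto
  finally have "z = (M *\<^sub>v ?v) \<bullet>c ?v" .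
  moreover have "?v \<bullet>c ?v = 1"
    using cscalar_prod_adjoint[OF U(1) v u(1)] Uv u(2) by simp
  ultimately show "z \<in> numerical_range M" using v M numerical_range_iff by metis
qed

lemma numerical_range_unitary:
  assumes M: "M \<in> carrier_mat n n" and U: "U \<in> carrier_mat n n" "unitary_mat U"
  shows "numerical_range (U * M * mat_adjoint U) = numerical_range M"
proof
  have car: "U * M * mat_adjoint U \<in> carrier_mat n n" "mat_adjoint U \<in> carrier_mat n n"
    using M U by auto
  have "mat_adjoint U * (U * M * mat_adjoint U) * U
      = (mat_adjoint U * U) * M * (mat_adjoint U * U)"
    using M U by (simp add: assoc_mult_mat[of _ n n _ n _ n])
  also have "\<dots> = M" using M U by (simp add: unitary_matD)
  finally show "numerical_range M \<subseteq> numerical_range (U * M * mat_adjoint U)"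
    using numerical_range_unitary_subset[OF car unitary_mat_adjoint[OF U]] by simp
qed (rule numerical_range_unitary_subset[OF assms])

lemma numerical_range_transpose_subset:
  assumes M: "M \<in> carrier_mat n n"
  shows "numerical_range (transpose_mat M) \<subseteq> numerical_range M"
proof
  have M': "transpose_mat M \<in> carrier_mat n n" using M by simp
  fix z assume "z \<in> numerical_range (transpose_mat M)"
  then obtain u where u: "u \<in> carrier_vec n" "u \<bullet>c u = 1" and z: "z = (transpose_mat M *\<^sub>v u) \<bullet>c u"
    using M' numerical_range_iff by metis
  have "z = (\<Sum>i=0..<n. \<Sum>j=0..<n. M $$ (j, i) * u $ j * cnj (u $ i))"
    unfolding z using M u by (simp add: cscalar_prod_mat_sum)
  also have "\<dots> = (\<Sum>j=0..<n. \<Sum>i=0..<n. M $$ (j, i) * u $ j * cnj (u $ i))"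
    by (rule sum.swap)
  also have "\<dots> = (M *\<^sub>v conjugate u) \<bullet>c conjugate u"
    using M u by (subst cscalar_prod_mat_sum) (auto simp: ac_simps)
  finally have "z = (M *\<^sub>v conjugate u) \<bullet>c conjugate u" .
  moreover have "conjugate u \<bullet>c conjugate u = 1"
    using u by (subst cscalar_prod_sum[of _ n]) (auto simp: cscalar_prod_sum[of _ n] mult.commute)
  ultimately show "z \<in> numerical_range M"
    using u M numerical_range_iff carrier_vec_conjugate by metis
qed

lemma numerical_range_transpose:
  assumes M: "M \<in> carrier_mat n n"
  shows "numerical_range (transpose_mat M) = numerical_range M"
  using numerical_range_transpose_subset[OF M] numerical_range_transpose_subset[of "transpose_mat M" n] M
  by auto

text \<open>Rayleigh quotients of vectors that need not be normalised.\<close>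

lemma numerical_range_homogeneous:
  assumes M: "M \<in> carrier_mat n n" and v: "v \<in> carrier_vec n" "v \<noteq> 0\<^sub>v n"
  shows "((M *\<^sub>v v) \<bullet>c v) / (v \<bullet>c v) \<in> numerical_range M"
proof -
  define s where "s = (\<Sum>i=0..<n. (cmod (v $ i))\<^sup>2)"
  have vv: "v \<bullet>c v = of_real s" using cscalar_prod_self[OF v(1)] by (simp add: s_def)
  have "s \<ge> 0" by (simp add: s_def sum_nonneg)
  moreover have "s \<noteq> 0" using vv v by (metis conjugate_square_eq_0_vec of_real_0)
  ultimately have s: "s > 0" by simp
  define c where "c = complex_of_real (1 / sqrt s)"
  have cc: "c * cnj c = 1 / of_real s"
    using s by (simp add: c_def flip: of_real_mult)
  let ?u = "c \<cdot>\<^sub>v v"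
  have u: "?u \<in> carrier_vec n" using v by simp
  have "?u \<bullet>c ?u = c * cnj c * (v \<bullet>c v)"
    using v by (simp add: cscalar_prod_sum[of _ n] sum_distrib_left ac_simps)
  moreover have "(M *\<^sub>v ?u) \<bullet>c ?u = c * cnj c * ((M *\<^sub>v v) \<bullet>c v)"
    using v M by (simp add: cscalar_prod_mat_sum[of _ n] sum_distrib_left ac_simps)
  ultimately have "?u \<bullet>c ?u = 1" "(M *\<^sub>v ?u) \<bullet>c ?u = ((M *\<^sub>v v) \<bullet>c v) / (v \<bullet>c v)"
    using cc vv s by auto
  then show ?thesis using u M numerical_range_iff by metis
qed

lemma cscalar_prod_sandwich:
  fixes M :: "complex mat"
  assumes "M \<in> carrier_mat n n" "a < n" "b < n"
  shows "(M *\<^sub>v unit_vec n b) \<bullet>c unit_vec n a = M $$ (a, b)"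
proof -
  have "(M *\<^sub>v unit_vec n b) \<bullet>c unit_vec n a
      = (\<Sum>i=0..<n. \<Sum>j=0..<n. if i = a then (if j = b then M $$ (i, j) else 0) else 0)"
    using assms by (subst cscalar_prod_mat_sum) (auto simp: unit_vec_def simp del: sum.delta intro!: sum.cong)
  also have "\<dots> = (\<Sum>i=0..<n. if i = a then (\<Sum>j=0..<n. if j = b then M $$ (i, j) else 0) else 0)"
    by (intro sum.cong refl) auto
  also have "\<dots> = M $$ (a, b)" using assms by simp
  finally show ?thesis .
qed

lemma quadratic_form_add_smult:
  fixes M :: "complex mat"
  assumes M: "M \<in> carrier_mat n n" and x: "x \<in> carrier_vec n" and y: "y \<in> carrier_vec n"
  shows "(M *\<^sub>v (x + s \<cdot>\<^sub>v y)) \<bullet>c (x + s \<cdot>\<^sub>v y)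
    = (M *\<^sub>v x) \<bullet>c x + s * ((M *\<^sub>v y) \<bullet>c x) + cnj s * ((M *\<^sub>v x) \<bullet>c y)
      + s * cnj s * ((M *\<^sub>v y) \<bullet>c y)"
proof -
  have "x + s \<cdot>\<^sub>v y \<in> carrier_vec n" using x y by simp
  note sums = cscalar_prod_mat_sum[OF M this this] cscalar_prod_mat_sum[OF M x x]
    cscalar_prod_mat_sum[OF M y x] cscalar_prod_mat_sum[OF M x y] cscalar_prod_mat_sum[OF M y y]
  show ?thesis
    unfolding sums sum_distrib_left sum.distrib[symmetric]
    using x y by (intro sum.cong refl) (auto simp: algebra_simps)
qed

text \<open>Polarisation over the complex numbers: testing the form on the sum of two basis vectors with
  the coefficients \<open>1\<close> and \<open>\<i>\<close> separates the two mixed entries.\<close>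

lemma quadratic_form_zero_imp_zero:
  fixes M :: "complex mat"
  assumes M: "M \<in> carrier_mat n n"
    and q: "\<And>u. u \<in> carrier_vec n \<Longrightarrow> (M *\<^sub>v u) \<bullet>c u = 0"
  shows "M = 0\<^sub>m n n"
proof (rule eq_matI)
  fix a b assume "a < dim_row (0\<^sub>m n n)" "b < dim_col (0\<^sub>m n n)"
  then have ab: "a < n" "b < n" by auto
  have pol: "cnj s * M $$ (a, b) + s * M $$ (b, a) = 0" for s
  proof -
    let ?x = "unit_vec n b :: complex vec" and ?y = "unit_vec n a :: complex vec"
    have xy: "?x \<in> carrier_vec n" "?y \<in> carrier_vec n" by auto
    let ?u = "?x + s \<cdot>\<^sub>v ?y"
    note quadratic_form_add_smult[OF M xy, of s]
    then show ?thesis using q[of ?x] q[of ?y] q[of ?u] xy ab M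
      by (simp add: cscalar_prod_sandwich add.commute)
  qed
  have "M $$ (b, a) = - M $$ (a, b)" using pol[of 1] by (simp add: eq_neg_iff_add_eq_0 add.commute)
  then have "\<i> * (2 * M $$ (a, b)) = 0" using pol[of \<i>] by (simp add: algebra_simps)
  then have "M $$ (a, b) = 0" by simp
  then show "M $$ (a, b) = 0\<^sub>m n n $$ (a, b)" using ab by simp
qed (use M in auto)

lemma numerical_range_zero_imp_zero:
  assumes M: "M \<in> carrier_mat n n" and W: "numerical_range M \<subseteq> {0}"
  shows "M = 0\<^sub>m n n"
proof (rule quadratic_form_zero_imp_zero[OF M])
  fix u :: "complex vec" assume u: "u \<in> carrier_vec n"
  show "(M *\<^sub>v u) \<bullet>c u = 0"
  proof (cases "u = 0\<^sub>v n")
    case True then show ?thesis using M by simp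
  next
    case False
    then have "((M *\<^sub>v u) \<bullet>c u) / (u \<bullet>c u) = 0" using numerical_range_homogeneous[OF M u] W by auto
    then show ?thesis using False u by simp
  qed
qed

text \<open>The form of the difference of the adjoint and the matrix is \<open>-2 * \<i>\<close> times the imaginary part of
  the form of the matrix, so it vanishes.\<close>

lemma numerical_range_real_imp_hermitian:
  assumes M: "M \<in> carrier_mat n n" and W: "numerical_range M \<subseteq> \<real>"
  shows "mat_adjoint M = M"
proof -
  let ?D = "mat_adjoint M - M"
  have M': "mat_adjoint M \<in> carrier_mat n n" using M by simp
  have D: "?D \<in> carrier_mat n n" using M by (simp add: minus_carrier_mat)
  have "?D = 0\<^sub>m n n"
  proof (rule numerical_range_zero_imp_zero[OF D], rule subsetI)
    fix z assume "z \<in> numerical_range ?D"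
    then obtain u where u: "u \<in> carrier_vec n" "u \<bullet>c u = 1" and z: "z = (?D *\<^sub>v u) \<bullet>c u"
      using D numerical_range_iff by metis
    have "z = (mat_adjoint M *\<^sub>v u) \<bullet>c u - (M *\<^sub>v u) \<bullet>c u"
      unfolding z using M M' D u
      by (simp add: cscalar_prod_mat_sum[of _ n] algebra_simps sum_subtractf)
    also have "(mat_adjoint M *\<^sub>v u) \<bullet>c u = cnj ((M *\<^sub>v u) \<bullet>c u)"
      using cscalar_prod_adjoint[OF M' u(1) u(1)] cscalar_prod_commute[of "M *\<^sub>v u" n u] u M
      by simp
    also have "(M *\<^sub>v u) \<bullet>c u \<in> \<real>" using W u M numerical_range_iff by blast
    then have "cnj ((M *\<^sub>v u) \<bullet>c u) - (M *\<^sub>v u) \<bullet>c u = 0" by (simp add: complex_is_Real_iff complex_eq_iff)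
    finally show "z \<in> {0}" by simp
  qed
  then have "?D $$ (i, j) = 0" if "i < n" "j < n" for i j using that by simp
  then show ?thesis using M by (intro eq_matI) auto
qed

section \<open>Multilinear maps into matrices of rank one\<close>

definition outer :: "(nat \<Rightarrow> complex) \<Rightarrow> (nat \<Rightarrow> complex) \<Rightarrow> nat \<Rightarrow> nat \<Rightarrow> complex" where
  "outer g h = (\<lambda>a b. g a * h b)"

definition parallel :: "(nat \<Rightarrow> complex) \<Rightarrow> (nat \<Rightarrow> complex) \<Rightarrow> bool" where
  "parallel g h \<longleftrightarrow> (\<forall>a b. g a * h b = g b * h a)"

text \<open>Rank at most one is expressed by the vanishing of all \<open>2\<times>2\<close> minors, because polynomial identities
  can be polarised.  The two relations below compare the column spaces and the row spaces of two
  such matrices in the same cross-multiplied form; a zero matrix is related to everything.\<close>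

definition rank_le_one :: "(nat \<Rightarrow> nat \<Rightarrow> complex) \<Rightarrow> bool" where
  "rank_le_one P \<longleftrightarrow> (\<forall>a b c d. P a b * P c d = P a d * P c b)"

definition same_column :: "(nat \<Rightarrow> nat \<Rightarrow> complex) \<Rightarrow> (nat \<Rightarrow> nat \<Rightarrow> complex) \<Rightarrow> bool" where
  "same_column P Q \<longleftrightarrow> (\<forall>a b c d. P a b * Q c d = P c b * Q a d)"

definition same_row :: "(nat \<Rightarrow> nat \<Rightarrow> complex) \<Rightarrow> (nat \<Rightarrow> nat \<Rightarrow> complex) \<Rightarrow> bool" where
  "same_row P Q \<longleftrightarrow> (\<forall>a b c d. P a b * Q c d = P a d * Q c b)"

lemma parallel_sym: "parallel g h \<Longrightarrow> parallel h g"
  unfolding parallel_def by (metis mult.commute)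

lemma parallel_trans: "parallel x g \<Longrightarrow> parallel g y \<Longrightarrow> g a \<noteq> 0 \<Longrightarrow> parallel x y"
proof -
  assume x: "parallel x g" and y: "parallel g y" and a: "g a \<noteq> 0"
  have "g a * (g a * (x b * y c)) = g a * (g a * (x c * y b))" for b c
  proof -
    have "g a * (g a * (x b * y c)) = (x b * g a) * (g a * y c)" by simp
    also have "\<dots> = (x a * g b) * (g c * y a)" using x y unfolding parallel_def by metis
    also have "\<dots> = (x a * g c) * (g b * y a)" by simp
    also have "\<dots> = (x c * g a) * (g a * y b)" using x y unfolding parallel_def by metis
    finally show ?thesis by simp
  qed
  then show "parallel x y" using a by (simp add: parallel_def)
qed

lemma parallel_add_cancel:
  "parallel g (\<lambda>a. x a + y a) \<Longrightarrow> parallel g x \<Longrightarrow> parallel g y"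
  unfolding parallel_def by (metis add_left_cancel distrib_left)

lemma parallel_add_cancel': "parallel g (\<lambda>a. x a + y a) \<Longrightarrow> parallel g y \<Longrightarrow> parallel g x"
  unfolding parallel_def by (metis add_right_cancel distrib_left)

lemma rank_le_oneE:
  assumes "rank_le_one P"
  obtains g h where "P = outer g h"
proof (cases "\<exists>a b. P a b \<noteq> 0")
  case True
  then obtain a0 b0 where ne: "P a0 b0 \<noteq> 0" by auto
  have "P = outer (\<lambda>a. P a b0) (\<lambda>b. P a0 b / P a0 b0)"
  proof (intro ext)
    fix a b
    have "P a0 b0 * P a b = P a0 b * P a b0" using assms unfolding rank_le_one_def by metis
    then show "P a b = outer (\<lambda>a. P a b0) (\<lambda>b. P a0 b / P a0 b0) a b"
      using ne by (simp add: outer_def field_simps)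
  qed
  then show ?thesis by (rule that)
next
  case False
  then have "P = outer (\<lambda>_. 0) (\<lambda>_. 0)" by (auto simp: outer_def)
  then show ?thesis by (rule that)
qed

text \<open>A minor of the sum of two dyads is a minor of the pair of columns times a minor of the pair
  of rows.\<close>

lemma rank_le_one_outer_sum:
  assumes "rank_le_one (\<lambda>a b. outer g h a b + outer g' h' a b)"
  shows "parallel g g' \<or> parallel h h'"
proof (rule ccontr)
  assume "\<not> (parallel g g' \<or> parallel h h')"
  then obtain a c b d where "g a * g' c \<noteq> g c * g' a" "h b * h' d \<noteq> h d * h' b"
    unfolding parallel_def by blast
  then have "(g a * g' c - g c * g' a) * (h b * h' d - h d * h' b) \<noteq> 0" by simp
  moreover have "(g a * g' c - g c * g' a) * (h b * h' d - h d * h' b) = 0"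
    using assms[unfolded rank_le_one_def, rule_format, of a b c d]
    by (simp add: outer_def algebra_simps)
  ultimately show False by simp
qed

lemma same_column_outer: "parallel g g' \<Longrightarrow> same_column (outer g h) (outer g' h')"
  by (simp add: parallel_def same_column_def outer_def algebra_simps)

lemma same_column_outerD:
  "same_column (outer g h) (outer g' h') \<Longrightarrow> h b \<noteq> 0 \<Longrightarrow> h' d \<noteq> 0 \<Longrightarrow> parallel g g'"
proof -
  assume s: "same_column (outer g h) (outer g' h')" and ne: "h b \<noteq> 0" "h' d \<noteq> 0"
  have "(g a * g' c) * (h b * h' d) = (g c * g' a) * (h b * h' d)" for a c
    using s[unfolded same_column_def, rule_format, of a b c d] by (simp add: outer_def ac_simps)
  then show ?thesis using ne by (simp add: parallel_def)
qed

text \<open>Transposition exchanges the roles of rows and columns, so facts about columns transfer to rows.\<close>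

definition flip :: "(nat \<Rightarrow> nat \<Rightarrow> complex) \<Rightarrow> nat \<Rightarrow> nat \<Rightarrow> complex" where
  "flip P = (\<lambda>a b. P b a)"

lemma same_column_flip [simp]: "same_column (flip P) (flip Q) = same_row P Q"
  unfolding same_column_def same_row_def flip_def by auto

lemma same_row_flip [simp]: "same_row (flip P) (flip Q) = same_column P Q"
  unfolding same_column_def same_row_def flip_def by auto

lemma rank_le_one_flip [simp]: "rank_le_one (flip P) = rank_le_one P"
  unfolding rank_le_one_def flip_def by (auto simp: mult.commute)

lemma flip_outer: "flip (outer g h) = outer h g"
  by (simp add: flip_def outer_def mult.commute)

lemma same_row_outer: "parallel h h' \<Longrightarrow> same_row (outer g h) (outer g' h')"
  using same_column_outer[of h h' g g'] same_column_flip[of "outer g h" "outer g' h'"]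
  by (simp add: flip_outer)

lemma same_column_sym: "same_column P Q \<Longrightarrow> same_column Q P"
  unfolding same_column_def by (metis mult.commute)

lemma same_column_refl: "rank_le_one P \<Longrightarrow> same_column P P"
  unfolding same_column_def rank_le_one_def by (metis mult.commute)

lemma same_column_trans:
  assumes "same_column P Q" "same_column Q R" "Q a b \<noteq> 0"
  shows "same_column P R"
proof -
  have "Q a b * (Q a b * (P x y * R z t)) = Q a b * (Q a b * (P z y * R x t))" for x y z t
  proof -
    have "Q a b * (Q a b * (P x y * R z t)) = (P x y * Q a b) * (Q a b * R z t)" by simp
    also have "\<dots> = (P a y * Q x b) * (Q z b * R a t)" using assms unfolding same_column_def by metis
    also have "\<dots> = (P a y * Q z b) * (Q x b * R a t)" by simp
    also have "\<dots> = (P z y * Q a b) * (Q a b * R x t)" using assms unfolding same_column_def by metis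
    finally show ?thesis by simp
  qed
  then show ?thesis using assms(3) by (simp add: same_column_def)
qed

lemma outer_nonzero: "outer g h \<noteq> (\<lambda>_ _. 0) \<longleftrightarrow> (\<exists>a. g a \<noteq> 0) \<and> (\<exists>b. h b \<noteq> 0)"
  by (auto simp: outer_def fun_eq_iff)

lemma same_column_or_same_row:
  assumes "rank_le_one P" "rank_le_one Q" "rank_le_one (\<lambda>a b. P a b + Q a b)"
  shows "same_column P Q \<or> same_row P Q"
proof -
  obtain g h g' h' where "P = outer g h" "Q = outer g' h'" using assms(1,2) by (metis rank_le_oneE)
  then show ?thesis
    using assms(3) rank_le_one_outer_sum[of g h g' h'] same_column_outer same_row_outer by blast
qed

lemma same_column_and_same_row:
  assumes "same_column P Q" "same_row P Q" "P a b \<noteq> 0"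
  shows "\<exists>c. Q = (\<lambda>x y. c * P x y)"
proof (intro exI ext)
  fix x y
  have "P a b * Q x y = P x b * Q a y" using assms(1) by (simp add: same_column_def)
  moreover have "P x y * Q a b = P x b * Q a y" using assms(2) unfolding same_row_def by metis
  ultimately have "P a b * Q x y = P x y * Q a b" by simp
  then show "Q x y = Q a b / P a b * P x y" using assms(3) by (simp add: field_simps)
qed

text \<open>A third matrix that is compatible with two matrices sharing their column, but not their
  row, has to share that column as well: otherwise its row is parallel to both rows.\<close>

lemma same_column_third:
  assumes rank: "rank_le_one P" "rank_le_one Q" "rank_le_one R"
    and ne: "P \<noteq> (\<lambda>_ _. 0)" "Q \<noteq> (\<lambda>_ _. 0)" "R \<noteq> (\<lambda>_ _. 0)"
    and sum: "rank_le_one (\<lambda>a b. P a b + R a b)" "rank_le_one (\<lambda>a b. Q a b + R a b)"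
    and PQ: "same_column P Q" "\<not> same_row P Q"
  shows "same_column P R"
proof -
  obtain g1 h1 g2 h2 g h where outer: "P = outer g1 h1" "Q = outer g2 h2" "R = outer g h"
    using rank by (metis rank_le_oneE)
  obtain a1 b1 a2 b2 a b where nz: "g1 a1 \<noteq> 0" "h1 b1 \<noteq> 0" "g2 a2 \<noteq> 0" "h2 b2 \<noteq> 0" "g a \<noteq> 0" "h b \<noteq> 0"
    using ne unfolding outer outer_nonzero by auto
  have "parallel g1 g2" using PQ(1) nz unfolding outer by (metis same_column_outerD)
  moreover have "\<not> parallel h1 h2" using PQ(2) unfolding outer by (metis same_row_outer)
  moreover have "parallel g1 g \<or> parallel h1 h" "parallel g2 g \<or> parallel h2 h"
    using sum rank_le_one_outer_sum unfolding outer by blast+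
  ultimately have "parallel g1 g"
    using nz by (metis parallel_sym parallel_trans)
  then show ?thesis unfolding outer by (rule same_column_outer)
qed

text \<open>Write \<open>P\<close>, \<open>Q\<close> as a common column \<open>g\<close> times rows \<open>h1\<close>, \<open>h2\<close> and \<open>R\<close>, \<open>T\<close> as columns \<open>g1\<close>, \<open>g2\<close> times a common row \<open>h\<close>.
  Rank one of the sums makes \<open>g\<close> parallel to \<open>g1\<close> or \<open>h\<close> parallel to \<open>h1\<close>, and likewise for the second pair;
  neither the two columns nor the two rows can both be chosen.  With one of each kind, the sum of
  all four matrices has rank two.\<close>

lemma same_column_same_row_incompatible:
  assumes rank: "rank_le_one P" "rank_le_one Q" "rank_le_one R" "rank_le_one T"
    and ne: "P \<noteq> (\<lambda>_ _. 0)" "Q \<noteq> (\<lambda>_ _. 0)" "R \<noteq> (\<lambda>_ _. 0)" "T \<noteq> (\<lambda>_ _. 0)"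
    and sum: "rank_le_one (\<lambda>a b. P a b + R a b)" "rank_le_one (\<lambda>a b. Q a b + T a b)"
      "rank_le_one (\<lambda>a b. (P a b + Q a b) + (R a b + T a b))"
    and PQ: "same_column P Q" "\<not> same_row P Q"
    and RT: "same_row R T" "\<not> same_column R T"
  shows False
proof -
  obtain g h1 where P: "P = outer g h1" using rank by (metis rank_le_oneE)
  obtain g1 h where R: "R = outer g1 h" using rank by (metis rank_le_oneE)
  obtain a0 b0 where ab0: "P a0 b0 \<noteq> 0" using ne(1) by (auto simp: fun_eq_iff)
  define h2 where "h2 = (\<lambda>d. h1 b0 * Q a0 d / P a0 b0)"
  have Q: "Q = outer g h2"
  proof (intro ext)
    fix c d
    have "P a0 b0 * Q c d = P c b0 * Q a0 d" using PQ(1) unfolding same_column_def by metis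
    then show "Q c d = outer g h2 c d"
      using ab0 P by (auto simp: outer_def h2_def field_simps)
  qed
  obtain a1 b1 where ab1: "R a1 b1 \<noteq> 0" using ne(3) by (auto simp: fun_eq_iff)
  define g2 where "g2 = (\<lambda>c. g1 a1 * T c b1 / R a1 b1)"
  have T: "T = outer g2 h"
  proof (intro ext)
    fix c d
    have "R a1 b1 * T c d = R a1 d * T c b1" using RT(1) unfolding same_row_def by metis
    then show "T c d = outer g2 h c d"
      using ab1 R by (auto simp: outer_def g2_def field_simps)
  qed
  have nz: "\<exists>a. g a \<noteq> 0" "\<exists>b. h b \<noteq> 0"
    using ne unfolding P R outer_nonzero by auto
  have h: "\<not> parallel h1 h2" using PQ(2) unfolding P Q by (metis same_row_outer)
  have g: "\<not> parallel g1 g2" using RT(2) unfolding R T by (metis same_column_outer)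
  have 1: "parallel g g1 \<or> parallel h h1"
    using sum(1) rank_le_one_outer_sum parallel_sym unfolding P R by blast
  have 2: "parallel g g2 \<or> parallel h h2"
    using sum(2) rank_le_one_outer_sum parallel_sym unfolding Q T by blast
  have "rank_le_one (\<lambda>a b. outer g (\<lambda>b. h1 b + h2 b) a b + outer (\<lambda>a. g1 a + g2 a) h a b)"
    using sum(3) unfolding P Q R T by (simp add: outer_def algebra_simps)
  then have 3: "parallel g (\<lambda>a. g1 a + g2 a) \<or> parallel h (\<lambda>b. h1 b + h2 b)"
    using rank_le_one_outer_sum parallel_sym by blast
  have g': "\<not> (parallel g g1 \<and> parallel g g2)" using g nz by (metis parallel_sym parallel_trans)
  have h': "\<not> (parallel h h1 \<and> parallel h h2)" using h nz by (metis parallel_sym parallel_trans)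
  show False using 1 2 3 g' h' parallel_add_cancel parallel_add_cancel' by blast
qed

lemma nonzero_entryE:
  assumes "P \<noteq> (\<lambda>_ _. 0)"
  obtains a b where "P a b \<noteq> (0 :: complex)"
  using assms by (auto simp: fun_eq_iff)

text \<open>A map that is linear in each of finitely many vector arguments (slots), has values of rank
  at most one, and is nonzero as soon as all arguments are.  Its value is, up to a scalar, a column
  depending on some of the slots times a row depending on the others; the lemmas in the locale
  establish this for arguments that are basis vectors.\<close>

locale rank_one_multilinear =
  fixes S :: "'s set" and d :: "'s \<Rightarrow> nat" and \<Psi> :: "('s \<Rightarrow> nat \<Rightarrow> complex) \<Rightarrow> nat \<Rightarrow> nat \<Rightarrow> complex"
  assumes finite_slots: "finite S"
    and two_dimensional: "s \<in> S \<Longrightarrow> d s \<ge> 2"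
    and linear: "s \<in> S \<Longrightarrow> \<Psi> (w(s := \<lambda>i. x i + c * y i))
      = (\<lambda>a b. \<Psi> (w(s := x)) a b + c * \<Psi> (w(s := y)) a b)"
    and locality: "(\<And>s. s \<in> S \<Longrightarrow> w s = w' s) \<Longrightarrow> \<Psi> w = \<Psi> w'"
    and rank: "rank_le_one (\<Psi> w)"
    and nonzero: "(\<And>s. s \<in> S \<Longrightarrow> \<exists>i<d s. w s i \<noteq> 0) \<Longrightarrow> \<Psi> w \<noteq> (\<lambda>_ _. 0)"
begin

abbreviation basis :: "nat \<Rightarrow> nat \<Rightarrow> complex" where
  "basis a \<equiv> (\<lambda>i. if i = a then 1 else 0)"

definition unit_value :: "('s \<Rightarrow> nat) \<Rightarrow> nat \<Rightarrow> nat \<Rightarrow> complex" where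
  "unit_value p = \<Psi> (\<lambda>s. basis (p s))"

definition valid :: "('s \<Rightarrow> nat) \<Rightarrow> bool" where
  "valid p \<longleftrightarrow> (\<forall>s\<in>S. p s < d s)"

lemma valid_upd: "valid p \<Longrightarrow> s \<in> S \<Longrightarrow> a < d s \<Longrightarrow> valid (p(s := a))"
  by (simp add: valid_def)

lemma basis_upd: "(\<lambda>t. basis ((p(s := a)) t)) = (\<lambda>t. basis (p t))(s := basis a)"
  by auto

lemma rank_unit: "rank_le_one (unit_value p)"
  by (simp add: unit_value_def rank)

lemma unit_nonzero: "valid p \<Longrightarrow> unit_value p \<noteq> (\<lambda>_ _. 0)"
  unfolding unit_value_def by (rule nonzero) (auto simp: valid_def)

lemma rank_unit_add:
  assumes "s \<in> S"
  shows "rank_le_one (\<lambda>x y. unit_value (p(s := a)) x y + unit_value (p(s := b)) x y)"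
proof -
  have "(\<lambda>x y. unit_value (p(s := a)) x y + unit_value (p(s := b)) x y)
    = \<Psi> ((\<lambda>t. basis (p t))(s := \<lambda>i. basis a i + 1 * basis b i))"
    unfolding unit_value_def basis_upd linear[OF assms] by simp
  then show ?thesis by (simp only: rank)
qed

lemma rank_unit_add4:
  assumes "s \<in> S" "t \<in> S" "s \<noteq> t"
  shows "rank_le_one (\<lambda>x y. (unit_value (p(t := u, s := a)) x y + unit_value (p(t := u, s := b)) x y)
    + (unit_value (p(t := v, s := a)) x y + unit_value (p(t := v, s := b)) x y))"
proof -
  let ?w = "(\<lambda>t. basis (p t))(t := \<lambda>i. basis u i + 1 * basis v i, s := \<lambda>i. basis a i + 1 * basis b i)"
  have "\<Psi> ?w = (\<lambda>x y. \<Psi> ((\<lambda>t. basis (p t))(s := basis a, t := \<lambda>i. basis u i + 1 * basis v i)) x y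
      + 1 * \<Psi> ((\<lambda>t. basis (p t))(s := basis b, t := \<lambda>i. basis u i + 1 * basis v i)) x y)"
    unfolding linear[OF assms(1)] by (simp only: fun_upd_twist[OF assms(3)[symmetric]])
  also have "\<dots> = (\<lambda>x y. (unit_value (p(t := u, s := a)) x y + unit_value (p(t := u, s := b)) x y)
    + (unit_value (p(t := v, s := a)) x y + unit_value (p(t := v, s := b)) x y))"
    unfolding linear[OF assms(2)]
    unfolding unit_value_def basis_upd fun_upd_twist[OF assms(3)]
    by (simp only: mult_1 ac_simps)
  finally show ?thesis using rank[of ?w] by (simp only:)
qed

text \<open>If two values in one slot shared both row and column, then a combination of two basis
  vectors in this slot would be mapped to zero.\<close>

lemma unit_not_both:
  assumes p: "valid p" and s: "s \<in> S" and ab: "a < d s" "b < d s" "a \<noteq> b"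
  shows "\<not> (same_column (unit_value (p(s := a))) (unit_value (p(s := b)))
    \<and> same_row (unit_value (p(s := a))) (unit_value (p(s := b))))"
proof
  assume *: "same_column (unit_value (p(s := a))) (unit_value (p(s := b)))
    \<and> same_row (unit_value (p(s := a))) (unit_value (p(s := b)))"
  obtain x y where "unit_value (p(s := a)) x y \<noteq> 0"
    using unit_nonzero[OF valid_upd[OF p s ab(1)]] by (auto simp: fun_eq_iff)
  with * obtain c where c: "unit_value (p(s := b)) = (\<lambda>x y. c * unit_value (p(s := a)) x y)"
    using same_column_and_same_row by blast
  let ?w = "(\<lambda>t. basis (p t))(s := \<lambda>i. basis b i + (-c) * basis a i)"
  have "\<Psi> ?w = (\<lambda>_ _. 0)"
    unfolding linear[OF s] basis_upd[symmetric] using c by (simp add: unit_value_def)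
  moreover have "\<exists>i<d t. ?w t i \<noteq> 0" if "t \<in> S" for t
    using p that ab by (cases "t = s") (auto simp: valid_def intro!: exI[of _ b])
  ultimately show False using nonzero by blast
qed

text \<open>A column slot influences the column of the value and leaves its row fixed; a row slot
  influences the row and leaves the column fixed.\<close>

definition column_slot :: "'s \<Rightarrow> ('s \<Rightarrow> nat) \<Rightarrow> bool" where
  "column_slot s p \<longleftrightarrow> (\<forall>a<d s. \<forall>b<d s. same_row (unit_value (p(s := a))) (unit_value (p(s := b))))"

definition row_slot :: "'s \<Rightarrow> ('s \<Rightarrow> nat) \<Rightarrow> bool" where
  "row_slot s p \<longleftrightarrow> (\<forall>a<d s. \<forall>b<d s. same_column (unit_value (p(s := a))) (unit_value (p(s := b))))"

lemma same_column_imp_row_slot: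
  assumes p: "valid p" and s: "s \<in> S"
    and c: "same_column (unit_value (p(s := 0))) (unit_value (p(s := 1)))"
  shows "row_slot s p"
proof -
  let ?G = "\<lambda>a. unit_value (p(s := a))"
  have 01: "0 < d s" "1 < d s" using two_dimensional[OF s] by auto
  have ne: "?G a \<noteq> (\<lambda>_ _. 0)" if "a < d s" for a
    by (intro unit_nonzero valid_upd p s that)
  have nr: "\<not> same_row (?G 0) (?G 1)" using c unit_not_both[OF p s 01] by auto
  have 0: "same_column (?G 0) (?G a)" if "a < d s" for a
    by (rule same_column_third[OF rank_unit rank_unit rank_unit ne[OF 01(1)] ne[OF 01(2)] ne[OF that]
      rank_unit_add[OF s] rank_unit_add[OF s] c nr])
  obtain x y where "?G 0 x y \<noteq> 0" using ne[OF 01(1)] by (auto simp: fun_eq_iff)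
  then show ?thesis unfolding row_slot_def using 0 same_column_sym same_column_trans by blast
qed

lemma flipped: "rank_one_multilinear S d (\<lambda>w. flip (\<Psi> w))"
proof
  fix s and w :: "'s \<Rightarrow> nat \<Rightarrow> complex" and x y :: "nat \<Rightarrow> complex" and c :: complex
  assume s: "s \<in> S"
  show "flip (\<Psi> (w(s := \<lambda>i. x i + c * y i))) = (\<lambda>a b. flip (\<Psi> (w(s := x))) a b + c * flip (\<Psi> (w(s := y))) a b)"
    unfolding linear[OF s] by (simp add: flip_def)
next
  fix w :: "'s \<Rightarrow> nat \<Rightarrow> complex" assume "\<And>s. s \<in> S \<Longrightarrow> \<exists>i<d s. w s i \<noteq> 0"
  then have "\<Psi> w \<noteq> (\<lambda>_ _. 0)" by (rule nonzero)
  then show "flip (\<Psi> w) \<noteq> (\<lambda>_ _. 0)" by (auto simp: flip_def fun_eq_iff)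
next
  fix w w' :: "'s \<Rightarrow> nat \<Rightarrow> complex" assume "\<And>s. s \<in> S \<Longrightarrow> w s = w' s"
  then show "flip (\<Psi> w) = flip (\<Psi> w')" using locality[of w w'] by simp
qed (use finite_slots two_dimensional rank in auto)

lemma row_or_column_slot:
  assumes p: "valid p" and s: "s \<in> S"
  shows "row_slot s p \<or> column_slot s p"
proof -
  interpret F: rank_one_multilinear S d "\<lambda>w. flip (\<Psi> w)" by (rule flipped)
  have F: "F.unit_value q = flip (unit_value q)" for q
    by (simp add: F.unit_value_def unit_value_def)
  have Fv: "F.valid p" using p by (simp add: F.valid_def valid_def)
  have "same_column (unit_value (p(s := 0))) (unit_value (p(s := 1))) \<or>
    same_row (unit_value (p(s := 0))) (unit_value (p(s := 1)))"
    by (rule same_column_or_same_row[OF rank_unit rank_unit rank_unit_add[OF s]])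
  then show ?thesis
  proof
    assume "same_row (unit_value (p(s := 0))) (unit_value (p(s := 1)))"
    then have "F.row_slot s p" by (intro F.same_column_imp_row_slot Fv s) (simp add: F)
    then show ?thesis by (simp add: F.row_slot_def column_slot_def F)
  qed (use same_column_imp_row_slot[OF p s] in auto)
qed

lemma not_row_and_column_slot:
  assumes p: "valid p" and s: "s \<in> S"
  shows "\<not> (row_slot s p \<and> column_slot s p)"
  using unit_not_both[OF p s, of 0 1] two_dimensional[OF s]
  by (auto simp: row_slot_def column_slot_def)

text \<open>If a change in the slot \<open>t\<close> changed the type of the slot \<open>s\<close>, then two values for the old argument
  would share only their column and two values for the new one only their row.\<close>

lemma row_slot_upd:
  assumes p: "valid p" and s: "s \<in> S" and t: "t \<in> S" and v: "v < d t"
    and r: "row_slot s p"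
  shows "row_slot s (p(t := v))"
proof (cases "s = t")
  case True then show ?thesis using r by (simp add: row_slot_def)
next
  case False
  let ?q = "p(t := v)"
  have q: "valid ?q" by (rule valid_upd[OF p t v])
  have 01: "0 < d s" "1 < d s" using two_dimensional[OF s] by auto
  show ?thesis
  proof (rule ccontr)
    assume "\<not> row_slot s ?q"
    then have c: "column_slot s ?q" using row_or_column_slot[OF q s] by auto
    have ne: "unit_value (r(s := a)) \<noteq> (\<lambda>_ _. 0)" if "a < d s" "valid r" for a r
      by (intro unit_nonzero valid_upd s that)
    have R: "same_column (unit_value (p(s := 0))) (unit_value (p(s := 1)))"
      using r 01 by (auto simp: row_slot_def)
    have C: "same_row (unit_value (?q(s := 0))) (unit_value (?q(s := 1)))"
      using c 01 by (auto simp: column_slot_def)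
    have nr: "\<not> same_row (unit_value (p(s := 0))) (unit_value (p(s := 1)))"
      using unit_not_both[OF p s 01 zero_neq_one] R by blast
    have nc: "\<not> same_column (unit_value (?q(s := 0))) (unit_value (?q(s := 1)))"
      using unit_not_both[OF q s 01 zero_neq_one] C by blast
    have sum: "rank_le_one (\<lambda>x y. unit_value (p(s := a)) x y + unit_value (?q(s := a)) x y)" for a
    proof -
      have 1: "p(s := a, t := p t) = p(s := a)" using False by (simp add: fun_upd_idem_iff)
      have 2: "p(s := a, t := v) = ?q(s := a)" by (rule fun_upd_twist[OF False])
      show ?thesis using rank_unit_add[OF t, of "p(s := a)" "p t" v] unfolding 1 2 .
    qed
    show False
    proof (rule same_column_same_row_incompatible[where P = "unit_value (p(s := 0))"
          and Q = "unit_value (p(s := 1))" and R = "unit_value (?q(s := 0))"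
          and T = "unit_value (?q(s := 1))"])
      show "rank_le_one (\<lambda>x y. unit_value (p(s := 0)) x y + unit_value (p(s := 1)) x y
          + (unit_value (?q(s := 0)) x y + unit_value (?q(s := 1)) x y))"
        using rank_unit_add4[OF s t False, of p "p t" 0 1 v] unfolding fun_upd_triv .
    qed (fact rank_unit ne[OF 01(1) p] ne[OF 01(2) p] ne[OF 01(1) q] ne[OF 01(2) q] sum R nr C nc)+
  qed
qed

text \<open>Two argument families are connected by changing one slot at a time.\<close>

lemma row_slot_independent:
  assumes p: "valid p" and q: "valid q" and s: "s \<in> S" and r: "row_slot s p"
  shows "row_slot s q"
proof -
  have "row_slot s (\<lambda>t. if t \<in> K then q t else p t)" if "K \<subseteq> S" for K
    using finite_subset[OF that finite_slots] that
  proof (induction K rule: finite_induct)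
    case (insert t K)
    have "valid (\<lambda>t. if t \<in> K then q t else p t)" using p q by (auto simp: valid_def)
    then have "row_slot s ((\<lambda>t. if t \<in> K then q t else p t)(t := q t))"
      using insert q s by (intro row_slot_upd) (auto simp: valid_def)
    moreover have "(\<lambda>t. if t \<in> K then q t else p t)(t := q t) = (\<lambda>u. if u \<in> insert t K then q u else p u)"
      by auto
    ultimately show ?case by simp
  qed (use r in simp)
  then have *: "row_slot s (\<lambda>t. if t \<in> S then q t else p t)" by blast
  have "unit_value ((\<lambda>t. if t \<in> S then q t else p t)(s := a)) = unit_value (q(s := a))" for a
    unfolding unit_value_def by (rule locality) auto
  then show ?thesis using * by (simp add: row_slot_def)
qed

text \<open>Each single change in a row slot preserves the column, and the intermediate values are
  nonzero, so that sharing a column is transitive along the way.\<close>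

lemma same_column_changing_row_slots:
  assumes p: "valid p" and q: "valid q"
    and r: "\<And>s. s \<in> S \<Longrightarrow> p s \<noteq> q s \<Longrightarrow> row_slot s p"
  shows "same_column (unit_value p) (unit_value q)"
proof -
  let ?m = "\<lambda>K t. if t \<in> K then q t else p t"
  have v: "valid (?m K)" for K using p q by (auto simp: valid_def)
  have "same_column (unit_value p) (unit_value (?m K))" if "K \<subseteq> S" for K
    using finite_subset[OF that finite_slots] that
  proof (induction K rule: finite_induct)
    case empty then show ?case by (simp add: same_column_refl rank_unit)
  next
    case (insert t K)
    have eq: "(?m K)(t := q t) = ?m (insert t K)" "(?m K)(t := p t) = ?m K" using insert by auto
    have "same_column (unit_value (?m K)) (unit_value (?m (insert t K)))"
    proof (cases "p t = q t")
      case True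
      then have "?m (insert t K) = ?m K" by auto
      then show ?thesis by (simp add: same_column_refl rank_unit)
    next
      case False
      then have "row_slot t (?m K)"
        using r insert row_slot_independent[OF p v, of t] by auto
      moreover have "p t < d t" "q t < d t" using insert p q by (auto simp: valid_def)
      ultimately have "same_column (unit_value ((?m K)(t := p t))) (unit_value ((?m K)(t := q t)))"
        unfolding row_slot_def by blast
      then show ?thesis by (simp only: eq)
    qed
    moreover have "unit_value (?m K) \<noteq> (\<lambda>_ _. 0)" by (rule unit_nonzero[OF v])
    then obtain x y where xy: "unit_value (?m K) x y \<noteq> 0" by (rule nonzero_entryE)
    moreover have "K \<subseteq> S" using insert.prems by blast
    then have "same_column (unit_value p) (unit_value (?m K))" by (rule insert.IH)
    ultimately show ?case by (metis same_column_trans)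
  qed
  from this[of S] have "same_column (unit_value p) (unit_value (?m S))" by simp
  moreover have "unit_value (?m S) = unit_value q"
    unfolding unit_value_def by (rule locality) auto
  ultimately show ?thesis by simp
qed

lemma same_row_changing_column_slots:
  assumes p: "valid p" and q: "valid q"
    and r: "\<And>s. s \<in> S \<Longrightarrow> p s \<noteq> q s \<Longrightarrow> column_slot s p"
  shows "same_row (unit_value p) (unit_value q)"
proof -
  interpret F: rank_one_multilinear S d "\<lambda>w. flip (\<Psi> w)" by (rule flipped)
  have F: "F.unit_value q = flip (unit_value q)" for q
    by (simp add: F.unit_value_def unit_value_def)
  have Fv: "F.valid p" "F.valid q" using p q by (simp_all add: F.valid_def valid_def)
  have "same_column (F.unit_value p) (F.unit_value q)"
    using r by (intro F.same_column_changing_row_slots Fv)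
      (auto simp: F.row_slot_def column_slot_def F)
  then show ?thesis by (simp add: F)
qed

end

section \<open>Positive semidefinite matrices and unitary completion\<close>

text \<open>Moving from \<open>v\<close> a short way in the direction of \<open>- (M *\<^sub>v v)\<close> would make the form negative: the
  linear term in the step length \<open>e\<close> has the coefficient \<open>-2 * \<kappa>\<close>, where \<open>\<kappa>\<close> is the squared norm of \<open>M *\<^sub>v v\<close>.\<close>

lemma psd_form_zero_imp_kernel:
  fixes M :: "complex mat"
  assumes M: "M \<in> carrier_mat n n" and herm: "mat_adjoint M = M"
    and psd: "\<And>u. u \<in> carrier_vec n \<Longrightarrow> 0 \<le> (M *\<^sub>v u) \<bullet>c u"
    and v: "v \<in> carrier_vec n" and zero: "(M *\<^sub>v v) \<bullet>c v = 0"
  shows "M *\<^sub>v v = 0\<^sub>v n"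
proof (rule ccontr)
  assume ne: "M *\<^sub>v v \<noteq> 0\<^sub>v n"
  define w where "w = M *\<^sub>v v"
  have w: "w \<in> carrier_vec n" using M v by (simp add: w_def)
  define \<kappa> where "\<kappa> = Re (w \<bullet>c w)"
  define c where "c = Re ((M *\<^sub>v w) \<bullet>c w)"
  have "w \<bullet>c w > 0" using ne w by (simp add: w_def)
  then have \<kappa>: "w \<bullet>c w = of_real \<kappa>" "\<kappa> > 0"
    by (auto simp: \<kappa>_def less_complex_def complex_eq_iff)
  have c: "(M *\<^sub>v w) \<bullet>c w = of_real c" "c \<ge> 0"
    using psd[OF w] by (auto simp: c_def less_eq_complex_def complex_eq_iff)
  have wv: "(M *\<^sub>v w) \<bullet>c v = of_real \<kappa>"
    using cscalar_prod_adjoint[OF M w v] herm \<kappa>(1) by (simp add: w_def)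
  define e where "e = \<kappa> / (c + 1)"
  have e: "e > 0" "e * c < \<kappa>" using \<kappa> c by (auto simp: e_def field_simps)
  let ?s = "- complex_of_real e"
  have "(M *\<^sub>v (v + ?s \<cdot>\<^sub>v w)) \<bullet>c (v + ?s \<cdot>\<^sub>v w)
      = of_real (- 2 * e * \<kappa> + e * e * c)"
    unfolding quadratic_form_add_smult[OF M v w] zero wv c(1)
    using \<kappa>(1) by (simp add: w_def)
  moreover have "0 \<le> (M *\<^sub>v (v + ?s \<cdot>\<^sub>v w)) \<bullet>c (v + ?s \<cdot>\<^sub>v w)"
    using v w by (intro psd) simp
  ultimately have "0 \<le> - 2 * e * \<kappa> + e * e * c" by (simp add: less_eq_complex_def)
  also have "- 2 * e * \<kappa> + e * e * c = e * (e * c - 2 * \<kappa>)" by (simp add: algebra_simps)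
  finally have "e * c - 2 * \<kappa> \<ge> 0" using e(1) by (simp add: zero_le_mult_iff)
  then show False using e \<kappa> by simp
qed

text \<open>A Householder reflection takes the first basis vector to the direction of \<open>x\<close>; the number
  \<open>a\<close> in the proof has the phase of the first entry of \<open>x\<close>, which makes the reflection work over the
  complex numbers.  If \<open>x\<close> is already a multiple of that vector, then \<open>w = 0\<close> and division by zero
  turns the reflection into the identity.\<close>

lemma unitary_with_first_column:
  fixes x :: "nat \<Rightarrow> complex"
  assumes n: "n > 0"
  shows "\<exists>Q a. Q \<in> carrier_mat n n \<and> unitary_mat Q \<and> (\<forall>i<n. x i = a * Q $$ (i, 0))"
proof -
  define \<nu> where "\<nu> = (\<Sum>i=0..<n. (cmod (x i))\<^sup>2)"
  define a where "a = of_real (sqrt \<nu>) * (if x 0 = 0 then 1 else sgn (x 0))"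
  define w where "w = (\<lambda>i. x i - (if i = 0 then a else 0))"
  define q where "q = (\<Sum>i=0..<n. w i * cnj (w i))"
  define Q where "Q = mat n n (\<lambda>(i, j). (if i = j then 1 else 0) - 2 / q * w i * cnj (w j))"
  have Q: "Q \<in> carrier_mat n n" by (simp add: Q_def)
  have "\<nu> \<ge> 0" by (simp add: \<nu>_def sum_nonneg)
  have ph: "(if x 0 = 0 then 1 else sgn (x 0)) * cnj (if x 0 = 0 then 1 else sgn (x 0)) = 1"
    by (auto simp: complex_norm_square[symmetric] norm_sgn)
  have aa: "a * cnj a = of_real \<nu>"
  proof -
    have "a * cnj a = of_real (sqrt \<nu>) * of_real (sqrt \<nu>) *
      ((if x 0 = 0 then 1 else sgn (x 0)) * cnj (if x 0 = 0 then 1 else sgn (x 0)))"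
      unfolding a_def by simp
    also have "\<dots> = of_real \<nu>" unfolding ph using \<open>\<nu> \<ge> 0\<close> by (simp flip: of_real_mult)
    finally show ?thesis .
  qed
  have ax: "a * cnj (x 0) = of_real (sqrt \<nu> * cmod (x 0))"
  proof (cases "x 0 = 0")
    case False
    have "sgn (x 0) * cnj (x 0) = of_real (cmod (x 0))"
      using False by (simp add: sgn_div_norm scaleR_conv_of_real complex_norm_square[symmetric] field_simps power2_eq_square)
    then show ?thesis using False by (simp add: a_def)
  qed simp
  then have xa: "cnj a * x 0 = of_real (sqrt \<nu> * cmod (x 0))"
    by (metis complex_cnj_cnj complex_cnj_complex_of_real complex_cnj_mult)
  have "q = (\<Sum>i=0..<n. x i * cnj (x i) + (if i = 0 then a * cnj a - a * cnj (x 0) - x 0 * cnj a else 0))"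
    unfolding q_def by (rule sum.cong) (auto simp: w_def algebra_simps)
  also have "\<dots> = (\<Sum>i=0..<n. x i * cnj (x i)) + (a * cnj a - a * cnj (x 0) - x 0 * cnj a)"
    using n by (simp add: sum.distrib)
  also have "(\<Sum>i=0..<n. x i * cnj (x i)) = of_real \<nu>"
    by (simp add: \<nu>_def complex_norm_square del: of_real_power)
  finally have q: "q = 2 * (of_real \<nu> - of_real (sqrt \<nu> * cmod (x 0)))"
    using aa ax xa by (simp add: mult.commute)
  have q_real: "cnj q = q" unfolding q by simp
  have w_zero: "w i = 0" if "q = 0" "i < n" for i
  proof -
    have "of_real (\<Sum>i=0..<n. (cmod (w i))\<^sup>2) = q"
      by (simp add: q_def complex_norm_square del: of_real_power)
    then have "(\<Sum>i=0..<n. (cmod (w i))\<^sup>2) = 0" using that(1) by (metis of_real_eq_0_iff)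
    then show ?thesis using that(2) by (simp add: sum_nonneg_eq_0_iff)
  qed
  have "unitary_mat Q"
  proof (rule unitary_matI[OF Q], rule eq_matI)
    fix i j assume "i < dim_row (1\<^sub>m n)" "j < dim_col (1\<^sub>m n)"
    then have ij: "i < n" "j < n" by auto
    let ?d = "\<lambda>i j. if i = j then 1 else 0 :: complex"
    have "(Q * mat_adjoint Q) $$ (i, j)
        = (\<Sum>k=0..<n. (?d i k - 2 / q * w i * cnj (w k)) * (?d j k - 2 / q * cnj (w j) * w k))"
      using Q ij by (auto simp: scalar_prod_def Q_def q_real intro!: sum.cong)
    also have "\<dots> = (\<Sum>k=0..<n. (if k = i then ?d j i else 0) - (if k = i then 2 / q * cnj (w j) * w i else 0)
        - (if k = j then 2 / q * w i * cnj (w j) else 0)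
        + (2 / q * w i) * (2 / q * cnj (w j)) * (w k * cnj (w k)))"
      by (intro sum.cong refl) (auto simp: algebra_simps)
    also have "\<dots> = ?d j i - 2 / q * cnj (w j) * w i - 2 / q * w i * cnj (w j)
        + (2 / q * w i) * (2 / q * cnj (w j)) * q"
      unfolding sum.distrib sum_subtractf sum_distrib_left[symmetric] q_def[symmetric]
      using ij by simp
    also have "\<dots> = ?d j i" by (cases "q = 0") (auto simp: field_simps)
    finally show "(Q * mat_adjoint Q) $$ (i, j) = 1\<^sub>m n $$ (i, j)" using ij by auto
  qed (use Q in auto)
  moreover have "x i = a * Q $$ (i, 0)" if "i < n" for i
  proof (cases "q = 0")
    case True
    then show ?thesis using w_zero[OF True that] n that by (auto simp: Q_def w_def split: if_splits)
  next
    case False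
    have "a * cnj (w 0) = a * cnj (x 0) - a * cnj a" by (simp add: w_def algebra_simps)
    also have "\<dots> = - q / 2" unfolding aa ax q by simp
    finally have "a * cnj (w 0) = - q / 2" .
    then have "2 / q * w i * (a * cnj (w 0)) = - w i" using False by simp
    then show ?thesis using n that by (auto simp: Q_def w_def algebra_simps)
  qed
  ultimately show ?thesis using Q by blast
qed

section \<open>Matrix units and the preserver\<close>

definition mat_unit :: "nat \<Rightarrow> nat \<Rightarrow> nat \<Rightarrow> complex mat" where
  "mat_unit N i j = mat N N (\<lambda>(a, b). if a = i \<and> b = j then 1 else 0)"

lemma mat_unit_carrier [simp]: "mat_unit N i j \<in> carrier_mat N N"
  by (simp add: mat_unit_def)

lemma mat_unit_dim [simp]: "dim_row (mat_unit N i j) = N" "dim_col (mat_unit N i j) = N"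
  by (simp_all add: mat_unit_def)

lemma mat_unit_index [simp]:
  "a < N \<Longrightarrow> b < N \<Longrightarrow> mat_unit N i j $$ (a, b) = (if a = i \<and> b = j then 1 else 0)"
  by (simp add: mat_unit_def)

lemma prod_indicator:
  "finite K \<Longrightarrow> (\<Prod>k\<in>K. if Q k then 1 else 0 :: complex) = (if \<forall>k\<in>K. Q k then 1 else 0)"
  by (induction K rule: finite_induct) auto

lemma kron_prod_mat_unit:
  assumes pos: "\<forall>k\<in>{1..m}. n k > 0"
    and i: "i < (\<Prod>k=1..m. n k)" and j: "j < (\<Prod>k=1..m. n k)"
  shows "kron_prod (\<lambda>k. mat_unit (n k) (digit n m i k) (digit n m j k)) m
    = mat_unit (\<Prod>k=1..m. n k) i j"
proof (rule eq_matI)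
  let ?N = "\<Prod>k=1..m. n k"
  let ?E = "\<lambda>k. mat_unit (n k) (digit n m i k) (digit n m j k)"
  have E: "\<forall>k\<in>{1..m}. ?E k \<in> carrier_mat (n k) (n k)" by simp
  note car = kron_prod_carrier[OF E]
  show "dim_row (kron_prod ?E m) = dim_row (mat_unit ?N i j)"
    "dim_col (kron_prod ?E m) = dim_col (mat_unit ?N i j)" using car by (auto simp: mat_unit_def)
  fix a b assume "a < dim_row (mat_unit ?N i j)" "b < dim_col (mat_unit ?N i j)"
  then have ab: "a < ?N" "b < ?N" by (auto simp: mat_unit_def)
  have "kron_prod ?E m $$ (a, b)
      = (\<Prod>k=1..m. if digit n m a k = digit n m i k \<and> digit n m b k = digit n m j k then 1 else 0)"
    unfolding kron_prod_index[OF E ab]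
    by (intro prod.cong refl mat_unit_index digit_less[OF pos])
  also have "\<dots> = (if a = i \<and> b = j then 1 else 0)"
    unfolding prod_indicator[OF finite_atLeastAtMost]
    using digit_inject[OF pos ab(1) i] digit_inject[OF pos ab(2) j] by auto
  finally show "kron_prod ?E m $$ (a, b) = mat_unit ?N i j $$ (a, b)" using ab by simp
qed

text \<open>The hypotheses on \<open>\<phi>\<close> form a locale because the results are also needed for \<open>\<phi>\<close> expressed in
  other orthonormal bases, which is a different map with the same properties.\<close>

locale tensor_range_preserver =
  fixes m N :: nat and n :: "nat \<Rightarrow> nat" and \<phi> :: "complex mat \<Rightarrow> complex mat"
  assumes dims: "\<forall>k\<in>{1..m}. n k \<ge> 2"
    and N: "N = (\<Prod>k=1..m. n k)"
    and closed: "X \<in> carrier_mat N N \<Longrightarrow> \<phi> X \<in> carrier_mat N N"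
    and add: "X \<in> carrier_mat N N \<Longrightarrow> Y \<in> carrier_mat N N \<Longrightarrow> \<phi> (X + Y) = \<phi> X + \<phi> Y"
    and smult: "X \<in> carrier_mat N N \<Longrightarrow> \<phi> (c \<cdot>\<^sub>m X) = c \<cdot>\<^sub>m \<phi> X"
    and range: "\<forall>k\<in>{1..m}. A k \<in> carrier_mat (n k) (n k) \<Longrightarrow>
      numerical_range (\<phi> (kron_prod A m)) = numerical_range (kron_prod A m)"
begin

lemma pos: "\<forall>k\<in>{1..m}. n k > 0"
  using dims by fastforce

lemma N_pos: "N > 0"
  unfolding N using pos by (intro prod_pos) auto

lemma kron_carrier_N: "\<forall>k\<in>{1..m}. A k \<in> carrier_mat (n k) (n k) \<Longrightarrow> kron_prod A m \<in> carrier_mat N N"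
  unfolding N by (rule kron_prod_carrier)

lemma mat_unit_kron:
  "i < N \<Longrightarrow> j < N \<Longrightarrow> kron_prod (\<lambda>k. mat_unit (n k) (digit n m i k) (digit n m j k)) m = mat_unit N i j"
  unfolding N by (rule kron_prod_mat_unit[OF pos])

lemma expand:
  assumes X: "X \<in> carrier_mat N N" and rc: "r < N" "c < N"
  shows "\<phi> X $$ (r, c) = (\<Sum>i=0..<N. \<Sum>j=0..<N. X $$ (i, j) * \<phi> (mat_unit N i j) $$ (r, c))"
proof -
  let ?X = "\<lambda>K. mat N N (\<lambda>p. if p \<in> K then X $$ p else 0)"
  have "\<phi> (?X K) $$ (r, c) = (\<Sum>p\<in>K. X $$ p * \<phi> (mat_unit N (fst p) (snd p)) $$ (r, c))"
    if "finite K" "K \<subseteq> {0..<N} \<times> {0..<N}" for K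
    using that
  proof (induction K rule: finite_induct)
    case empty
    have "\<phi> (0 \<cdot>\<^sub>m ?X {}) = 0 \<cdot>\<^sub>m \<phi> (?X {})" by (rule smult) simp
    moreover have "0 \<cdot>\<^sub>m ?X {} = ?X {}" by (rule eq_matI) auto
    ultimately have "\<phi> (?X {}) = 0 \<cdot>\<^sub>m \<phi> (?X {})" by simp
    moreover have "\<phi> (?X {}) \<in> carrier_mat N N" by (rule closed) simp
    then have "(0 \<cdot>\<^sub>m \<phi> (?X {})) $$ (r, c) = 0" using rc by auto
    ultimately show ?case by simp
  next
    case (insert p K)
    obtain i j where p: "p = (i, j)" by (cases p)
    have ij: "i < N" "j < N" using insert.prems p by auto
    have "?X (insert p K) = ?X K + X $$ p \<cdot>\<^sub>m mat_unit N i j"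
      using insert.hyps p ij by (intro eq_matI) (auto simp: mat_unit_def)
    then have "\<phi> (?X (insert p K)) = \<phi> (?X K) + \<phi> (X $$ p \<cdot>\<^sub>m mat_unit N i j)"
      by (simp add: add)
    also have "\<phi> (X $$ p \<cdot>\<^sub>m mat_unit N i j) = X $$ p \<cdot>\<^sub>m \<phi> (mat_unit N i j)"
      by (simp add: smult)
    finally have "\<phi> (?X (insert p K)) $$ (r, c)
        = \<phi> (?X K) $$ (r, c) + X $$ p * \<phi> (mat_unit N i j) $$ (r, c)"
      using closed[of "?X K"] closed[of "mat_unit N i j"] rc by auto
    then show ?case using insert p by simp
  qed
  from this[of "{0..<N} \<times> {0..<N}"]
  have "\<phi> (?X ({0..<N} \<times> {0..<N})) $$ (r, c)
      = (\<Sum>i=0..<N. \<Sum>j=0..<N. X $$ (i, j) * \<phi> (mat_unit N i j) $$ (r, c))"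
    by (simp add: sum.cartesian_product case_prod_unfold)
  moreover have "?X ({0..<N} \<times> {0..<N}) = X" using X by (intro eq_matI) auto
  ultimately show ?thesis by simp
qed

text \<open>Conjugation by unitary matrices does not change numerical ranges, and conjugation by a product
  of unitary matrices keeps product matrices.  Thus it is enough to study the standard basis, once
  for all orthonormal product bases.\<close>

lemma change_of_basis:
  assumes Q: "\<forall>k\<in>{1..m}. Q k \<in> carrier_mat (n k) (n k)" "\<forall>k\<in>{1..m}. unitary_mat (Q k)"
    and V: "V \<in> carrier_mat N N" "unitary_mat V"
  shows "tensor_range_preserver m N n
    (\<lambda>X. V * \<phi> (kron_prod Q m * X * mat_adjoint (kron_prod Q m)) * mat_adjoint V)"
proof
  let ?Q = "kron_prod Q m"
  have Qc: "?Q \<in> carrier_mat N N" by (rule kron_carrier_N[OF Q(1)])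
  have Qa: "mat_adjoint ?Q \<in> carrier_mat N N" using Qc by simp
  have Va: "mat_adjoint V \<in> carrier_mat N N" using V by simp
  have Qu: "unitary_mat ?Q" by (rule unitary_kron_prod[OF Q pos])
  show "\<forall>k\<in>{1..m}. n k \<ge> 2" by (rule dims)
  show "N = (\<Prod>k=1..m. n k)" by (rule N)
  fix X :: "complex mat" assume X: "X \<in> carrier_mat N N"
  then have QX: "?Q * X * mat_adjoint ?Q \<in> carrier_mat N N" using Qc by simp
  show "V * \<phi> (?Q * X * mat_adjoint ?Q) * mat_adjoint V \<in> carrier_mat N N"
    using closed[OF QX] V by simp
  show "V * \<phi> (?Q * (X + Y) * mat_adjoint ?Q) * mat_adjoint V
      = V * \<phi> (?Q * X * mat_adjoint ?Q) * mat_adjoint V + V * \<phi> (?Q * Y * mat_adjoint ?Q) * mat_adjoint V"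
    if Y: "Y \<in> carrier_mat N N" for Y :: "complex mat"
  proof -
    have QY: "?Q * Y * mat_adjoint ?Q \<in> carrier_mat N N" using Qc Y by simp
    have "?Q * (X + Y) * mat_adjoint ?Q = ?Q * X * mat_adjoint ?Q + ?Q * Y * mat_adjoint ?Q"
      using mult_add_distrib_mat[OF Qc X Y] add_mult_distrib_mat[of "?Q * X" N N "?Q * Y" "mat_adjoint ?Q" N]
        Qc X Y by simp
    then show ?thesis
      using add[OF QX QY] mult_add_distrib_mat[OF V(1) closed[OF QX] closed[OF QY]]
        add_mult_distrib_mat[of "V * \<phi> (?Q * X * mat_adjoint ?Q)" N N "V * \<phi> (?Q * Y * mat_adjoint ?Q)" "mat_adjoint V" N]
        V closed[OF QX] closed[OF QY] by simp
  qed
  show "V * \<phi> (?Q * (c \<cdot>\<^sub>m X) * mat_adjoint ?Q) * mat_adjoint V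
      = c \<cdot>\<^sub>m (V * \<phi> (?Q * X * mat_adjoint ?Q) * mat_adjoint V)" for c
  proof -
    have "?Q * (c \<cdot>\<^sub>m X) * mat_adjoint ?Q = c \<cdot>\<^sub>m (?Q * X * mat_adjoint ?Q)"
      using mult_smult_distrib[OF Qc X] mult_smult_assoc_mat[of "?Q * X" N N "mat_adjoint ?Q" N] Qc X by simp
    then show ?thesis
      using smult[OF QX, of c] mult_smult_distrib[OF V(1) closed[OF QX]]
        mult_smult_assoc_mat[of "V * \<phi> (?Q * X * mat_adjoint ?Q)" N N "mat_adjoint V" N]
        V closed[OF QX] by simp
  qed
next
  let ?Q = "kron_prod Q m"
  fix A :: "nat \<Rightarrow> complex mat" assume A: "\<forall>k\<in>{1..m}. A k \<in> carrier_mat (n k) (n k)"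
  have QA: "\<forall>k\<in>{1..m}. Q k * A k * mat_adjoint (Q k) \<in> carrier_mat (n k) (n k)" using Q A by auto
  have eq: "kron_prod (\<lambda>k. Q k * A k * mat_adjoint (Q k)) m = ?Q * kron_prod A m * mat_adjoint ?Q"
    by (rule kron_prod_conjugation[OF Q(1) A pos])
  have "?Q * kron_prod A m * mat_adjoint ?Q \<in> carrier_mat N N"
    using kron_carrier_N[OF QA] by (simp add: eq)
  then have "numerical_range (V * \<phi> (?Q * kron_prod A m * mat_adjoint ?Q) * mat_adjoint V)
      = numerical_range (\<phi> (?Q * kron_prod A m * mat_adjoint ?Q))"
    by (intro numerical_range_unitary[OF _ V] closed)
  also have "\<dots> = numerical_range (?Q * kron_prod A m * mat_adjoint ?Q)"
    using range[OF QA] by (simp add: eq)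
  also have "\<dots> = numerical_range (kron_prod A m)"
    by (rule numerical_range_unitary[OF kron_carrier_N[OF A] kron_carrier_N[OF Q(1)] unitary_kron_prod[OF Q pos]])
  finally show "numerical_range (V * \<phi> (?Q * kron_prod A m * mat_adjoint ?Q) * mat_adjoint V)
      = numerical_range (kron_prod A m)" .
qed

lemma unit_diag_form:
  assumes i: "i < N" and u: "u \<in> carrier_vec N"
  shows "(mat_unit N i i *\<^sub>v u) \<bullet>c u = of_real ((cmod (u $ i))\<^sup>2)"
proof -
  have "(mat_unit N i i *\<^sub>v u) \<bullet>c u
      = (\<Sum>a=0..<N. \<Sum>b=0..<N. if a = i then (if b = i then u $ b * cnj (u $ a) else 0) else 0)"
    unfolding cscalar_prod_mat_sum[OF mat_unit_carrier u u] by (intro sum.cong refl) auto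
  also have "\<dots> = (\<Sum>a=0..<N. if a = i then (\<Sum>b=0..<N. if b = i then u $ b * cnj (u $ a) else 0) else 0)"
    by (intro sum.cong refl) auto
  also have "\<dots> = u $ i * cnj (u $ i)" using i by simp
  finally show ?thesis by (simp only: complex_norm_square)
qed

lemma range_mat_unit:
  "i < N \<Longrightarrow> j < N \<Longrightarrow> numerical_range (\<phi> (mat_unit N i j)) = numerical_range (mat_unit N i j)"
  using range[of "\<lambda>k. mat_unit (n k) (digit n m i k) (digit n m j k)"] by (simp add: mat_unit_kron)

text \<open>The numerical range of the image is the single point \<open>1\<close>, and a matrix is determined by its form.\<close>

lemma image_one: "\<phi> (1\<^sub>m N) = 1\<^sub>m N"
proof -
  have \<phi>1: "\<phi> (1\<^sub>m N) \<in> carrier_mat N N" by (rule closed) simp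
  have "kron_prod (\<lambda>k. 1\<^sub>m (n k)) m = 1\<^sub>m N" unfolding N by (rule kron_prod_one)
  then have W: "numerical_range (\<phi> (1\<^sub>m N)) = numerical_range (1\<^sub>m N)"
    using range[of "\<lambda>k. 1\<^sub>m (n k)"] by simp
  let ?D = "\<phi> (1\<^sub>m N) - 1\<^sub>m N"
  have D: "?D \<in> carrier_mat N N" by (simp add: minus_carrier_mat)
  have "?D = 0\<^sub>m N N"
  proof (rule numerical_range_zero_imp_zero[OF D], rule subsetI)
    fix z assume "z \<in> numerical_range ?D"
    then obtain u where u: "u \<in> carrier_vec N" "u \<bullet>c u = 1" and z: "z = (?D *\<^sub>v u) \<bullet>c u"
      using D numerical_range_iff by metis
    have "(\<phi> (1\<^sub>m N) *\<^sub>v u) \<bullet>c u \<in> numerical_range (\<phi> (1\<^sub>m N))"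
      using u by (subst numerical_range_iff[OF \<phi>1]) auto
    then have "(\<phi> (1\<^sub>m N) *\<^sub>v u) \<bullet>c u \<in> numerical_range (1\<^sub>m N)" by (simp only: W)
    then have 1: "(\<phi> (1\<^sub>m N) *\<^sub>v u) \<bullet>c u = 1"
      using numerical_range_iff[of "1\<^sub>m N" N] by auto
    have "z = (\<phi> (1\<^sub>m N) *\<^sub>v u) \<bullet>c u - (1\<^sub>m N *\<^sub>v u) \<bullet>c u"
      unfolding z cscalar_prod_mat_sum[OF D u(1) u(1)] cscalar_prod_mat_sum[OF \<phi>1 u(1) u(1)]
        cscalar_prod_mat_sum[OF one_carrier_mat u(1) u(1)] sum_subtractf[symmetric]
      using \<phi>1 by (intro sum.cong refl) (auto simp: algebra_simps)
    then show "z \<in> {0}" using 1 u by simp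
  qed
  then have D0: "?D $$ (i, j) = 0" if "i < N" "j < N" for i j using that by simp
  show ?thesis
  proof (rule eq_matI)
    fix i j assume "i < dim_row (1\<^sub>m N)" "j < dim_col (1\<^sub>m N)"
    then show "\<phi> (1\<^sub>m N) $$ (i, j) = 1\<^sub>m N $$ (i, j)"
      using D0[of i j] \<phi>1 by simp
  qed (use \<phi>1 in auto)
qed

lemma diag_sum:
  assumes "r < N" "c < N"
  shows "(\<Sum>i=0..<N. \<phi> (mat_unit N i i) $$ (r, c)) = (if r = c then 1 else 0)"
proof -
  have "\<phi> (1\<^sub>m N) $$ (r, c)
      = (\<Sum>i=0..<N. \<Sum>j=0..<N. if j = i then \<phi> (mat_unit N i j) $$ (r, c) else 0)"
    unfolding expand[OF one_carrier_mat assms] by (intro sum.cong refl) auto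
  also have "\<dots> = (\<Sum>i=0..<N. \<phi> (mat_unit N i i) $$ (r, c))" by (intro sum.cong refl) simp
  finally show ?thesis using assms by (simp add: image_one)
qed

text \<open>The images of the diagonal matrix units are \<open>N\<close> positive semidefinite matrices with sum
  \<open>1\<close>, and each has the point \<open>1\<close> in its numerical range.  A unit vector at which the form of
  one image takes the value \<open>1\<close> is therefore in the kernel of all the others, and these \<open>N\<close>
  vectors turn out to be orthonormal.\<close>

lemma diagonalize_diagonal_units:
  "\<exists>V\<in>carrier_mat N N. unitary_mat V \<and>
    (\<forall>i<N. V * \<phi> (mat_unit N i i) * mat_adjoint V = mat_unit N i i)"
proof -
  define P where "P = (\<lambda>i. \<phi> (mat_unit N i i))"
  have P: "P i \<in> carrier_mat N N" for i unfolding P_def by (rule closed) simp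
  have psd: "0 \<le> (P i *\<^sub>v u) \<bullet>c u" if i: "i < N" and u: "u \<in> carrier_vec N" for i u
  proof (cases "u = 0\<^sub>v N")
    case True then show ?thesis using P[of i] by simp
  next
    case False
    have "((P i *\<^sub>v u) \<bullet>c u) / (u \<bullet>c u) \<in> numerical_range (mat_unit N i i)"
      using numerical_range_homogeneous[OF P u False, of i] unfolding P_def range_mat_unit[OF i i] .
    then obtain v where v: "v \<in> carrier_vec N" "((P i *\<^sub>v u) \<bullet>c u) / (u \<bullet>c u) = of_real ((cmod (v $ i))\<^sup>2)"
      using numerical_range_iff[of "mat_unit N i i" N] unit_diag_form[OF i] by auto
    have "u \<bullet>c u \<noteq> 0" using False u by simp
    then have "(P i *\<^sub>v u) \<bullet>c u = of_real ((cmod (v $ i))\<^sup>2) * of_real (\<Sum>i=0..<N. (cmod (u $ i))\<^sup>2)"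
      using v(2) cscalar_prod_self[OF u] by (simp add: field_simps)
    also have "\<dots> = of_real ((cmod (v $ i))\<^sup>2 * (\<Sum>i=0..<N. (cmod (u $ i))\<^sup>2))" by simp
    finally show ?thesis by (simp add: less_eq_complex_def sum_nonneg del: of_real_mult)
  qed
  have herm: "mat_adjoint (P i) = P i" if i: "i < N" for i
  proof (rule numerical_range_real_imp_hermitian[OF P])
    show "numerical_range (P i) \<subseteq> \<real>"
      using numerical_range_iff[OF P] psd[OF i] by (auto simp: less_eq_complex_def complex_is_Real_iff)
  qed
  have "\<exists>v\<in>carrier_vec N. v \<bullet>c v = 1 \<and> (P i *\<^sub>v v) \<bullet>c v = 1" if i: "i < N" for i
  proof -
    have "1 \<in> numerical_range (mat_unit N i i)"
      using i by (subst numerical_range_iff[of _ N]) (auto simp: unit_diag_form intro!: bexI[of _ "unit_vec N i"])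
    then have "1 \<in> numerical_range (P i)" using range_mat_unit[OF i i] by (simp add: P_def)
    then show ?thesis using numerical_range_iff[OF P] by metis
  qed
  then obtain v where v: "\<And>i. i < N \<Longrightarrow> v i \<in> carrier_vec N"
    "\<And>i. i < N \<Longrightarrow> v i \<bullet>c v i = 1" "\<And>i. i < N \<Longrightarrow> (P i *\<^sub>v v i) \<bullet>c v i = 1"
    by metis
  have form_sum: "(\<Sum>j=0..<N. (P j *\<^sub>v u) \<bullet>c u) = u \<bullet>c u" if u: "u \<in> carrier_vec N" for u
  proof -
    have "(\<Sum>j=0..<N. (P j *\<^sub>v u) \<bullet>c u)
        = (\<Sum>a=0..<N. \<Sum>b=0..<N. (\<Sum>j=0..<N. P j $$ (a, b)) * u $ b * cnj (u $ a))"
      unfolding cscalar_prod_mat_sum[OF P u u] sum_distrib_right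
      by (subst sum.swap, rule sum.cong[OF refl], rule sum.swap)
    also have "\<dots> = (\<Sum>a=0..<N. \<Sum>b=0..<N. if b = a then u $ b * cnj (u $ a) else 0)"
      by (intro sum.cong refl) (auto simp: P_def diag_sum)
    also have "\<dots> = u \<bullet>c u" using u by (simp add: cscalar_prod_sum)
    finally show ?thesis .
  qed
  have kernel: "P j *\<^sub>v v i = 0\<^sub>v N" if i: "i < N" and j: "j < N" and ij: "j \<noteq> i" for i j
  proof (rule psd_form_zero_imp_kernel[OF P herm[OF j] psd[OF j] v(1)[OF i]])
    have "(\<Sum>j=0..<N. (P j *\<^sub>v v i) \<bullet>c v i) = 1" using form_sum v i by simp
    then have "(\<Sum>j\<in>{0..<N} - {i}. (P j *\<^sub>v v i) \<bullet>c v i) = 0"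
      using i v(3)[OF i] by (subst (asm) sum.remove[of _ i]) auto
    then show "(P j *\<^sub>v v i) \<bullet>c v i = 0"
      using psd v(1)[OF i] i j ij by (subst (asm) sum_nonneg_eq_0_iff) auto
  qed
  have fixed: "P i *\<^sub>v v i = v i" if i: "i < N" for i
  proof (rule eq_vecI)
    fix r assume "r < dim_vec (v i)"
    then have r: "r < N" using v(1)[OF i] by simp
    have entry: "(P j *\<^sub>v v i) $ r = (\<Sum>c=0..<N. P j $$ (r, c) * v i $ c)" for j
      using P[of j] v(1)[OF i] r by (auto simp: scalar_prod_def intro!: sum.cong)
    have "(\<Sum>j=0..<N. (P j *\<^sub>v v i) $ r) = (\<Sum>c=0..<N. (\<Sum>j=0..<N. P j $$ (r, c)) * v i $ c)"
      unfolding entry sum_distrib_right by (rule sum.swap)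
    also have "\<dots> = (\<Sum>c=0..<N. if c = r then v i $ c else 0)"
      by (intro sum.cong refl) (use r in \<open>auto simp: P_def diag_sum\<close>)
    also have "\<dots> = v i $ r" using r by simp
    finally have "(\<Sum>j=0..<N. (P j *\<^sub>v v i) $ r) = v i $ r" .
    moreover have "(\<Sum>j=0..<N. (P j *\<^sub>v v i) $ r) = (\<Sum>j=0..<N. if j = i then (P i *\<^sub>v v i) $ r else 0)"
      using kernel[OF i] r by (intro sum.cong refl) auto
    ultimately show "(P i *\<^sub>v v i) $ r = v i $ r" using i by simp
  qed (use P[of i] v(1)[OF i] in auto)
  have orth: "v j \<bullet>c v i = (if i = j then 1 else 0)" if i: "i < N" and j: "j < N" for i j
  proof (cases "i = j")
    case False
    have "v j \<bullet>c v i = (P j *\<^sub>v v j) \<bullet>c v i" using fixed j by simp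
    also have "\<dots> = v j \<bullet>c (P j *\<^sub>v v i)"
      using cscalar_prod_adjoint[OF P v(1)[OF j] v(1)[OF i]] herm[OF j] by simp
    finally show ?thesis using kernel[OF i j] False v(1)[OF j] by simp
  qed (use v i in simp)
  define V where "V = mat N N (\<lambda>(i, r). cnj (v i $ r))"
  have V: "V \<in> carrier_mat N N" by (simp add: V_def)
  have VV: "(V * M * mat_adjoint V) $$ (a, b) = (M *\<^sub>v v b) \<bullet>c v a"
    if "M \<in> carrier_mat N N" "a < N" "b < N" for M a b
  proof -
    have "V * M * mat_adjoint V = V * (M * mat_adjoint V)"
      using V that by (intro assoc_mult_mat[of _ N N _ N _ N]) auto
    then have "(V * M * mat_adjoint V) $$ (a, b)
        = (\<Sum>i=0..<N. cnj (v a $ i) * (\<Sum>j=0..<N. M $$ (i, j) * v b $ j))"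
      using V that by (auto simp: scalar_prod_def V_def intro!: sum.cong)
    then show ?thesis
      using that v(1) by (simp add: cscalar_prod_mat_sum[of _ N] sum_distrib_left ac_simps)
  qed
  have "unitary_mat V"
  proof (rule unitary_matI[OF V], rule eq_matI)
    fix a b assume "a < dim_row (1\<^sub>m N)" "b < dim_col (1\<^sub>m N)"
    then have ab: "a < N" "b < N" by auto
    have "V * mat_adjoint V = V * 1\<^sub>m N * mat_adjoint V" using V by simp
    then show "(V * mat_adjoint V) $$ (a, b) = 1\<^sub>m N $$ (a, b)"
      using VV[of "1\<^sub>m N" a b] ab orth[of a b] v(1)[of b] by simp
  qed (use V in auto)
  moreover have "V * P i * mat_adjoint V = mat_unit N i i" if i: "i < N" for i
  proof (rule eq_matI)
    fix a b assume "a < dim_row (mat_unit N i i)" "b < dim_col (mat_unit N i i)"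
    then have ab: "a < N" "b < N" by (auto simp: mat_unit_def)
    have "(P i *\<^sub>v v b) \<bullet>c v a = (if b = i then v b \<bullet>c v a else 0)"
      using kernel[OF ab(2) i] fixed[OF i] v(1)[OF ab(1)] by (auto simp: cscalar_prod_sum[of _ N])
    then show "(V * P i * mat_adjoint V) $$ (a, b) = mat_unit N i i $$ (a, b)"
      using VV[OF P ab, of i] ab orth by auto
  qed (use V P in \<open>auto simp: mat_unit_def\<close>)
  ultimately show ?thesis using V unfolding P_def by blast
qed

end

section \<open>Product matrices of rank one\<close>

text \<open>Uniqueness of the coefficients of a trigonometric polynomial of degree two.\<close>

lemma trig_coefficient_zero:
  fixes a b c d e :: complex
  assumes "\<And>t. t * cnj t = 1 \<Longrightarrow> a * t\<^sup>2 + b * t + c + d * cnj t + e * (cnj t)\<^sup>2 = 0"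
  shows "e = 0"
proof -
  \<comment> \<open>Averaging over \<open>t\<close> and \<open>-t\<close> leaves the even part; three values of \<open>t\<^sup>2\<close> then suffice.\<close>
  have even: "a * t\<^sup>2 + c + e * (cnj t)\<^sup>2 = 0" if t: "t * cnj t = 1" for t
  proof -
    have minus: "a * (- t)\<^sup>2 + b * (- t) + c + d * cnj (- t) + e * (cnj (- t))\<^sup>2 = 0"
      using t by (intro assms) simp
    have "2 * (a * t\<^sup>2 + c + e * (cnj t)\<^sup>2) = (a * t\<^sup>2 + b * t + c + d * cnj t + e * (cnj t)\<^sup>2)
      + (a * (- t)\<^sup>2 + b * (- t) + c + d * cnj (- t) + e * (cnj (- t))\<^sup>2)"
      by (simp add: algebra_simps)
    also have "\<dots> = 0" unfolding assms[OF t] minus by simp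
    finally show ?thesis by (metis mult_eq_0_iff zero_neq_numeral)
  qed
  have 1: "a + c + e = 0" using even[of 1] by simp
  have 2: "- a + c - e = 0" using even[of \<i>] by simp
  have 3: "a * \<i> + c - e * \<i> = 0"
  proof -
    define w where "w = Complex (1 / sqrt 2) (1 / sqrt 2)"
    have "w * cnj w = 1" "w\<^sup>2 = \<i>" "(cnj w)\<^sup>2 = - \<i>"
      by (auto simp: w_def complex_eq_iff power2_eq_square real_sqrt_divide)
    then show ?thesis using even[of w] by simp
  qed
  have "2 * c = (a + c + e) + (- a + c - e)" by simp
  then have c: "c = 0" unfolding 1 2 by simp
  then have a: "a = - e" using 1 by (simp add: eq_neg_iff_add_eq_0)
  have "\<i> * (2 * e) = - (a * \<i> + c - e * \<i>)" unfolding a c by simp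
  then show ?thesis unfolding 3 by simp
qed

text \<open>Each minor of \<open>A + t * B + cnj t * C + D\<close> is a trigonometric polynomial on the unit circle,
  and its coefficient at \<open>(cnj t)\<^sup>2\<close> is the same minor of \<open>C\<close>.\<close>

lemma rank_le_one_polarize:
  assumes "\<And>t. t * cnj t = 1 \<Longrightarrow>
    rank_le_one (\<lambda>x y. A x y + t * B x y + cnj t * C x y + D x y)"
  shows "rank_le_one C"
  unfolding rank_le_one_def
proof (intro allI)
  fix x y z w
  have "C x y * C z w - C x w * C z y = 0"
  proof (rule trig_coefficient_zero[where a = "B x y * B z w - B x w * B z y"
      and b = "(A x y + D x y) * B z w + B x y * (A z w + D z w) - (A x w + D x w) * B z y - B x w * (A z y + D z y)"
      and d = "(A x y + D x y) * C z w + C x y * (A z w + D z w) - (A x w + D x w) * C z y - C x w * (A z y + D z y)"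
      and c = "(A x y + D x y) * (A z w + D z w) - (A x w + D x w) * (A z y + D z y)
        + B x y * C z w + C x y * B z w - B x w * C z y - C x w * B z y"])
    fix t :: complex assume t: "t * cnj t = 1"
    have "(A x y + t * B x y + cnj t * C x y + D x y) * (A z w + t * B z w + cnj t * C z w + D z w)
      = (A x w + t * B x w + cnj t * C x w + D x w) * (A z y + t * B z y + cnj t * C z y + D z y)"
      using assms[OF t] unfolding rank_le_one_def by blast
    then have "(B x y * B z w - B x w * B z y) * t\<^sup>2 +
      ((A x y + D x y) * B z w + B x y * (A z w + D z w) - (A x w + D x w) * B z y - B x w * (A z y + D z y)) * t +
      ((A x y + D x y) * (A z w + D z w) - (A x w + D x w) * (A z y + D z y)
        + (t * cnj t) * (B x y * C z w + C x y * B z w - B x w * C z y - C x w * B z y)) +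
      ((A x y + D x y) * C z w + C x y * (A z w + D z w) - (A x w + D x w) * C z y - C x w * (A z y + D z y)) * cnj t +
      (C x y * C z w - C x w * C z y) * (cnj t)\<^sup>2 = 0"
      by (simp add: algebra_simps power2_eq_square)
    then show "(B x y * B z w - B x w * B z y) * t\<^sup>2 +
      ((A x y + D x y) * B z w + B x y * (A z w + D z w) - (A x w + D x w) * B z y - B x w * (A z y + D z y)) * t +
      ((A x y + D x y) * (A z w + D z w) - (A x w + D x w) * (A z y + D z y)
        + B x y * C z w + C x y * B z w - B x w * C z y - C x w * B z y) +
      ((A x y + D x y) * C z w + C x y * (A z w + D z w) - (A x w + D x w) * C z y - C x w * (A z y + D z y)) * cnj t +
      (C x y * C z w - C x w * C z y) * (cnj t)\<^sup>2 = 0"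
      unfolding t by (simp add: algebra_simps)
  qed
  then show "C x y * C z w = C x w * C z y" by simp
qed

lemma rank_le_one_scale:
  assumes "rank_le_one P"
  shows "rank_le_one (\<lambda>a b. c * P a b)"
  unfolding rank_le_one_def
proof (intro allI)
  fix x y z w
  have "c * P x y * (c * P z w) = c * c * (P x y * P z w)" by simp
  also have "P x y * P z w = P x w * P z y" using assms unfolding rank_le_one_def by blast
  finally show "c * P x y * (c * P z w) = c * P x w * (c * P z y)" by simp
qed

definition slots :: "nat \<Rightarrow> (nat \<times> bool) set" where
  "slots m = {1..m} \<times> UNIV"

lemma slots_iff [simp]: "(k, b) \<in> slots m \<longleftrightarrow> k \<in> {1..m}"
  by (simp add: slots_def)

lemma finite_slots: "finite (slots m)"
  by (simp add: slots_def)

lemma prod_slots: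
  fixes f :: "nat \<times> bool \<Rightarrow> 'a::comm_monoid_mult"
  shows "(\<Prod>s\<in>slots m. f s) = (\<Prod>k=1..m. f (k, True) * f (k, False))"
proof -
  have "(\<Prod>s\<in>slots m. f s) = (\<Prod>k=1..m. \<Prod>b\<in>UNIV. f (k, b))"
    unfolding slots_def by (subst prod.cartesian_product) (simp add: case_prod_unfold)
  then show ?thesis by (simp add: UNIV_bool mult.commute)
qed

context tensor_range_preserver
begin

text \<open>The tensor product of the rank one matrices with entries \<open>w (k, True) i * w (k, False) j\<close>.
  There is no conjugation, so the product is complex linear in each of the \<open>2 * m\<close> vectors.\<close>

definition dyad :: "(nat \<times> bool \<Rightarrow> nat \<Rightarrow> complex) \<Rightarrow> complex mat" where
  "dyad w = kron_prod (\<lambda>k. mat (n k) (n k) (\<lambda>(i, j). w (k, True) i * w (k, False) j)) m"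

definition slot_digit :: "nat \<Rightarrow> nat \<Rightarrow> nat \<times> bool \<Rightarrow> nat" where
  "slot_digit i j = (\<lambda>(k, b). digit n m (if b then i else j) k)"

lemma slot_digit_simps [simp]:
  "slot_digit i j (k, True) = digit n m i k" "slot_digit i j (k, False) = digit n m j k"
  by (simp_all add: slot_digit_def)

lemma slot_digit_less: "s \<in> slots m \<Longrightarrow> slot_digit i j s < n (fst s)"
  by (cases s) (auto simp: slot_digit_def intro!: digit_less[OF pos])

lemma dyad_carrier: "dyad w \<in> carrier_mat N N"
  unfolding dyad_def by (rule kron_carrier_N) simp

text \<open>The product over the \<open>2 * m\<close> slots shows the entry as a multilinear function of all vectors.\<close>

lemma dyad_index:
  assumes "i < N" "j < N"
  shows "dyad w $$ (i, j) = (\<Prod>s\<in>slots m. w s (slot_digit i j s))"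
proof -
  have "dyad w $$ (i, j) = (\<Prod>k=1..m. w (k, True) (digit n m i k) * w (k, False) (digit n m j k))"
    unfolding dyad_def using assms N digit_less[OF pos]
    by (subst kron_prod_index[of _ _ n]) (auto intro!: prod.cong)
  then show ?thesis by (simp add: prod_slots)
qed

lemma dyad_linear:
  assumes s: "s \<in> slots m"
  shows "dyad (w(s := \<lambda>i. x i + c * y i)) = dyad (w(s := x)) + c \<cdot>\<^sub>m dyad (w(s := y))"
proof (rule eq_matI)
  fix i j assume "i < dim_row (dyad (w(s := x)) + c \<cdot>\<^sub>m dyad (w(s := y)))"
    "j < dim_col (dyad (w(s := x)) + c \<cdot>\<^sub>m dyad (w(s := y)))"
  then have ij: "i < N" "j < N" using dyad_carrier[of "w(s := y)"] by auto
  have upd: "dyad (w(s := z)) $$ (i, j) = z (slot_digit i j s) * (\<Prod>t\<in>slots m - {s}. w t (slot_digit i j t))" for z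
    unfolding dyad_index[OF ij] prod.remove[OF finite_slots s] by (auto intro!: prod.cong)
  show "dyad (w(s := \<lambda>i. x i + c * y i)) $$ (i, j) = (dyad (w(s := x)) + c \<cdot>\<^sub>m dyad (w(s := y))) $$ (i, j)"
    using ij carrier_matD[OF dyad_carrier[of "w(s := x)"]] carrier_matD[OF dyad_carrier[of "w(s := y)"]]
    by (simp add: upd algebra_simps)
qed (use dyad_carrier in \<open>auto simp: carrier_matD[OF dyad_carrier]\<close>)

definition entries :: "complex mat \<Rightarrow> nat \<Rightarrow> nat \<Rightarrow> complex" where
  "entries X = (\<lambda>r c. if r < N \<and> c < N then X $$ (r, c) else 0)"

definition image_dyad :: "(nat \<times> bool \<Rightarrow> nat \<Rightarrow> complex) \<Rightarrow> nat \<Rightarrow> nat \<Rightarrow> complex" where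
  "image_dyad w = entries (\<phi> (dyad w))"

lemma image_dyad_linear:
  assumes s: "s \<in> slots m"
  shows "image_dyad (w(s := \<lambda>i. x i + c * y i))
    = (\<lambda>a b. image_dyad (w(s := x)) a b + c * image_dyad (w(s := y)) a b)"
proof -
  have "\<phi> (dyad (w(s := \<lambda>i. x i + c * y i))) = \<phi> (dyad (w(s := x))) + c \<cdot>\<^sub>m \<phi> (dyad (w(s := y)))"
    unfolding dyad_linear[OF s] using dyad_carrier by (simp add: add smult)
  then show ?thesis
    using carrier_matD[OF closed[OF dyad_carrier[of "w(s := x)"]]]
      carrier_matD[OF closed[OF dyad_carrier[of "w(s := y)"]]]
    by (auto simp: image_dyad_def entries_def fun_eq_iff)
qed

lemma image_dyad_local:
  assumes "\<And>s. s \<in> slots m \<Longrightarrow> w s = w' s"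
  shows "image_dyad w = image_dyad w'"
proof -
  have "dyad w = dyad w'" unfolding dyad_def using assms by (intro kron_prod_cong) simp
  then show ?thesis by (simp add: image_dyad_def)
qed

text \<open>The product matrix is nonzero, so its numerical range, which is also that of its image, contains a
  nonzero point.\<close>

lemma image_dyad_nonzero:
  assumes "\<And>s. s \<in> slots m \<Longrightarrow> \<exists>i<n (fst s). w s i \<noteq> 0"
  shows "image_dyad w \<noteq> (\<lambda>_ _. 0)"
proof
  assume zero: "image_dyad w = (\<lambda>_ _. 0)"
  have "\<phi> (dyad w) = 0\<^sub>m N N"
    using zero carrier_matD[OF closed[OF dyad_carrier[of w]]]
    by (intro eq_matI) (auto simp: image_dyad_def entries_def fun_eq_iff split: if_splits)
  then have "numerical_range (dyad w) = numerical_range (0\<^sub>m N N)"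
    using range[of "\<lambda>k. mat (n k) (n k) (\<lambda>(i, j). w (k, True) i * w (k, False) j)"] by (simp add: dyad_def)
  also have "\<dots> \<subseteq> {0}"
  proof
    fix z assume "z \<in> numerical_range (0\<^sub>m N N)"
    then obtain u where u: "u \<in> carrier_vec N" and z: "z = (0\<^sub>m N N *\<^sub>v u) \<bullet>c u"
      using numerical_range_iff[of "0\<^sub>m N N" N] by auto
    show "z \<in> {0}" unfolding z cscalar_prod_mat_sum[OF zero_carrier_mat u u] by simp
  qed
  finally have D: "dyad w = 0\<^sub>m N N" by (rule numerical_range_zero_imp_zero[OF dyad_carrier])
  obtain f where f: "\<And>s. s \<in> slots m \<Longrightarrow> f s < n (fst s) \<and> w s (f s) \<noteq> 0" using assms by metis
  have "\<exists>i<N. \<forall>k\<in>{1..m}. digit n m i k = f (k, b)" for b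
    unfolding N using f by (intro digit_surj) force
  then obtain i j where ij: "i < N" "j < N"
    and d: "\<forall>k\<in>{1..m}. digit n m i k = f (k, True)" "\<forall>k\<in>{1..m}. digit n m j k = f (k, False)"
    by metis
  have "slot_digit i j s = f s" if "s \<in> slots m" for s
    using that d by (cases s) (auto simp: slot_digit_def)
  then have "(\<Prod>s\<in>slots m. w s (slot_digit i j s)) \<noteq> 0"
    using f by (simp add: prod_zero_iff[OF finite_slots])
  then show False using D ij dyad_index[OF ij, of w] by simp
qed

text \<open>In a suitable orthonormal basis the image is a diagonal matrix unit.\<close>

lemma rank_image_mat_unit:
  assumes i: "i < N"
  shows "rank_le_one (entries (\<phi> (mat_unit N i i)))"
proof -
  obtain V where V: "V \<in> carrier_mat N N" "unitary_mat V"
    and VP: "V * \<phi> (mat_unit N i i) * mat_adjoint V = mat_unit N i i"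
    using diagonalize_diagonal_units i by blast
  let ?P = "\<phi> (mat_unit N i i)" and ?V = "mat_adjoint V"
  have P: "?P \<in> carrier_mat N N" by (rule closed) simp
  have V': "?V \<in> carrier_mat N N" using V by simp
  have "?P = (?V * V) * ?P * (?V * V)" using V P by (simp add: unitary_matD)
  also have "\<dots> = ?V * (V * ?P * ?V) * V"
    using V V' P by (simp add: assoc_mult_mat[of _ N N _ N _ N])
  finally have eq: "?P = ?V * mat_unit N i i * V" unfolding VP .
  have "?P $$ (r, c) = cnj (V $$ (i, r)) * V $$ (i, c)" if rc: "r < N" "c < N" for r c
  proof -
    have left: "(?V * mat_unit N i i) $$ (r, a) = (if a = i then cnj (V $$ (i, r)) else 0)" if "a < N" for a
    proof -
      have "(?V * mat_unit N i i) $$ (r, a) = (\<Sum>b=0..<N. if b = i then (if a = i then cnj (V $$ (b, r)) else 0) else 0)"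
        using V rc that by (auto simp: scalar_prod_def mat_unit_def simp del: sum.delta sum.delta' intro!: sum.cong)
      then show ?thesis using i by simp
    qed
    have "?P $$ (r, c) = (\<Sum>a=0..<N. (?V * mat_unit N i i) $$ (r, a) * V $$ (a, c))"
      unfolding eq using V rc mat_unit_carrier[of N i i]
      by (auto simp: scalar_prod_def simp del: mat_unit_index intro!: sum.cong)
    also have "\<dots> = (\<Sum>a=0..<N. if a = i then cnj (V $$ (i, r)) * V $$ (a, c) else 0)"
      by (intro sum.cong refl) (simp add: left)
    finally show ?thesis using i by simp
  qed
  then show ?thesis by (auto simp: rank_le_one_def entries_def)
qed

text \<open>A product of positive semidefinite rank one matrices is, up to a factor, the conjugate of
  a diagonal matrix unit by a tensor product of unitary matrices.\<close>

lemma rank_image_projection: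
  assumes conj: "\<And>k i. k \<in> {1..m} \<Longrightarrow> w (k, False) i = cnj (w (k, True) i)"
  shows "rank_le_one (image_dyad w)"
proof -
  have "\<exists>Q a. Q \<in> carrier_mat (n k) (n k) \<and> unitary_mat Q \<and> (\<forall>i<n k. w (k, True) i = a * Q $$ (i, 0))"
    if "k \<in> {1..m}" for k using unitary_with_first_column pos that by blast
  then obtain Q a where Q: "\<forall>k\<in>{1..m}. Q k \<in> carrier_mat (n k) (n k)" "\<forall>k\<in>{1..m}. unitary_mat (Q k)"
    and wQ: "\<And>k i. k \<in> {1..m} \<Longrightarrow> i < n k \<Longrightarrow> w (k, True) i = a k * Q k $$ (i, 0)"
    by metis
  let ?Q = "kron_prod Q m"
  have Qc: "?Q \<in> carrier_mat N N" by (rule kron_carrier_N[OF Q(1)])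
  interpret T: tensor_range_preserver m N n
    "\<lambda>X. 1\<^sub>m N * \<phi> (?Q * X * mat_adjoint ?Q) * mat_adjoint (1\<^sub>m N)"
    by (rule change_of_basis[OF Q]) (auto simp: unitary_mat_one)
  have digit0: "digit n m 0 k = 0" for k
  proof -
    have "digit n l 0 k = 0" for l by (induction l) auto
    then show ?thesis .
  qed
  define c where "c = (\<Prod>k=1..m. a k * cnj (a k))"
  let ?E = "mat_unit N 0 0"
  have QEQ: "?Q * ?E * mat_adjoint ?Q \<in> carrier_mat N N" using Qc by simp
  have "dyad w = c \<cdot>\<^sub>m (?Q * ?E * mat_adjoint ?Q)"
  proof (rule eq_matI)
    fix i j assume "i < dim_row (c \<cdot>\<^sub>m (?Q * ?E * mat_adjoint ?Q))" "j < dim_col (c \<cdot>\<^sub>m (?Q * ?E * mat_adjoint ?Q))"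
    then have ij: "i < N" "j < N" using Qc by auto
    have left: "(?Q * ?E) $$ (i, b) = (if b = 0 then ?Q $$ (i, 0) else 0)" if "b < N" for b
    proof -
      have "(?Q * ?E) $$ (i, b) = (\<Sum>l=0..<N. if l = 0 then (if b = 0 then ?Q $$ (i, l) else 0) else 0)"
        using Qc ij that by (auto simp: scalar_prod_def mat_unit_def simp del: sum.delta sum.delta' intro!: sum.cong)
      then show ?thesis using N_pos by simp
    qed
    have "(?Q * ?E * mat_adjoint ?Q) $$ (i, j) = (\<Sum>b=0..<N. (?Q * ?E) $$ (i, b) * cnj (?Q $$ (j, b)))"
      using Qc ij mat_unit_carrier[of N 0 0]
      by (auto simp: scalar_prod_def simp del: mat_unit_index intro!: sum.cong)
    also have "\<dots> = (\<Sum>b=0..<N. if b = 0 then ?Q $$ (i, 0) * cnj (?Q $$ (j, b)) else 0)"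
      by (intro sum.cong refl) (simp add: left)
    also have "\<dots> = ?Q $$ (i, 0) * cnj (?Q $$ (j, 0))" using N_pos by simp
    also have "\<dots> = (\<Prod>k=1..m. Q k $$ (digit n m i k, 0) * cnj (Q k $$ (digit n m j k, 0)))"
      using ij N_pos unfolding N by (simp add: kron_prod_index[OF Q(1)] digit0 prod.distrib)
    finally have "c * (?Q * ?E * mat_adjoint ?Q) $$ (i, j)
        = (\<Prod>k=1..m. a k * cnj (a k) * (Q k $$ (digit n m i k, 0) * cnj (Q k $$ (digit n m j k, 0))))"
      unfolding c_def by (simp add: prod.distrib)
    also have "\<dots> = (\<Prod>k=1..m. w (k, True) (digit n m i k) * w (k, False) (digit n m j k))"
      by (intro prod.cong refl) (simp add: conj wQ digit_less[OF pos] ac_simps)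
    also have "\<dots> = dyad w $$ (i, j)" by (simp add: dyad_index[OF ij] prod_slots)
    finally show "dyad w $$ (i, j) = (c \<cdot>\<^sub>m (?Q * ?E * mat_adjoint ?Q)) $$ (i, j)"
      using ij Qc by simp
  qed (use Qc carrier_matD[OF dyad_carrier[of w]] in auto)
  then have "\<phi> (dyad w) = c \<cdot>\<^sub>m \<phi> (?Q * ?E * mat_adjoint ?Q)" by (simp only: smult[OF QEQ])
  moreover have "rank_le_one (entries (\<phi> (?Q * ?E * mat_adjoint ?Q)))"
  proof -
    have "mat_adjoint (1\<^sub>m N) = (1\<^sub>m N :: complex mat)" by (rule eq_matI) auto
    then show ?thesis
      using T.rank_image_mat_unit[OF N_pos] closed[OF QEQ] by (simp add: T.entries_def entries_def)
  qed
  moreover have "entries (c \<cdot>\<^sub>m \<phi> (?Q * ?E * mat_adjoint ?Q))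
      = (\<lambda>a b. c * entries (\<phi> (?Q * ?E * mat_adjoint ?Q)) a b)"
    using carrier_matD[OF closed[OF QEQ]] by (auto simp: entries_def fun_eq_iff)
  ultimately show ?thesis by (simp add: image_dyad_def rank_le_one_scale)
qed

text \<open>Induction on the set \<open>K\<close> of factors in which the second vector is allowed to differ from the
  conjugate of the first.  If these vectors are \<open>x\<close> and the conjugate of \<open>z\<close> in one
  factor, then \<open>x + t * z\<close> and its conjugate form a Hermitian dyad there, and the value for the
  original pair appears as the coefficient of \<open>cnj t\<close>.\<close>

lemma rank_image_dyad: "rank_le_one (image_dyad w)"
proof -
  have "rank_le_one (image_dyad w)"
    if "\<And>k i. k \<in> {1..m} - K \<Longrightarrow> w (k, False) i = cnj (w (k, True) i)" "K \<subseteq> {1..m}" for K w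
    using finite_subset[OF that(2) finite_atLeastAtMost] that
  proof (induction K arbitrary: w rule: finite_induct)
    case empty then show ?case by (intro rank_image_projection) simp
  next
    case (insert k K)
    let ?s = "(k, True)" and ?s' = "(k, False)"
    have s: "?s \<in> slots m" "?s' \<in> slots m" using insert.prems by auto
    define x where "x = w ?s"
    define z where "z = (\<lambda>i. cnj (w ?s' i))"
    define x' where "x' = (\<lambda>i. cnj (x i))"
    let ?W = "\<lambda>u v. image_dyad (w(?s := u, ?s' := v))"
    have expand: "image_dyad (w(?s := \<lambda>i. x i + t * z i, ?s' := \<lambda>i. x' i + cnj t * w ?s' i))
      = (\<lambda>a b. ?W x x' a b + t * ?W z x' a b + cnj t * ?W x (w ?s') a b + ?W z (w ?s') a b)"
      if t: "t * cnj t = 1" for t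
    proof -
      have twist: "w(?s := u, ?s' := v) = w(?s' := v, ?s := u)" for u v by (simp add: fun_upd_twist)
      have 1: "?W (\<lambda>i. x i + t * z i) v = (\<lambda>a b. ?W x v a b + t * ?W z v a b)" for v
        unfolding twist by (rule image_dyad_linear[OF s(1)])
      have "image_dyad (w(?s := \<lambda>i. x i + t * z i, ?s' := \<lambda>i. x' i + cnj t * w ?s' i))
        = (\<lambda>a b. ?W (\<lambda>i. x i + t * z i) x' a b + cnj t * ?W (\<lambda>i. x i + t * z i) (w ?s') a b)"
        by (rule image_dyad_linear[OF s(2)])
      also have "\<dots> = (\<lambda>a b. ?W x x' a b + t * ?W z x' a b + cnj t * ?W x (w ?s') a b + (t * cnj t) * ?W z (w ?s') a b)"
        unfolding 1 by (simp add: algebra_simps)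
      finally show ?thesis using t by simp
    qed
    have "rank_le_one (\<lambda>a b. ?W x x' a b + t * ?W z x' a b + cnj t * ?W x (w ?s') a b + ?W z (w ?s') a b)"
      if t: "t * cnj t = 1" for t
      unfolding expand[OF t, symmetric]
    proof (rule insert.IH)
      show "K \<subseteq> {1..m}" using insert.prems by simp
      fix l i assume l: "l \<in> {1..m} - K"
      show "(w(?s := \<lambda>i. x i + t * z i, ?s' := \<lambda>i. x' i + cnj t * w ?s' i)) (l, False) i
        = cnj ((w(?s := \<lambda>i. x i + t * z i, ?s' := \<lambda>i. x' i + cnj t * w ?s' i)) (l, True) i)"
        using l insert.prems(1)[of l i] by (cases "l = k") (auto simp: x'_def z_def)
    qed
    then have "rank_le_one (?W x (w ?s'))" by (rule rank_le_one_polarize)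
    moreover have "w(?s := x, ?s' := w ?s') = w" by (auto simp: x_def fun_eq_iff)
    ultimately show ?case by simp
  qed
  from this[of "{1..m}"] show ?thesis by simp
qed

sublocale dyads: rank_one_multilinear "slots m" "\<lambda>s. n (fst s)" image_dyad
proof
  show "finite (slots m)" by (rule finite_slots)
  show "n (fst s) \<ge> 2" if "s \<in> slots m" for s using that dims by (cases s) auto
qed (fact image_dyad_linear image_dyad_local rank_image_dyad image_dyad_nonzero)+

end

section \<open>The images of the matrix units\<close>

context tensor_range_preserver
begin

text \<open>The index with the digits of \<open>j\<close> in the factors from \<open>T\<close> and the digits of \<open>i\<close> elsewhere.
  Transposing the factors in \<open>T\<close> moves the entry at \<open>(i, j)\<close> to \<open>(mix T i j, mix T j i)\<close>.\<close>

definition mix :: "nat set \<Rightarrow> nat \<Rightarrow> nat \<Rightarrow> nat" where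
  "mix T i j = (SOME l. l < N \<and> (\<forall>k\<in>{1..m}. digit n m l k = digit n m (if k \<in> T then j else i) k))"

lemma mix:
  shows mix_less: "mix T i j < N"
    and digit_mix: "k \<in> {1..m} \<Longrightarrow> digit n m (mix T i j) k = digit n m (if k \<in> T then j else i) k"
proof -
  have "\<exists>l<N. \<forall>k\<in>{1..m}. digit n m l k = digit n m (if k \<in> T then j else i) k"
    unfolding N by (rule digit_surj) (simp add: digit_less[OF pos])
  then have "mix T i j < N \<and> (\<forall>k\<in>{1..m}. digit n m (mix T i j) k = digit n m (if k \<in> T then j else i) k)"
    unfolding mix_def by (rule someI_ex[of "\<lambda>l. l < N \<and> _ l"])
  then show "mix T i j < N"
    "k \<in> {1..m} \<Longrightarrow> digit n m (mix T i j) k = digit n m (if k \<in> T then j else i) k" by auto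
qed

lemma digit_eqI: "i < N \<Longrightarrow> j < N \<Longrightarrow> (\<And>k. k \<in> {1..m} \<Longrightarrow> digit n m i k = digit n m j k) \<Longrightarrow> i = j"
  using digit_inject[OF pos] N by blast

lemma mix_self: "i < N \<Longrightarrow> mix T i i = i"
  by (rule digit_eqI[OF mix_less]) (auto simp: digit_mix)

lemma mix_mix: "i < N \<Longrightarrow> mix T (mix T i j) (mix T j i) = i"
  by (rule digit_eqI[OF mix_less]) (auto simp: digit_mix)

lemma unit_value_slot_digit:
  assumes ij: "i < N" "j < N"
  shows "dyads.unit_value (slot_digit i j) = entries (\<phi> (mat_unit N i j))"
proof -
  have "dyad (\<lambda>s a. if a = slot_digit i j s then 1 else 0) = mat_unit N i j"
  proof (rule eq_matI)
    fix a b assume "a < dim_row (mat_unit N i j)" "b < dim_col (mat_unit N i j)"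
    then have ab: "a < N" "b < N" by auto
    have "(\<forall>s\<in>slots m. slot_digit a b s = slot_digit i j s) \<longleftrightarrow> a = i \<and> b = j"
      using digit_eqI[OF ab(1) ij(1)] digit_eqI[OF ab(2) ij(2)]
      by (auto simp: slots_def slot_digit_def split: if_splits)
    then show "dyad (\<lambda>s a. if a = slot_digit i j s then 1 else 0) $$ (a, b) = mat_unit N i j $$ (a, b)"
      using ab by (simp add: dyad_index prod_indicator[OF finite_slots])
  qed (auto simp: carrier_matD[OF dyad_carrier])
  then show ?thesis by (simp add: dyads.unit_value_def image_dyad_def)
qed

lemma valid_slot_digit: "dyads.valid (slot_digit i j)"
  by (simp add: dyads.valid_def slot_digit_less)

text \<open>In an untransposed factor the first vector of a dyad controls the column of the image.  The
  factors in which it controls the row instead are those that the map transposes.\<close>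

definition transposed :: "nat set" where
  "transposed = {k\<in>{1..m}. dyads.row_slot (k, True) (slot_digit 0 0)}"

lemma row_slot_any: "s \<in> slots m \<Longrightarrow> dyads.row_slot s (slot_digit i j) = dyads.row_slot s (slot_digit 0 0)"
  using dyads.row_slot_independent valid_slot_digit by blast

lemma exists_other_index:
  assumes k: "k \<in> {1..m}"
  obtains i where "i < N" "i \<noteq> 0" "\<And>l. l \<in> {1..m} \<Longrightarrow> l \<noteq> k \<Longrightarrow> digit n m i l = digit n m 0 l"
proof -
  have "\<exists>i<N. \<forall>l\<in>{1..m}. digit n m i l = (if l = k then if digit n m 0 k = 0 then 1 else 0 else digit n m 0 l)"
    unfolding N using dims by (intro digit_surj) (fastforce simp: digit_less[OF pos])
  then obtain i where i: "i < N"
    "\<forall>l\<in>{1..m}. digit n m i l = (if l = k then if digit n m 0 k = 0 then 1 else 0 else digit n m 0 l)" by blast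
  have "digit n m i k \<noteq> digit n m 0 k" using i(2) k by auto
  then have "i \<noteq> 0" by metis
  then show ?thesis using that i by auto
qed

text \<open>If both slots of a factor had the same type, then two diagonal matrix units whose indices
  differ in one digit only would have images with a common row or a common column.\<close>

lemma partner_slot:
  assumes normal: "\<And>i. i < N \<Longrightarrow> \<phi> (mat_unit N i i) = mat_unit N i i"
    and k: "k \<in> {1..m}"
  shows "dyads.row_slot (k, False) (slot_digit 0 0) \<longleftrightarrow> \<not> dyads.row_slot (k, True) (slot_digit 0 0)"
proof -
  obtain i where i: "i < N" "i \<noteq> 0"
    and only: "\<And>l. l \<in> {1..m} \<Longrightarrow> l \<noteq> k \<Longrightarrow> digit n m i l = digit n m 0 l"
    using exists_other_index[OF k] by blast
  have ent: "entries (\<phi> (mat_unit N a a)) = (\<lambda>r c. if r < N \<and> c < N \<and> r = a \<and> c = a then 1 else 0)"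
    if "a < N" for a using that by (auto simp: normal entries_def fun_eq_iff)
  have diff: "s = (k, True) \<or> s = (k, False)" if "s \<in> slots m" "slot_digit 0 0 s \<noteq> slot_digit i i s" for s
    using that only by (cases s) (auto simp: slot_digit_def, metis)
  have 1: "\<not> (dyads.row_slot (k, True) (slot_digit 0 0) \<and> dyads.row_slot (k, False) (slot_digit 0 0))"
  proof
    assume *: "dyads.row_slot (k, True) (slot_digit 0 0) \<and> dyads.row_slot (k, False) (slot_digit 0 0)"
    have "same_column (dyads.unit_value (slot_digit 0 0)) (dyads.unit_value (slot_digit i i))"
      by (rule dyads.same_column_changing_row_slots[OF valid_slot_digit valid_slot_digit]) (use diff * in blast)
    then have "same_column (entries (\<phi> (mat_unit N 0 0))) (entries (\<phi> (mat_unit N i i)))"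
      using unit_value_slot_digit N_pos i by simp
    then have "entries (\<phi> (mat_unit N 0 0)) 0 0 * entries (\<phi> (mat_unit N i i)) i i
        = entries (\<phi> (mat_unit N 0 0)) i 0 * entries (\<phi> (mat_unit N i i)) 0 i"
      unfolding same_column_def by blast
    then show False using i N_pos by (simp add: ent)
  qed
  have 2: "\<not> (dyads.column_slot (k, True) (slot_digit 0 0) \<and> dyads.column_slot (k, False) (slot_digit 0 0))"
  proof
    assume *: "dyads.column_slot (k, True) (slot_digit 0 0) \<and> dyads.column_slot (k, False) (slot_digit 0 0)"
    have "same_row (dyads.unit_value (slot_digit 0 0)) (dyads.unit_value (slot_digit i i))"
      by (rule dyads.same_row_changing_column_slots[OF valid_slot_digit valid_slot_digit]) (use diff * in blast)
    then have "same_row (entries (\<phi> (mat_unit N 0 0))) (entries (\<phi> (mat_unit N i i)))"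
      using unit_value_slot_digit N_pos i by simp
    then have "entries (\<phi> (mat_unit N 0 0)) 0 0 * entries (\<phi> (mat_unit N i i)) i i
        = entries (\<phi> (mat_unit N 0 0)) 0 i * entries (\<phi> (mat_unit N i i)) i 0"
      unfolding same_row_def by blast
    then show False using i N_pos by (simp add: ent)
  qed
  show ?thesis
    using 1 2 k dyads.row_or_column_slot[OF valid_slot_digit[of 0 0], of "(k, True)"]
      dyads.row_or_column_slot[OF valid_slot_digit[of 0 0], of "(k, False)"] by auto
qed

text \<open>The pair \<open>(i, j)\<close> arises from the diagonal pair at \<open>mix transposed i j\<close> by changes in row slots only,
  so the image has the column of that diagonal matrix unit; likewise for the row.\<close>

lemma image_mat_unit_support:
  assumes normal: "\<And>i. i < N \<Longrightarrow> \<phi> (mat_unit N i i) = mat_unit N i i"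
    and ij: "i < N" "j < N" and rc: "r < N" "c < N"
    and ne: "\<phi> (mat_unit N i j) $$ (r, c) \<noteq> 0"
  shows "r = mix transposed i j" "c = mix transposed j i"
proof -
  let ?a = "mix transposed i j" and ?b = "mix transposed j i"
  have ab: "?a < N" "?b < N" by (rule mix_less)+
  have row: "dyads.row_slot (k, b) (slot_digit l l) \<longleftrightarrow> (k \<in> transposed \<longleftrightarrow> b)" if "k \<in> {1..m}" for k b l
    using that partner_slot[OF normal that] row_slot_any[of "(k, b)" l l]
    by (cases b) (auto simp: transposed_def)
  have column: "dyads.column_slot (k, b) (slot_digit l l) \<longleftrightarrow> \<not> (k \<in> transposed \<longleftrightarrow> b)" if "k \<in> {1..m}" for k b l
    using row[OF that] dyads.row_or_column_slot[OF valid_slot_digit[of l l], of "(k, b)"]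
      dyads.not_row_and_column_slot[OF valid_slot_digit[of l l], of "(k, b)"] that by auto
  have "same_column (dyads.unit_value (slot_digit ?a ?a)) (dyads.unit_value (slot_digit i j))"
  proof (rule dyads.same_column_changing_row_slots[OF valid_slot_digit valid_slot_digit])
    fix s assume s: "s \<in> slots m" "slot_digit ?a ?a s \<noteq> slot_digit i j s"
    then obtain k b where kb: "s = (k, b)" "k \<in> {1..m}" by (cases s) auto
    have "(k \<in> transposed \<longleftrightarrow> b)"
      using s(2) kb by (cases b) (auto simp: digit_mix split: if_splits)
    then show "dyads.row_slot s (slot_digit ?a ?a)" using row kb by blast
  qed
  then have "same_column (entries (mat_unit N ?a ?a)) (entries (\<phi> (mat_unit N i j)))"
    by (simp add: unit_value_slot_digit ab ij normal)
  then have "entries (mat_unit N ?a ?a) ?a ?a * entries (\<phi> (mat_unit N i j)) r c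
      = entries (mat_unit N ?a ?a) r ?a * entries (\<phi> (mat_unit N i j)) ?a c"
    unfolding same_column_def by blast
  then show "r = ?a" using ne rc ab by (auto simp: entries_def split: if_splits)
  have "same_row (dyads.unit_value (slot_digit ?b ?b)) (dyads.unit_value (slot_digit i j))"
  proof (rule dyads.same_row_changing_column_slots[OF valid_slot_digit valid_slot_digit])
    fix s assume s: "s \<in> slots m" "slot_digit ?b ?b s \<noteq> slot_digit i j s"
    then obtain k b where kb: "s = (k, b)" "k \<in> {1..m}" by (cases s) auto
    have "\<not> (k \<in> transposed \<longleftrightarrow> b)"
      using s(2) kb by (cases b) (auto simp: digit_mix split: if_splits)
    then show "dyads.column_slot s (slot_digit ?b ?b)" using column kb by blast
  qed
  then have "same_row (entries (mat_unit N ?b ?b)) (entries (\<phi> (mat_unit N i j)))"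
    by (simp add: unit_value_slot_digit ab ij normal)
  then have "entries (mat_unit N ?b ?b) ?b ?b * entries (\<phi> (mat_unit N i j)) r c
      = entries (mat_unit N ?b ?b) ?b c * entries (\<phi> (mat_unit N i j)) r ?b"
    unfolding same_row_def by blast
  then show "c = ?b" using ne rc ab by (auto simp: entries_def split: if_splits)
qed

text \<open>Since \<open>mix\<close> is an involution on pairs of indices, exactly one matrix unit contributes to a given
  entry of the image.\<close>

lemma image_index:
  assumes normal: "\<And>i. i < N \<Longrightarrow> \<phi> (mat_unit N i i) = mat_unit N i i"
    and X: "X \<in> carrier_mat N N" and rc: "r < N" "c < N"
  shows "\<phi> X $$ (r, c) = X $$ (mix transposed r c, mix transposed c r)
    * \<phi> (mat_unit N (mix transposed r c) (mix transposed c r)) $$ (r, c)"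
proof -
  let ?a = "mix transposed r c" and ?b = "mix transposed c r"
  let ?F = "\<lambda>i j. X $$ (i, j) * \<phi> (mat_unit N i j) $$ (r, c)"
  have zero: "?F i j = 0" if "i < N" "j < N" "\<not> (i = ?a \<and> j = ?b)" for i j
  proof (rule ccontr)
    assume "?F i j \<noteq> 0"
    then have "r = mix transposed i j" "c = mix transposed j i"
      using image_mat_unit_support[OF normal that(1,2) rc] by auto
    then show False using that mix_mix by metis
  qed
  have "\<phi> X $$ (r, c) = (\<Sum>i=0..<N. \<Sum>j=0..<N. ?F i j)" by (rule expand[OF X rc])
  also have "\<dots> = (\<Sum>i=0..<N. \<Sum>j=0..<N. if i = ?a then (if j = ?b then ?F ?a ?b else 0) else 0)"
    by (intro sum.cong refl) (auto simp: zero simp del: mult_eq_0_iff)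
  also have "\<dots> = (\<Sum>i=0..<N. if i = ?a then (\<Sum>j=0..<N. if j = ?b then ?F ?a ?b else 0) else 0)"
    by (intro sum.cong refl) auto
  also have "\<dots> = ?F ?a ?b" using mix_less by simp
  finally show ?thesis .
qed

text \<open>The remaining scalars are the entries of the image of the product of the all-ones
  matrices, which is Hermitian, of rank one and has only ones on the diagonal.\<close>

lemma image_of_kron_normal:
  assumes normal: "\<And>i. i < N \<Longrightarrow> \<phi> (mat_unit N i i) = mat_unit N i i"
  obtains u where "\<And>r. r < N \<Longrightarrow> u r * cnj (u r) = 1"
    and "\<And>A r c. \<forall>k\<in>{1..m}. A k \<in> carrier_mat (n k) (n k) \<Longrightarrow> r < N \<Longrightarrow> c < N \<Longrightarrow>
      \<phi> (kron_prod A m) $$ (r, c) = u r *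
        kron_prod (\<lambda>k. if k \<in> transposed then transpose_mat (A k) else A k) m $$ (r, c) * cnj (u c)"
proof -
  let ?J = "dyad (\<lambda>_ _. 1)"
  define C where "C = (\<lambda>r c. \<phi> ?J $$ (r, c))"
  have J: "?J $$ (i, j) = 1" if "i < N" "j < N" for i j using that by (simp add: dyad_index)
  have C: "\<phi> (mat_unit N (mix transposed r c) (mix transposed c r)) $$ (r, c) = C r c"
    if "r < N" "c < N" for r c
    using image_index[OF normal dyad_carrier that] J mix_less by (simp add: C_def)
  have diag: "C r r = 1" if "r < N" for r
    using C[OF that that] that by (simp add: mix_self normal)
  have rank: "C a b * C r c = C a c * C r b" if "a < N" "b < N" "r < N" "c < N" for a b r c
  proof -
    have "image_dyad (\<lambda>_ _. 1) a b * image_dyad (\<lambda>_ _. 1) r c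
        = image_dyad (\<lambda>_ _. 1) a c * image_dyad (\<lambda>_ _. 1) r b"
      using rank_image_dyad unfolding rank_le_one_def by blast
    then show ?thesis using that by (simp add: image_dyad_def entries_def C_def)
  qed
  have herm: "C c r = cnj (C r c)" if "r < N" "c < N" for r c
  proof -
    have J_herm: "mat_adjoint ?J = ?J"
      using J carrier_matD[OF dyad_carrier[of "\<lambda>_ _. 1"]] by (intro eq_matI) auto
    have "numerical_range ?J \<subseteq> \<real>"
    proof
      fix z assume "z \<in> numerical_range ?J"
      then obtain x where x: "x \<in> carrier_vec N" and z: "z = (?J *\<^sub>v x) \<bullet>c x"
        using numerical_range_iff[OF dyad_carrier] by blast
      have "z = x \<bullet>c (?J *\<^sub>v x)"
        unfolding z using cscalar_prod_adjoint[OF dyad_carrier x x] J_herm by simp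
      also have "\<dots> = cnj z"
        unfolding z by (rule cscalar_prod_commute[OF mult_mat_vec_carrier[OF dyad_carrier x] x])
      finally have "z = cnj z" .
      then show "z \<in> \<real>" by (metis Reals_cnj_iff)
    qed
    then have "numerical_range (\<phi> ?J) \<subseteq> \<real>"
      using range[of "\<lambda>k. mat (n k) (n k) (\<lambda>(i, j). 1 * 1)"] by (simp add: dyad_def)
    then have "mat_adjoint (\<phi> ?J) = \<phi> ?J"
      by (rule numerical_range_real_imp_hermitian[OF closed[OF dyad_carrier]])
    moreover have "mat_adjoint (\<phi> ?J) $$ (c, r) = cnj (\<phi> ?J $$ (r, c))"
      using that carrier_matD[OF closed[OF dyad_carrier[of "\<lambda>_ _. 1"]]] by simp
    ultimately show ?thesis by (simp add: C_def)
  qed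
  define u where "u = (\<lambda>r. C r 0)"
  have C_u: "C r c = u r * cnj (u c)" if "r < N" "c < N" for r c
    using rank[OF that N_pos N_pos] diag[OF N_pos] herm[OF that(2) N_pos] by (simp add: u_def)
  show ?thesis
  proof (rule that)
    show "u r * cnj (u r) = 1" if "r < N" for r using C_u[OF that that] diag[OF that] by simp
    fix A :: "nat \<Rightarrow> complex mat" and r c assume A: "\<forall>k\<in>{1..m}. A k \<in> carrier_mat (n k) (n k)" and rc: "r < N" "c < N"
    let ?B = "\<lambda>k. if k \<in> transposed then transpose_mat (A k) else A k"
    have B: "\<forall>k\<in>{1..m}. ?B k \<in> carrier_mat (n k) (n k)" using A by auto
    have "kron_prod A m $$ (mix transposed r c, mix transposed c r)
        = (\<Prod>k=1..m. A k $$ (digit n m (mix transposed r c) k, digit n m (mix transposed c r) k))"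
      using mix_less[of transposed r c] mix_less[of transposed c r] unfolding N
      by (rule kron_prod_index[OF A])
    also have "\<dots> = (\<Prod>k=1..m. ?B k $$ (digit n m r k, digit n m c k))"
    proof (rule prod.cong[OF refl])
      fix k assume k: "k \<in> {1..m}"
      show "A k $$ (digit n m (mix transposed r c) k, digit n m (mix transposed c r) k)
          = ?B k $$ (digit n m r k, digit n m c k)"
        using bspec[OF A k] digit_less[OF pos k, of r] digit_less[OF pos k, of c]
        by (auto simp: digit_mix[OF k])
    qed
    also have "\<dots> = kron_prod ?B m $$ (r, c)" using kron_prod_index[OF B] rc unfolding N by simp
    finally show "\<phi> (kron_prod A m) $$ (r, c) = u r * kron_prod ?B m $$ (r, c) * cnj (u c)"
      using image_index[OF normal kron_carrier_N[OF A] rc] C[OF rc] C_u[OF rc] by simp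
  qed
qed

text \<open>The general case: first diagonalise the images of the diagonal matrix units by \<open>V\<close>, then collect
  the remaining unimodular scalars in a diagonal unitary matrix \<open>D\<close>.\<close>

lemma image_of_kron:
  "\<exists>U T. U \<in> carrier_mat N N \<and> unitary_mat U \<and> (\<forall>A. (\<forall>k\<in>{1..m}. A k \<in> carrier_mat (n k) (n k)) \<longrightarrow>
    \<phi> (kron_prod A m)
      = U * kron_prod (\<lambda>k. if k \<in> T then transpose_mat (A k) else A k) m * mat_adjoint U)"
proof -
  obtain V where V: "V \<in> carrier_mat N N" "unitary_mat V"
    and VP: "\<And>i. i < N \<Longrightarrow> V * \<phi> (mat_unit N i i) * mat_adjoint V = mat_unit N i i"
    using diagonalize_diagonal_units by blast
  have V': "mat_adjoint V \<in> carrier_mat N N" using V by simp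
  have one: "mat_adjoint (1\<^sub>m N) = (1\<^sub>m N :: complex mat)" by (rule eq_matI) auto
  have K1: "kron_prod (\<lambda>k. 1\<^sub>m (n k)) m = 1\<^sub>m N" unfolding N by (rule kron_prod_one)
  let ?\<phi> = "\<lambda>X. V * \<phi> (1\<^sub>m N * X * mat_adjoint (1\<^sub>m N)) * mat_adjoint V"
  interpret T: tensor_range_preserver m N n ?\<phi>
    using change_of_basis[of "\<lambda>k. 1\<^sub>m (n k)", OF _ _ V] unitary_mat_one unfolding K1 by simp
  have V\<phi>: "?\<phi> X = V * \<phi> X * mat_adjoint V" if "X \<in> carrier_mat N N" for X using that by (simp add: one)
  obtain u where u: "\<And>r. r < N \<Longrightarrow> u r * cnj (u r) = 1"
    and ent: "\<And>A r c. \<forall>k\<in>{1..m}. A k \<in> carrier_mat (n k) (n k) \<Longrightarrow> r < N \<Longrightarrow> c < N \<Longrightarrow>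
      ?\<phi> (kron_prod A m) $$ (r, c) = u r *
        kron_prod (\<lambda>k. if k \<in> T.transposed then transpose_mat (A k) else A k) m $$ (r, c) * cnj (u c)"
  proof (rule T.image_of_kron_normal)
    show "?\<phi> (mat_unit N i i) = mat_unit N i i" if "i < N" for i 
      unfolding V\<phi>[OF mat_unit_carrier] by (rule VP[OF that])
  qed blast
  define D where "D = mat N N (\<lambda>(i, j). if i = j then u i else 0)"
  have D: "D \<in> carrier_mat N N" by (simp add: D_def)
  have D_index: "D $$ (a, b) = (if a = b then u a else 0)" if "a < N" "b < N" for a b
    using that by (simp add: D_def)
  have D': "mat_adjoint D \<in> carrier_mat N N" using D by simp
  have DXD: "(D * X * mat_adjoint D) $$ (r, c) = u r * X $$ (r, c) * cnj (u c)"
    if X: "X \<in> carrier_mat N N" and rc: "r < N" "c < N" for X r c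
  proof -
    have DX: "(D * X) $$ (r, a) = u r * X $$ (r, a)" if "a < N" for a
    proof -
      have "(D * X) $$ (r, a) = (\<Sum>b=0..<N. if b = r then u r * X $$ (b, a) else 0)"
        using X rc that by (auto simp: scalar_prod_def D_def simp del: sum.delta sum.delta' intro!: sum.cong)
      then show ?thesis using rc by simp
    qed
    have "(D * X * mat_adjoint D) $$ (r, c) = (\<Sum>a=0..<N. (D * X) $$ (r, a) * cnj (D $$ (c, a)))"
      using X D rc by (auto simp: scalar_prod_def intro!: sum.cong)
    also have "\<dots> = (\<Sum>a=0..<N. if a = c then u r * X $$ (r, c) * cnj (u c) else 0)"
      using rc by (intro sum.cong refl) (auto simp: DX D_index)
    finally show ?thesis using rc by simp
  qed
  have D_unitary: "unitary_mat D"
  proof (rule unitary_matI[OF D], rule eq_matI)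
    fix a b assume "a < dim_row (1\<^sub>m N)" "b < dim_col (1\<^sub>m N)"
    then have ab: "a < N" "b < N" by auto
    have "D * mat_adjoint D = D * 1\<^sub>m N * mat_adjoint D" using D by simp
    then show "(D * mat_adjoint D) $$ (a, b) = 1\<^sub>m N $$ (a, b)"
      using DXD[of "1\<^sub>m N" a b] ab u by auto
  qed (use D in auto)
  let ?U = "mat_adjoint V * D"
  have "\<phi> (kron_prod A m)
      = ?U * kron_prod (\<lambda>k. if k \<in> T.transposed then transpose_mat (A k) else A k) m * mat_adjoint ?U"
    if A: "\<forall>k\<in>{1..m}. A k \<in> carrier_mat (n k) (n k)" for A
  proof -
    let ?B = "\<lambda>k. if k \<in> T.transposed then transpose_mat (A k) else A k"
    have B: "\<forall>k\<in>{1..m}. ?B k \<in> carrier_mat (n k) (n k)" using A by auto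
    note KA = kron_carrier_N[OF A] and KB = kron_carrier_N[OF B]
    have eq: "V * \<phi> (kron_prod A m) * mat_adjoint V = D * kron_prod ?B m * mat_adjoint D"
    proof (rule eq_matI)
      fix r c assume "r < dim_row (D * kron_prod ?B m * mat_adjoint D)" "c < dim_col (D * kron_prod ?B m * mat_adjoint D)"
      then have "r < N" "c < N" using D by auto
      then show "(V * \<phi> (kron_prod A m) * mat_adjoint V) $$ (r, c) = (D * kron_prod ?B m * mat_adjoint D) $$ (r, c)"
        using ent[OF A] DXD[OF KB] unfolding V\<phi>[OF KA] by simp
    qed (use V D in auto)
    have "\<phi> (kron_prod A m) = (mat_adjoint V * V) * \<phi> (kron_prod A m) * (mat_adjoint V * V)"
      using V closed[OF KA] by (simp add: unitary_matD)
    also have "\<dots> = mat_adjoint V * (V * \<phi> (kron_prod A m) * mat_adjoint V) * V"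
      using V V' closed[OF KA] by (simp add: assoc_mult_mat[of _ N N _ N _ N])
    also have "\<dots> = ?U * kron_prod ?B m * mat_adjoint ?U"
      unfolding eq mat_adjoint_mult[OF V' D] using V V' D D' KB
      by (simp add: assoc_mult_mat[of _ N N _ N _ N])
    finally show ?thesis .
  qed
  moreover have "unitary_mat ?U"
    by (rule unitary_mat_mult[OF V' unitary_mat_adjoint[OF V] D D_unitary])
  ultimately show ?thesis using V' D by (intro exI[of _ ?U] exI[of _ T.transposed]) auto
qed

end

section \<open>Transposition in dimension two\<close>

text \<open>It suffices to solve \<open>transpose_mat A * W = W * A\<close> with a unitary \<open>W\<close>.  For symmetric \<open>W\<close> this is one
  linear equation.  With off-diagonal entry \<open>r\<close> and diagonal entries \<open>s * e\<close> and \<open>- s * cnj e\<close>, where \<open>r\<close> and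
  \<open>s\<close> are real, \<open>r * r + s * s = 1\<close> and \<open>e\<close> is unimodular, \<open>W\<close> is unitary, and \<open>e\<close> can be chosen such that the
  equation has a real solution for the ratio of \<open>r\<close> and \<open>s\<close>.\<close>

lemma transpose_unitarily_similar_two:
  fixes A :: "complex mat"
  assumes A: "A \<in> carrier_mat 2 2"
  shows "\<exists>W. W \<in> carrier_mat 2 2 \<and> unitary_mat W \<and> transpose_mat A = W * A * mat_adjoint W"
proof -
  define a b c d where "a = A $$ (0, 0)" and "b = A $$ (0, 1)" and "c = A $$ (1, 0)" and "d = A $$ (1, 1)"
  have "\<exists>e r s. e * cnj e = 1 \<and> r * r + s * s = 1 \<and> (a - d) * of_real r = of_real s * (b * e + c * cnj e)"
  proof (cases "a = d")
    case True
    then show ?thesis by (intro exI[of _ 1] exI[of _ "1::real"] exI[of _ "0::real"]) auto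
  next
    case False
    define z where "z = cnj (a - d) * b - cnj (cnj (a - d) * c)"
    define e where "e = (if z = 0 then 1 else sgn (cnj z))"
    have e: "e * cnj e = 1" by (auto simp: e_def complex_norm_square[symmetric] norm_sgn)
    have "Im (z * e) = 0"
    proof (cases "z = 0")
      case False
      have "z * e = of_real (cmod z)"
        using False by (simp add: e_def sgn_div_norm scaleR_conv_of_real field_simps complex_norm_square[symmetric] power2_eq_square)
      then show ?thesis by simp
    qed simp
    moreover have "z * e = cnj (a - d) * (b * e + c * cnj e) - (cnj (a - d) * c * cnj e + cnj (cnj (a - d) * c * cnj e))"
      by (simp add: z_def algebra_simps)
    then have "Im (z * e) = Im (cnj (a - d) * (b * e + c * cnj e))"
      by (simp only: minus_complex.sel plus_complex.sel cnj.sel add.right_inverse diff_zero)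
    ultimately have im: "Im (cnj (a - d) * (b * e + c * cnj e)) = 0" by simp
    define \<kappa> where "\<kappa> = Re (cnj (a - d) * (b * e + c * cnj e)) / (cmod (a - d))\<^sup>2"
    have ne: "(cmod (a - d))\<^sup>2 \<noteq> 0" using False by simp
    have "of_real ((cmod (a - d))\<^sup>2) * of_real \<kappa> = cnj (a - d) * (b * e + c * cnj e)"
      using im ne by (simp add: \<kappa>_def complex_eq_iff)
    then have "cnj (a - d) * ((a - d) * of_real \<kappa>) = cnj (a - d) * (b * e + c * cnj e)"
      by (simp add: complex_norm_square mult.assoc mult.left_commute del: of_real_power)
    then have \<kappa>: "(a - d) * of_real \<kappa> = b * e + c * cnj e" using False by simp
    define s where "s = 1 / sqrt (1 + \<kappa>\<^sup>2)"
    have p: "1 + \<kappa>\<^sup>2 > 0" by (simp add: add_pos_nonneg)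
    have "s * s * (1 + \<kappa>\<^sup>2) = 1" using p by (simp add: s_def field_simps)
    then have "(\<kappa> * s) * (\<kappa> * s) + s * s = 1" by (simp add: algebra_simps power2_eq_square)
    moreover have "(a - d) * of_real (\<kappa> * s) = of_real s * (b * e + c * cnj e)"
      using \<kappa> by (simp add: mult.left_commute mult.commute)
    ultimately show ?thesis using e by blast
  qed
  then obtain e r s where e: "e * cnj e = 1" and rs: "r * r + s * s = (1 :: real)"
    and eq: "(a - d) * of_real r = of_real s * (b * e + c * cnj e)" by blast
  define W where "W = mat 2 2 (\<lambda>(i, j). if i \<noteq> j then of_real r else if i = 0 then of_real s * e else - of_real s * cnj e)"
  have W: "W \<in> carrier_mat 2 2" by (simp add: W_def)
  have W_index: "W $$ (0, 0) = of_real s * e" "W $$ (0, 1) = of_real r" "W $$ (1, 0) = of_real r"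
    "W $$ (1, 1) = - of_real s * cnj e" by (auto simp: W_def)
  have two: "i < 2 \<longleftrightarrow> i = 0 \<or> i = 1" for i :: nat by auto
  have prod: "(X * Y) $$ (i, j) = X $$ (i, 0) * Y $$ (0, j) + X $$ (i, 1) * Y $$ (1, j)"
    if "X \<in> carrier_mat 2 2" "Y \<in> carrier_mat 2 2" "i < 2" "j < 2" for X Y :: "complex mat" and i j
    using that by (auto simp: scalar_prod_def numeral_2_eq_2)
  have norm: "of_real r * of_real r + of_real s * of_real s = (1 :: complex)"
    using arg_cong[OF rs, of complex_of_real] by simp
  have "unitary_mat W"
  proof (rule unitary_matI[OF W], rule eq_matI)
    fix i j assume "i < dim_row (1\<^sub>m 2)" "j < dim_col (1\<^sub>m 2)"
    then have ij: "i < 2" "j < 2" by auto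
    have ee: "e * (cnj e * x) = x" for x using e by (simp flip: mult.assoc)
    have entry: "(W * mat_adjoint W) $$ (i, j) = W $$ (i, 0) * cnj (W $$ (j, 0)) + W $$ (i, 1) * cnj (W $$ (j, 1))"
      using prod[OF W _ ij, of "mat_adjoint W"] W ij by simp
    show "(W * mat_adjoint W) $$ (i, j) = 1\<^sub>m 2 $$ (i, j)"
      unfolding entry using ij norm unfolding two
      by (auto simp: ee W_index W_index[unfolded One_nat_def] algebra_simps)
  qed (use W in auto)
  moreover have "transpose_mat A * W = W * A"
  proof (rule eq_matI)
    fix i j assume "i < dim_row (W * A)" "j < dim_col (W * A)"
    then have ij: "i < 2" "j < 2" using W A by auto
    have entry: "(transpose_mat A * W) $$ (i, j) = A $$ (0, i) * W $$ (0, j) + A $$ (1, i) * W $$ (1, j)"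
      using prod[OF _ W ij, of "transpose_mat A"] A ij by simp
    show "(transpose_mat A * W) $$ (i, j) = (W * A) $$ (i, j)"
      unfolding entry prod[OF W A ij] using ij eq unfolding two
      by (auto simp: W_index W_index[unfolded One_nat_def] a_def b_def c_def d_def algebra_simps)
  qed (use W A in auto)
  then have "transpose_mat A * (W * mat_adjoint W) = W * A * mat_adjoint W"
    using W A by (simp add: assoc_mult_mat[of _ 2 2 _ 2 _ 2, symmetric])
  ultimately show ?thesis using W A by (auto simp: unitary_matD)
qed

lemma numerical_range_kron_unitary:
  assumes pos: "\<forall>k\<in>{1..m}. n k > 0"
    and A: "\<forall>k\<in>{1..m}. A k \<in> carrier_mat (n k) (n k)"
    and sim: "\<And>k. k \<in> {1..m} \<Longrightarrow> \<exists>Q. Q \<in> carrier_mat (n k) (n k) \<and> unitary_mat Q \<and> B k = Q * A k * mat_adjoint Q"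
  shows "numerical_range (kron_prod B m) = numerical_range (kron_prod A m)"
proof -
  obtain Q where Q: "\<forall>k\<in>{1..m}. Q k \<in> carrier_mat (n k) (n k)" "\<forall>k\<in>{1..m}. unitary_mat (Q k)"
    and B: "\<And>k. k \<in> {1..m} \<Longrightarrow> B k = Q k * A k * mat_adjoint (Q k)" using sim by metis
  have "kron_prod B m = kron_prod Q m * kron_prod A m * mat_adjoint (kron_prod Q m)"
    unfolding kron_prod_conjugation[OF Q(1) A pos, symmetric] by (rule kron_prod_cong[OF B])
  then show ?thesis
    using numerical_range_unitary[OF kron_prod_carrier[OF A] kron_prod_carrier[OF Q(1)] unitary_kron_prod[OF Q pos]]
    by simp
qed

lemma unitary_similar_refl:
  "A \<in> carrier_mat k k \<Longrightarrow> \<exists>Q. Q \<in> carrier_mat k k \<and> unitary_mat Q \<and> A = Q * A * mat_adjoint (Q :: complex mat)"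
proof (intro exI conjI)
  assume A: "A \<in> carrier_mat k k"
  have "mat_adjoint (1\<^sub>m k) = (1\<^sub>m k :: complex mat)" by (rule eq_matI) auto
  then show "A = 1\<^sub>m k * A * mat_adjoint (1\<^sub>m k)" using A by simp
qed (auto simp: unitary_mat_one)

text \<open>In dimension two transposition acts on each single matrix like a unitary similarity, so
  transpositions of such factors can be inserted or removed freely.  If all larger factors are
  transposed, one inserts the missing ones and arrives at the transpose of the whole product, which
  has the same form at the conjugate vectors.\<close>

lemma numerical_range_partial_transpose:
  assumes dims: "\<forall>k\<in>{1..m}. n k \<ge> 2"
    and A: "\<forall>k\<in>{1..m}. A k \<in> carrier_mat (n k) (n k)"
    and \<psi>: "\<forall>k\<in>{1..m}. is_identity_map (n k) (\<psi> k) \<or> is_transposition_map (n k) (\<psi> k)"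
    and same: "(\<forall>k\<in>{1..m}. n k \<ge> 3 \<longrightarrow> is_identity_map (n k) (\<psi> k)) \<or>
      (\<forall>k\<in>{1..m}. n k \<ge> 3 \<longrightarrow> is_transposition_map (n k) (\<psi> k))"
  shows "numerical_range (kron_prod (\<lambda>k. \<psi> k (A k)) m) = numerical_range (kron_prod A m)"
proof -
  have pos: "\<forall>k\<in>{1..m}. n k > 0" using dims by fastforce
  have A': "\<forall>k\<in>{1..m}. transpose_mat (A k) \<in> carrier_mat (n k) (n k)" using A by auto
  have \<psi>A: "\<psi> k (A k) = A k \<or> \<psi> k (A k) = transpose_mat (A k)" if "k \<in> {1..m}" for k
    using bspec[OF \<psi> that] bspec[OF A that] by (auto simp: is_identity_map_def is_transposition_map_def)
  from same show ?thesis
  proof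
    assume id: "\<forall>k\<in>{1..m}. n k \<ge> 3 \<longrightarrow> is_identity_map (n k) (\<psi> k)"
    show ?thesis
    proof (rule numerical_range_kron_unitary[OF pos A])
      fix k assume k: "k \<in> {1..m}"
      have Ak: "A k \<in> carrier_mat (n k) (n k)" using A k by blast
      show "\<exists>Q. Q \<in> carrier_mat (n k) (n k) \<and> unitary_mat Q \<and> \<psi> k (A k) = Q * A k * mat_adjoint Q"
      proof (cases "n k = 2")
        case True
        then show ?thesis
          using \<psi>A[OF k] unitary_similar_refl[OF Ak] transpose_unitarily_similar_two[of "A k"] Ak by auto
      next
        case False
        then have "n k \<ge> 3" using bspec[OF dims k] by linarith
        then have "is_identity_map (n k) (\<psi> k)" using id k by blast
        then have "\<psi> k (A k) = A k" using Ak unfolding is_identity_map_def by blast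
        then show ?thesis using unitary_similar_refl[OF Ak] by simp
      qed
    qed
  next
    assume tr: "\<forall>k\<in>{1..m}. n k \<ge> 3 \<longrightarrow> is_transposition_map (n k) (\<psi> k)"
    have "numerical_range (kron_prod (\<lambda>k. \<psi> k (A k)) m) = numerical_range (kron_prod (\<lambda>k. transpose_mat (A k)) m)"
    proof (rule numerical_range_kron_unitary[OF pos A'])
      fix k assume k: "k \<in> {1..m}"
      have Ak: "A k \<in> carrier_mat (n k) (n k)" "transpose_mat (A k) \<in> carrier_mat (n k) (n k)" using A k by auto
      show "\<exists>Q. Q \<in> carrier_mat (n k) (n k) \<and> unitary_mat Q \<and> \<psi> k (A k) = Q * transpose_mat (A k) * mat_adjoint Q"
      proof (cases "n k = 2")
        case True
        then show ?thesis
          using \<psi>A[OF k] unitary_similar_refl[OF Ak(2)] transpose_unitarily_similar_two[of "transpose_mat (A k)"] Ak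
          by auto
      next
        case False
        then have "n k \<ge> 3" using bspec[OF dims k] by linarith
        then have "is_transposition_map (n k) (\<psi> k)" using tr k by blast
        then have "\<psi> k (A k) = transpose_mat (A k)" using Ak unfolding is_transposition_map_def by blast
        then show ?thesis using unitary_similar_refl[OF Ak(2)] by simp
      qed
    qed
    also have "\<dots> = numerical_range (kron_prod A m)"
      unfolding kron_prod_transpose[OF A pos]
      by (rule numerical_range_transpose[OF kron_prod_carrier[OF A]])
    finally show ?thesis .
  qed
qed

section \<open>Partial transposition in two larger factors\<close>

text \<open>A weighted version of the Schur test: by the inequality of arithmetic and geometric means,
  half the sum of the row sum and the column sum with the same index bounds the contribution of
  that index.\<close>

lemma Re_numerical_range_le:
  fixes c :: "nat \<Rightarrow> nat \<Rightarrow> real"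
  assumes M: "M \<in> carrier_mat N N" and M_c: "\<And>i j. i < N \<Longrightarrow> j < N \<Longrightarrow> M $$ (i, j) = of_real (c i j)"
    and nonneg: "\<And>i j. i < N \<Longrightarrow> j < N \<Longrightarrow> c i j \<ge> 0"
    and sums: "\<And>i. i < N \<Longrightarrow> (\<Sum>j=0..<N. c i j) + (\<Sum>j=0..<N. c j i) \<le> 2 * b"
    and z: "z \<in> numerical_range M"
  shows "Re z \<le> b"
proof -
  obtain u where u: "u \<in> carrier_vec N" "u \<bullet>c u = 1" and z: "z = (M *\<^sub>v u) \<bullet>c u"
    using z numerical_range_iff[OF M] by blast
  define v where "v = (\<lambda>i. (cmod (u $ i))\<^sup>2)"
  have norm: "(\<Sum>i=0..<N. v i) = 1"
    using cscalar_prod_self[OF u(1)] u(2) unfolding v_def by (metis of_real_eq_1_iff)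
  have "Re z = (\<Sum>i=0..<N. \<Sum>j=0..<N. c i j * Re (u $ j * cnj (u $ i)))"
    unfolding z cscalar_prod_mat_sum[OF M u(1) u(1)] Re_sum
    by (intro sum.cong refl) (auto simp: M_c mult.assoc)
  also have "\<dots> \<le> (\<Sum>i=0..<N. \<Sum>j=0..<N. c i j * ((v i + v j) / 2))"
  proof (intro sum_mono mult_left_mono)
    fix i j assume ij: "i \<in> {0..<N}" "j \<in> {0..<N}"
    have "Re (u $ j * cnj (u $ i)) \<le> cmod (u $ j) * cmod (u $ i)"
      using complex_Re_le_cmod[of "u $ j * cnj (u $ i)"] by (simp add: norm_mult)
    also have "\<dots> \<le> (v i + v j) / 2"
      using sum_squares_bound[of "cmod (u $ j)" "cmod (u $ i)"] by (simp add: v_def)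
    finally show "Re (u $ j * cnj (u $ i)) \<le> (v i + v j) / 2" .
    show "0 \<le> c i j" using nonneg ij by simp
  qed
  also have "\<dots> = ((\<Sum>i=0..<N. \<Sum>j=0..<N. v i * c i j) + (\<Sum>i=0..<N. \<Sum>j=0..<N. v j * c i j)) / 2"
  proof -
    have "c i j * ((v i + v j) / 2) = (v i * c i j + v j * c i j) / 2" for i j
      by (simp add: algebra_simps)
    then show ?thesis by (simp only: sum_divide_distrib[symmetric] sum.distrib)
  qed
  also have "(\<Sum>i=0..<N. \<Sum>j=0..<N. v j * c i j) = (\<Sum>i=0..<N. \<Sum>j=0..<N. v i * c j i)"
    by (rule sum.swap)
  also have "((\<Sum>i=0..<N. \<Sum>j=0..<N. v i * c i j) + (\<Sum>i=0..<N. \<Sum>j=0..<N. v i * c j i)) / 2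
      = (\<Sum>i=0..<N. v i * ((\<Sum>j=0..<N. c i j) + (\<Sum>j=0..<N. c j i))) / 2"
    by (simp add: sum_distrib_left sum.distrib distrib_left)
  also have "\<dots> \<le> (\<Sum>i=0..<N. v i * (2 * b)) / 2"
    using sums by (intro divide_right_mono sum_mono mult_left_mono) (auto simp: v_def)
  also have "\<dots> = b" using norm by (simp add: sum_distrib_right[symmetric])
  finally show ?thesis .
qed

text \<open>The shift with the two unequal weights \<open>1\<close> and \<open>2\<close>, padded by zeros, and a diagonal matrix unit
  for the factors that are not of interest.\<close>

definition shift_entry :: "nat \<Rightarrow> nat \<Rightarrow> real" where
  "shift_entry a b = (if a = 0 \<and> b = 1 then 1 else if a = 1 \<and> b = 2 then 2 else 0)"

definition corner_entry :: "nat \<Rightarrow> nat \<Rightarrow> real" where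
  "corner_entry a b = (if a = 0 \<and> b = 0 then 1 else 0)"

definition real_mat :: "nat \<Rightarrow> (nat \<Rightarrow> nat \<Rightarrow> real) \<Rightarrow> complex mat" where
  "real_mat d c = mat d d (\<lambda>(a, b). of_real (c a b))"

lemma real_mat_carrier: "real_mat d c \<in> carrier_mat d d"
  by (simp add: real_mat_def)

lemma transpose_real_mat: "transpose_mat (real_mat d c) = real_mat d (\<lambda>a b. c b a)"
  by (rule eq_matI) (auto simp: real_mat_def)

lemma shift_entry_sums:
  assumes "d \<ge> 3"
  shows "(\<Sum>b=0..<d. shift_entry a b) = (if a = 0 then 1 else if a = 1 then 2 else 0)"
    and "(\<Sum>b=0..<d. shift_entry b a) = (if a = 1 then 1 else if a = 2 then 2 else 0)"
proof -
  have *: "(\<Sum>b=0..<d. f b) = f 0 + f 1 + f 2" if "\<And>b. b \<ge> 3 \<Longrightarrow> f b = 0" for f :: "nat \<Rightarrow> real"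
  proof -
    have "(\<Sum>b=0..<d. f b) = (\<Sum>b=0..<3. f b)"
      using assms that by (intro sum.mono_neutral_right) auto
    then show ?thesis by (simp add: numeral_3_eq_3 numeral_2_eq_2)
  qed
  show "(\<Sum>b=0..<d. shift_entry a b) = (if a = 0 then 1 else if a = 1 then 2 else 0)"
    by (subst *) (auto simp: shift_entry_def)
  show "(\<Sum>b=0..<d. shift_entry b a) = (if a = 1 then 1 else if a = 2 then 2 else 0)"
    by (subst *) (auto simp: shift_entry_def)
qed

lemma sum_corner:
  "(\<Sum>b=0..<d. corner_entry a b) \<in> {0..1}" "(\<Sum>b=0..<d. corner_entry b a) \<in> {0..1}"
proof -
  have "(\<Sum>b=0..<d. if b = 0 then x else 0 :: real) \<in> {0..1}" if "x \<in> {0..1}" for x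
    using that by simp
  from this[of "if a = 0 then 1 else 0"]
  have *: "(\<Sum>b=0..<d. if b = 0 then if a = 0 then 1 else 0 else 0 :: real) \<in> {0..1}" by simp
  have "corner_entry a b = (if b = 0 then if a = 0 then 1 else 0 else 0)"
    "corner_entry b a = (if b = 0 then if a = 0 then 1 else 0 else 0)" for b
    by (auto simp: corner_entry_def)
  then show "(\<Sum>b=0..<d. corner_entry a b) \<in> {0..1}" "(\<Sum>b=0..<d. corner_entry b a) \<in> {0..1}"
    using * by simp_all
qed

lemma kron_real_mat_index:
  assumes pos: "\<forall>q\<in>{1..m}. n q > 0"
    and ij: "i < (\<Prod>q=1..m. n q)" "j < (\<Prod>q=1..m. n q)"
  shows "kron_prod (\<lambda>q. real_mat (n q) (c q)) m $$ (i, j)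
    = of_real (\<Prod>q=1..m. c q (digit n m i q) (digit n m j q))"
proof -
  have "kron_prod (\<lambda>q. real_mat (n q) (c q)) m $$ (i, j)
      = (\<Prod>q=1..m. real_mat (n q) (c q) $$ (digit n m i q, digit n m j q))"
    using ij by (intro kron_prod_index) (auto simp: real_mat_carrier)
  also have "\<dots> = (\<Prod>q=1..m. of_real (c q (digit n m i q) (digit n m j q)))"
    by (intro prod.cong refl) (simp add: real_mat_def digit_less[OF pos])
  finally show ?thesis by simp
qed

text \<open>Let \<open>B\<close> be the shift with weights \<open>1\<close> and \<open>2\<close>.  In the product of \<open>B\<close> with itself the weights
  on the diagonal path are squared to \<open>1\<close> and \<open>4\<close>, and the vector with entries \<open>1, 4, 4\<close> on this path has
  the Rayleigh quotient \<open>68 / 33 > 2\<close>.  In the product of \<open>B\<close> with its transpose the weights \<open>1\<close> and \<open>4\<close>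
  sit on separate edges, and the row sum and the column sum at each index add up to at most \<open>4\<close>.\<close>

lemma numerical_range_partial_transpose_differs:
  assumes dims: "\<forall>q\<in>{1..m}. n q \<ge> 2"
    and k: "k \<in> {1..m}" "n k \<ge> 3" and l: "l \<in> {1..m}" "n l \<ge> 3" and kl: "k \<noteq> l"
  defines "A \<equiv> \<lambda>q. real_mat (n q) (if q = k \<or> q = l then shift_entry else corner_entry)"
  shows "numerical_range (kron_prod (\<lambda>q. if q = l then transpose_mat (A q) else A q) m)
    \<noteq> numerical_range (kron_prod A m)"
proof -
  have pos: "\<forall>q\<in>{1..m}. n q > 0" using dims by fastforce
  define N where "N = (\<Prod>q=1..m. n q)"
  define cA where "cA = (\<lambda>q. if q = k \<or> q = l then shift_entry else corner_entry)"
  define cB where "cB = (\<lambda>q. if q = l then (\<lambda>a b. shift_entry b a) else cA q)"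
  have nonneg: "shift_entry a b \<ge> 0" "corner_entry a b \<ge> 0" for a b
    by (auto simp: shift_entry_def corner_entry_def)
  have A: "A = (\<lambda>q. real_mat (n q) (cA q))" unfolding A_def cA_def ..
  have B: "(\<lambda>q. if q = l then transpose_mat (A q) else A q) = (\<lambda>q. real_mat (n q) (cB q))"
    by (auto simp: A cA_def cB_def transpose_real_mat)
  let ?A = "kron_prod A m" and ?B = "kron_prod (\<lambda>q. if q = l then transpose_mat (A q) else A q) m"
  have A_car: "?A \<in> carrier_mat N N" unfolding N_def A by (rule kron_prod_carrier) (simp add: real_mat_carrier)
  have B_car: "?B \<in> carrier_mat N N" unfolding N_def B by (rule kron_prod_carrier) (simp add: real_mat_carrier)
  have split: "(\<Prod>q=1..m. f q) = f k * f l * (\<Prod>q\<in>{1..m} - {k} - {l}. f q)" for f :: "nat \<Rightarrow> real"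
    using k l kl prod.remove[of "{1..m}" k f] prod.remove[of "{1..m} - {k}" l f] by (simp add: mult.assoc)
  have upper: "Re z \<le> 2" if z: "z \<in> numerical_range ?B" for z
  proof (rule Re_numerical_range_le[OF B_car _ _ _ z])
    let ?c = "\<lambda>i j. \<Prod>q=1..m. cB q (digit n m i q) (digit n m j q)"
    show "?B $$ (i, j) = of_real (?c i j)" if "i < N" "j < N" for i j
      using that unfolding B N_def by (rule kron_real_mat_index[OF pos])
    show "?c i j \<ge> 0" for i j
      by (intro prod_nonneg) (auto simp: cA_def cB_def nonneg)
    fix i assume i: "i < N"
    define R where "R = (\<Prod>q\<in>{1..m} - {k} - {l}. \<Sum>b=0..<n q. corner_entry (digit n m i q) b)"
    define S where "S = (\<Prod>q\<in>{1..m} - {k} - {l}. \<Sum>b=0..<n q. corner_entry b (digit n m i q))"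
    have RS: "0 \<le> R" "R \<le> 1" "0 \<le> S" "S \<le> 1"
      unfolding R_def S_def using sum_corner by (auto intro!: prod_nonneg prod_le_1)
    define \<rho> where "\<rho> = (\<lambda>a::nat. if a = 0 then 1 else if a = 1 then 2 else 0 :: real)"
    define \<sigma> where "\<sigma> = (\<lambda>a::nat. if a = 1 then 1 else if a = 2 then 2 else 0 :: real)"
    have special: "cB k = shift_entry" "cB l = (\<lambda>a b. shift_entry b a)"
      using kl by (auto simp: cA_def cB_def)
    have factor: "(\<Sum>b=0..<n k. cB k a b) = \<rho> a" "(\<Sum>b=0..<n l. cB l a b) = \<sigma> a"
      "(\<Sum>b=0..<n k. cB k b a) = \<sigma> a" "(\<Sum>b=0..<n l. cB l b a) = \<rho> a" for a
      unfolding special \<rho>_def \<sigma>_def shift_entry_sums[OF k(2)] shift_entry_sums[OF l(2)] by (rule refl)+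
    have other: "cB q = corner_entry" if "q \<in> {1..m} - {k} - {l}" for q
      using that by (auto simp: cA_def cB_def)
    let ?a = "digit n m i k" and ?b = "digit n m i l"
    have "(\<Sum>j=0..<N. ?c i j) = (\<Prod>q=1..m. \<Sum>b=0..<n q. cB q (digit n m i q) b)"
      unfolding N_def by (rule sum_prod_digit[OF pos])
    also have "\<dots> = \<rho> ?a * \<sigma> ?b * R"
      unfolding split R_def factor by (intro arg_cong2[of _ _ _ _ "(*)"] prod.cong refl) (simp add: other)
    finally have row: "(\<Sum>j=0..<N. ?c i j) = \<rho> ?a * \<sigma> ?b * R" .
    have "(\<Sum>j=0..<N. ?c j i) = (\<Prod>q=1..m. \<Sum>b=0..<n q. cB q b (digit n m i q))"
      unfolding N_def by (rule sum_prod_digit[OF pos])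
    also have "\<dots> = \<sigma> ?a * \<rho> ?b * S"
      unfolding split S_def factor by (intro arg_cong2[of _ _ _ _ "(*)"] prod.cong refl) (simp add: other)
    finally have column: "(\<Sum>j=0..<N. ?c j i) = \<sigma> ?a * \<rho> ?b * S" .
    have "\<rho> ?a * \<sigma> ?b * R \<le> \<rho> ?a * \<sigma> ?b" "\<sigma> ?a * \<rho> ?b * S \<le> \<sigma> ?a * \<rho> ?b"
      using RS by (auto intro!: mult_left_le simp: \<rho>_def \<sigma>_def)
    moreover have "\<rho> a * \<sigma> b + \<sigma> a * \<rho> b \<le> 4" for a b by (simp add: \<rho>_def \<sigma>_def)
    then have "\<rho> ?a * \<sigma> ?b + \<sigma> ?a * \<rho> ?b \<le> 4" .
    ultimately show "(\<Sum>j=0..<N. ?c i j) + (\<Sum>j=0..<N. ?c j i) \<le> 2 * 2"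
      unfolding row column by linarith
  qed
  have ex: "\<exists>i<N. \<forall>q\<in>{1..m}. digit n m i q = (if q = k \<or> q = l then a else 0)" if "a < 3" for a
    unfolding N_def using that k l pos by (intro digit_surj) auto
  define g where "g = (\<lambda>a. SOME i. i < N \<and> (\<forall>q\<in>{1..m}. digit n m i q = (if q = k \<or> q = l then a else 0)))"
  have gg: "g a < N \<and> (\<forall>q\<in>{1..m}. digit n m (g a) q = (if q = k \<or> q = l then a else 0))" if "a < 3" for a
    unfolding g_def by (rule someI_ex[OF ex[OF that]])
  have g: "g a < N" if "a < 3" for a using gg[OF that] by blast
  have g_digit: "digit n m (g a) q = (if q = k \<or> q = l then a else 0)" if "a < 3" "q \<in> {1..m}" for a q
    using gg[OF that(1)] that(2) by blast
  have g_eq: "g a = g b \<longleftrightarrow> a = b" if "a < 3" "b < 3" for a b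
  proof -
    have "digit n m (g a) k = a" "digit n m (g b) k = b"
      using g_digit[OF that(1) k(1)] g_digit[OF that(2) k(1)] by (simp_all only: simp_thms if_True)
    then show ?thesis by metis
  qed
  have entry: "?A $$ (g a, g b) = of_real ((shift_entry a b)\<^sup>2)" if "a < 3" "b < 3" for a b
  proof -
    have "?A $$ (g a, g b) = of_real (\<Prod>q=1..m. cA q (digit n m (g a) q) (digit n m (g b) q))"
      using g[OF that(1)] g[OF that(2)] unfolding A N_def by (rule kron_real_mat_index[OF pos])
    also have "(\<Prod>q=1..m. cA q (digit n m (g a) q) (digit n m (g b) q))
        = shift_entry a b * shift_entry a b * (\<Prod>q\<in>{1..m} - {k} - {l}. 1)"
      unfolding split using k l kl that
      by (intro arg_cong2[of _ _ _ _ "(*)"] prod.cong refl) (auto simp: g_digit cA_def corner_entry_def)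
    finally show ?thesis by (simp add: power2_eq_square)
  qed
  \<comment> \<open>the entries of the test vector along the path \<open>g 0, g 1, g 2\<close>\<close>
  define w where "w = (\<lambda>a::nat. if a = 0 then 1 else 4 :: complex)"
  define u where "u = vec N (\<lambda>i. if i = g 0 then w 0 else if i = g 1 then w 1 else if i = g 2 then w 2 else 0)"
  have u: "u \<in> carrier_vec N" by (simp add: u_def)
  have u_g: "u $ g 0 = 1" "u $ g 1 = 4" "u $ g 2 = 4"
    using g g_eq by (auto simp: u_def w_def)
  have restrict: "(\<Sum>i=0..<N. f i) = f (g 0) + f (g 1) + f (g 2)"
    if "\<And>i. i < N \<Longrightarrow> u $ i = 0 \<Longrightarrow> f i = 0" for f :: "nat \<Rightarrow> complex"
  proof -
    have "(\<Sum>i=0..<N. f i) = (\<Sum>i\<in>{g 0, g 1, g 2}. f i)"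
      using g that by (intro sum.mono_neutral_right) (auto simp: u_def)
    then show ?thesis using g_eq by (simp add: add.assoc)
  qed
  have uu: "u \<bullet>c u = 33"
    unfolding cscalar_prod_sum[OF u u] by (subst restrict) (auto simp: u_g u_g[unfolded One_nat_def])
  have "(?A *\<^sub>v u) \<bullet>c u = (\<Sum>i=0..<N. (\<Sum>j=0..<N. ?A $$ (i, j) * u $ j) * cnj (u $ i))"
    unfolding cscalar_prod_mat_sum[OF A_car u u] sum_distrib_right ..
  also have "\<dots> = (\<Sum>i=0..<N. (?A $$ (i, g 0) + ?A $$ (i, g 1) * 4 + ?A $$ (i, g 2) * 4) * cnj (u $ i))"
    by (subst restrict) (auto simp: u_g u_g[unfolded One_nat_def])
  also have "\<dots> = 68"
    by (subst restrict) (auto simp: u_g u_g[unfolded One_nat_def] entry shift_entry_def)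
  finally have Au: "(?A *\<^sub>v u) \<bullet>c u = 68" .
  have "u \<noteq> 0\<^sub>v N" using uu u by auto
  then have "68 / 33 \<in> numerical_range ?A"
    using numerical_range_homogeneous[OF A_car u] Au uu by simp
  moreover have "\<not> Re (68 / 33) \<le> 2" by simp
  ultimately show ?thesis using upper by metis
qed

section \<open>The characterisation\<close>

theorem theorem3p1:
  fixes m N :: nat and n :: "nat \<Rightarrow> nat" and \<phi> :: "complex mat \<Rightarrow> complex mat"
  assumes m: "m \<ge> 2"
    and n: "\<forall>k\<in>{1..m}. n k \<ge> 2"
    and N: "N = (\<Prod>k=1..m. n k)"
    and linear: "linear_map class_ring (module_mat TYPE(complex) N N) (module_mat TYPE(complex) N N) \<phi>"
  shows
    "(\<forall>A. (\<forall>k\<in>{1..m}. A k \<in> carrier_mat (n k) (n k)) \<longrightarrow>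
        numerical_range (\<phi> (kron_prod A m)) = numerical_range (kron_prod A m))
     \<longleftrightarrow>
     (\<exists>U \<psi>. U \<in> carrier_mat N N \<and> unitary_mat U \<and>
        (\<forall>k\<in>{1..m}. is_identity_map (n k) (\<psi> k) \<or> is_transposition_map (n k) (\<psi> k)) \<and>
        (\<forall>A. (\<forall>k\<in>{1..m}. A k \<in> carrier_mat (n k) (n k)) \<longrightarrow>
           \<phi> (kron_prod A m) = U * kron_prod (\<lambda>k. \<psi> k (A k)) m * mat_adjoint U) \<and>
        ((\<forall>k\<in>{1..m}. n k \<ge> 3 \<longrightarrow> is_identity_map (n k) (\<psi> k)) \<or>
         (\<forall>k\<in>{1..m}. n k \<ge> 3 \<longrightarrow> is_transposition_map (n k) (\<psi> k))))"
    (is "?preserves \<longleftrightarrow> ?standard")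
proof
  interpret L: linear_map class_ring "module_mat TYPE(complex) N N" "module_mat TYPE(complex) N N" \<phi>
    by (rule linear)
  assume range: ?preserves
  interpret P: tensor_range_preserver m N n \<phi>
  proof
    show "\<phi> X \<in> carrier_mat N N" if "X \<in> carrier_mat N N" for X
      using L.f_hom that by (auto simp: LinearCombinations.module_hom_def module_mat_simps)
    show "\<phi> (X + Y) = \<phi> X + \<phi> Y" if "X \<in> carrier_mat N N" "Y \<in> carrier_mat N N" for X Y
      using L.f_add[of X Y] that by (simp add: module_mat_simps)
    show "\<phi> (c \<cdot>\<^sub>m X) = c \<cdot>\<^sub>m \<phi> X" if "X \<in> carrier_mat N N" for c X
      using L.f_smult[of c X] that by (simp add: module_mat_simps class_ring_simps)
  qed (use n N range in auto)
  obtain U T where U: "U \<in> carrier_mat N N" "unitary_mat U"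
    and \<phi>: "\<And>A. \<forall>k\<in>{1..m}. A k \<in> carrier_mat (n k) (n k) \<Longrightarrow> \<phi> (kron_prod A m)
      = U * kron_prod (\<lambda>k. if k \<in> T then transpose_mat (A k) else A k) m * mat_adjoint U"
    using P.image_of_kron by blast
  define \<psi> where "\<psi> = (\<lambda>k X. if k \<in> T then transpose_mat X else X :: complex mat)"
  have id: "is_identity_map (n k) (\<psi> k)" if "k \<notin> T" for k
    using that by (simp add: \<psi>_def is_identity_map_def)
  have tr: "is_transposition_map (n k) (\<psi> k)" if "k \<in> T" for k
    using that by (simp add: \<psi>_def is_transposition_map_def)
  have same: "l \<in> T \<longleftrightarrow> k \<in> T" if k: "k \<in> {1..m}" "n k \<ge> 3" and l: "l \<in> {1..m}" "n l \<ge> 3" for k l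
  proof -
    have "\<not> (k \<notin> T \<and> l \<in> T)" if k: "k \<in> {1..m}" "n k \<ge> 3" and l: "l \<in> {1..m}" "n l \<ge> 3" for k l
    proof
      assume kl: "k \<notin> T \<and> l \<in> T"
      then have ne: "k \<noteq> l" by auto
      \<comment> \<open>the other factors are symmetric, so only the transposition in \<open>l\<close> is visible\<close>
      let ?A = "\<lambda>q. real_mat (n q) (if q = k \<or> q = l then shift_entry else corner_entry)"
      let ?B = "\<lambda>q. if q \<in> T then transpose_mat (?A q) else ?A q"
      have A: "\<forall>q\<in>{1..m}. ?A q \<in> carrier_mat (n q) (n q)" by (simp add: real_mat_carrier)
      have B: "\<forall>q\<in>{1..m}. ?B q \<in> carrier_mat (n q) (n q)" by (simp add: real_mat_carrier)
      have corner: "(\<lambda>a b. corner_entry b a) = corner_entry" by (auto simp: corner_entry_def fun_eq_iff)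
      have "kron_prod ?B m = kron_prod (\<lambda>q. if q = l then transpose_mat (?A q) else ?A q) m"
        using kl by (intro kron_prod_cong) (auto simp: transpose_real_mat corner)
      moreover have "numerical_range (\<phi> (kron_prod ?A m)) = numerical_range (kron_prod ?A m)"
        by (rule range[rule_format, OF bspec[OF A]])
      then have "numerical_range (kron_prod ?B m) = numerical_range (kron_prod ?A m)"
        unfolding \<phi>[OF A] numerical_range_unitary[OF P.kron_carrier_N[OF B] U] .
      ultimately show False
        using numerical_range_partial_transpose_differs[OF n k l ne] by simp
    qed
    then show ?thesis using k l by blast
  qed
  show ?standard
  proof (intro exI conjI)
    show "\<forall>k\<in>{1..m}. is_identity_map (n k) (\<psi> k) \<or> is_transposition_map (n k) (\<psi> k)"
      using id tr by blast
    show "\<forall>A. (\<forall>k\<in>{1..m}. A k \<in> carrier_mat (n k) (n k)) \<longrightarrow>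
      \<phi> (kron_prod A m) = U * kron_prod (\<lambda>k. \<psi> k (A k)) m * mat_adjoint U"
      using \<phi> by (simp add: \<psi>_def)
    show "(\<forall>k\<in>{1..m}. n k \<ge> 3 \<longrightarrow> is_identity_map (n k) (\<psi> k)) \<or>
      (\<forall>k\<in>{1..m}. n k \<ge> 3 \<longrightarrow> is_transposition_map (n k) (\<psi> k))"
      using id tr same by blast
  qed (fact U)+
next
  assume ?standard
  then obtain U \<psi> where U: "U \<in> carrier_mat N N" "unitary_mat U"
    and \<psi>: "\<forall>k\<in>{1..m}. is_identity_map (n k) (\<psi> k) \<or> is_transposition_map (n k) (\<psi> k)"
    and \<phi>: "\<forall>A. (\<forall>k\<in>{1..m}. A k \<in> carrier_mat (n k) (n k)) \<longrightarrow>
      \<phi> (kron_prod A m) = U * kron_prod (\<lambda>k. \<psi> k (A k)) m * mat_adjoint U"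
    and same: "(\<forall>k\<in>{1..m}. n k \<ge> 3 \<longrightarrow> is_identity_map (n k) (\<psi> k)) \<or>
      (\<forall>k\<in>{1..m}. n k \<ge> 3 \<longrightarrow> is_transposition_map (n k) (\<psi> k))"
    by blast
  show ?preserves
  proof (intro allI impI)
    fix A :: "nat \<Rightarrow> complex mat" assume A: "\<forall>k\<in>{1..m}. A k \<in> carrier_mat (n k) (n k)"
    have \<psi>A: "\<forall>k\<in>{1..m}. \<psi> k (A k) \<in> carrier_mat (n k) (n k)"
    proof
      fix k assume k: "k \<in> {1..m}"
      show "\<psi> k (A k) \<in> carrier_mat (n k) (n k)"
        using bspec[OF \<psi> k] bspec[OF A k] by (auto simp: is_identity_map_def is_transposition_map_def)
    qed
    have "numerical_range (\<phi> (kron_prod A m)) = numerical_range (kron_prod (\<lambda>k. \<psi> k (A k)) m)"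
      using \<phi> A numerical_range_unitary[OF kron_prod_carrier[OF \<psi>A, folded N] U] by simp
    also have "\<dots> = numerical_range (kron_prod A m)"
      by (rule numerical_range_partial_transpose[OF n A \<psi> same])
    finally show "numerical_range (\<phi> (kron_prod A m)) = numerical_range (kron_prod A m)" .
  qed
qed

end
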